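(* Let $S_t=S_0e^{X_t}$, $S_0>0$, where $(X_t)$ is a real Lévy process under $\mathbb{P}$ with triplet $(\sigma^2,b,\nu)$ satisfying the standing assumptions listed in the context. Assume that $$(i)\ \int_{|x|>1}e^x\nu(x)\,dx<\infty\qquad\text{and}\qquad (ii)\ \sup_{|x|>\varepsilon}e^x\nu(x)<\infty\ \text{ for every }\varepsilon>0.$$ Then for every strike $K>S_0$, with $k=\log(K/S_0)>0$, $$\frac1t\,\mathbb{E}(S_t-K)_+ \;=\; S_0\int_{-\infty}^{\infty}(e^x-e^k)_+\,\nu(x)\,dx\;+\;\frac12 S_0\big[d_2^*(k)-e^k d_2(k)\big]\,t+o(t)\qquad (t\to0),$$ where $d_2(k)=d_2(k;b,\sigma,\nu)$ and $d_2^*(k)=d_2(k;b^*,\sigma,\nu^* )$ with $$\nu^*(x)=e^x\nu(x),\qquad b^*=b+\int_{|x|\le1}x(e^x-1)\nu(x)\,dx+\sigma^2 .$$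
   Context: Triplet convention: $\mathbb{E}e^{iuX_t}=\exp\{t(ibu-\tfrac12\sigma^2u^2+\int(e^{iux}-1-iux1_{|x|\le1})\nu(dx))\}$, with $\sigma\ge 0$. Standing assumptions: zero interest rate and dividends; $\int_{|x|>1}e^x\nu(dx)<\infty$; the martingale condition $b+\tfrac12\sigma^2+\int_{-\infty}^\infty(e^x-1-x1_{|x|\le1})\nu(dx)=0$ (so $S$ is a $\mathbb{P}$-martingale); the Lévy measure $\nu(dx)$ has a positive density, also written $\nu(x)$, which is $C^1$ on $\mathbb{R}\setminus\{0\}$ and satisfies $\sup_{|x|>\varepsilon}\nu(x)<\infty$ for every $\varepsilon>0$. Definition of $d_2$: for $y>0$, $$\begin{aligned} d_2(y;b,\sigma,\nu)=&-\sigma^2\nu'(y)+2b\,\nu(y)-\nu[y,\infty)^2+\nu(\tfrac12y,y)^2+2\int_{-\infty}^{-y/2}\int_{y-x}^{y}\nu(u)\nu(x)\,du\,dx\\&-2\nu(y)\,I(y)+2\int_{-y/2}^{y/2}\int_{y-x}^{y}(\nu(u)-\nu(y))\nu(x)\,du\,dx,\end{aligned}$$ where $\nu[y,\infty)$ and $\nu(\tfrac12 y,y)$ denote the $\nu$-measures of these intervals, inner integrals are oriented ($\int_{y-x}^y=-\int_y^{y-x}$ when $x<0$), and $I(y)=\int_{y/2<|x|\le1}x\nu(x)\,dx$ if $y\le2$, $I(y)=-\int_{1<|x|\le y/2}x\nu(x)\,dx$ if $y>2$. *)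

theory Defs
  imports "HOL-Probability.Probability" "HOL-Library.Landau_Symbols"
begin

text \<open>
  A L\'evy process as in Sato's book. Time is the half line \<open>{0..}\<close>; the values of \<open>X\<close> at
  negative times are unconstrained and never used.
\<close>

locale levy_process = prob_space M
  for M :: "'a measure" +
  fixes X :: "real \<Rightarrow> 'a \<Rightarrow> real"
  assumes random_variable_at: "0 \<le> t \<Longrightarrow> random_variable borel (X t)"
    and starts_at_zero: "AE \<omega> in M. X 0 \<omega> = 0"
    and independent_increments:
      "0 \<le> \<tau> 0 \<Longrightarrow> (\<And>i. i < n \<Longrightarrow> \<tau> i < \<tau> (Suc i)) \<Longrightarrow>
         indep_vars (\<lambda>_. borel) (\<lambda>i \<omega>. X (\<tau> (Suc i)) \<omega> - X (\<tau> i) \<omega>) {..<n::nat}"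
    and stationary_increments:
      "0 \<le> s \<Longrightarrow> 0 \<le> h \<Longrightarrow>
         distr M borel (\<lambda>\<omega>. X (s + h) \<omega> - X s \<omega>) = distr M borel (X h)"
    and stochastically_continuous:
      "0 \<le> t \<Longrightarrow> 0 < \<epsilon> \<Longrightarrow>
         ((\<lambda>s. prob {\<omega> \<in> space M. \<epsilon> < \<bar>X s \<omega> - X t \<omega>\<bar>}) \<longlongrightarrow> 0) (at t within {0..})"
    and cadlag_paths:
      "AE \<omega> in M. \<forall>t\<ge>0. continuous (at_right t) (\<lambda>s. X s \<omega>) \<and>
         (0 < t \<longrightarrow> (\<exists>l. ((\<lambda>s. X s \<omega>) \<longlongrightarrow> l) (at_left t)))"

definition levy_measure :: "real measure \<Rightarrow> bool" where
  "levy_measure N \<longleftrightarrow> sets N = sets borel \<and> emeasure N {0} = 0 \<and>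
     (\<integral>\<^sup>+x. ennreal (min 1 (x\<^sup>2)) \<partial>N) < \<infinity>"

definition levy_exponent :: "real \<Rightarrow> real \<Rightarrow> real measure \<Rightarrow> real \<Rightarrow> complex" where
  "levy_exponent b \<sigma> N u =
     \<i> * of_real b * of_real u - of_real (\<sigma>\<^sup>2 * u\<^sup>2 / 2)
     + (CLINT x|N. iexp (u * x) - 1 - \<i> * of_real (u * x * indicator {-1..1} x))"

text \<open>\<open>X\<close> is a L\'evy process under \<open>M\<close> with characteristic triplet \<open>(\<sigma>\<^sup>2, b, N)\<close>.\<close>

definition levy_process_with_triplet ::
  "'a measure \<Rightarrow> (real \<Rightarrow> 'a \<Rightarrow> real) \<Rightarrow> real \<Rightarrow> real \<Rightarrow> real measure \<Rightarrow> bool" where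
  "levy_process_with_triplet M X \<sigma> b N \<longleftrightarrow>
     levy_process M X \<and> 0 \<le> \<sigma> \<and> levy_measure N \<and>
     (\<forall>t\<ge>0. \<forall>u. char (distr M borel (X t)) u = exp (of_real t * levy_exponent b \<sigma> N u))"

definition d2_drift :: "(real \<Rightarrow> real) \<Rightarrow> real \<Rightarrow> real" where
  "d2_drift \<nu> y =
     (if y \<le> 2 then (LBINT x:{x. y / 2 < \<bar>x\<bar> \<and> \<bar>x\<bar> \<le> 1}. x * \<nu> x)
      else - (LBINT x:{x. 1 < \<bar>x\<bar> \<and> \<bar>x\<bar> \<le> y / 2}. x * \<nu> x))"

text \<open>
  The interval integrals \<open>LBINT u=a..c. f u\<close> are oriented: for \<open>c < a\<close> they are
  \<open>- (LBINT u=c..a. f u)\<close>.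
\<close>

definition d2 :: "real \<Rightarrow> real \<Rightarrow> real \<Rightarrow> (real \<Rightarrow> real) \<Rightarrow> real" where
  "d2 y b \<sigma> \<nu> =
     - \<sigma>\<^sup>2 * deriv \<nu> y + 2 * b * \<nu> y
     - (measure (density lborel \<nu>) {y..})\<^sup>2
     + (measure (density lborel \<nu>) {y / 2<..<y})\<^sup>2
     + 2 * (LBINT x=-\<infinity>..-y / 2. (LBINT u=y - x..y. \<nu> u * \<nu> x))
     - 2 * \<nu> y * d2_drift \<nu> y
     + 2 * (LBINT x=-y / 2..y / 2. (LBINT u=y - x..y. (\<nu> u - \<nu> y) * \<nu> x))"

definition nu_star :: "(real \<Rightarrow> real) \<Rightarrow> real \<Rightarrow> real" where
  "nu_star \<nu> x = exp x * \<nu> x"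

definition b_star :: "real \<Rightarrow> real \<Rightarrow> (real \<Rightarrow> real) \<Rightarrow> real" where
  "b_star b \<sigma> \<nu> = b + (LBINT x:{-1..1}. x * (exp x - 1) * \<nu> x) + \<sigma>\<^sup>2"

end

theory Submission
  imports Defs "HOL-Real_Asymp.Real_Asymp"
begin

text \<open>
  Only the one-dimensional laws of \<open>X\<close> matter. Fix a small level \<open>e\<close> and split the law at time \<open>t\<close>
  into the convolution of a law \<open>Q\<close>, which carries drift, Gaussian part and the compensated jumps of size
  at most \<open>e\<close>, and a compound Poisson law of the larger jumps; uniqueness of characteristic functions
  gives the splitting, and a Helly argument the existence of \<open>Q\<close>. Let \<open>h x = max 0 (exp x - exp k)\<close> and
  condition on the number of big jumps. With none, \<open>Q\<close> has to exceed \<open>k\<close>, and its exponential moments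
  make this \<open>O(t ^ 3)\<close> when \<open>e\<close> is small compared with \<open>k\<close>. With one, the integral of \<open>h (x + z)\<close>
  over the big jumps \<open>z\<close> is twice differentiable in \<open>x\<close> near \<open>0\<close>, and a Taylor expansion uses only
  the first two moments of \<open>Q\<close>. With two, the shift by \<open>Q\<close> is negligible; three or more contribute
  \<open>O(t ^ 3)\<close>. This yields a second-order coefficient up to an error that vanishes with \<open>e\<close>.

  The payoff is treated directly, so no change of measure for the process is needed. The starred functional
  appears only in the final identification: splitting all integrals in \<open>d2\<close> at \<open>e\<close> expresses it through
  the truncated measure, for \<open>\<nu>\<close> as well as for \<open>nu_star \<nu>\<close>, and the martingale condition
  makes the two coefficients agree up to the variance of the jumps of size at most \<open>e\<close>.
\<close>

subsection \<open>Convolutions and compound Poisson laws\<close>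

text \<open>Two features shape the argument. First, the weak limit that constructs the small-jump
  law hands over only upper bounds on exponential moments. They determine the mean and second moment
  of \<open>Q\<close> up to \<open>o(t)\<close> and an error of order \<open>t * v\<close>, where
  \<open>v\<close> is the variance rate of the jumps below \<open>e\<close>. So no single
  \<open>e\<close> gives the exact coefficient; \<open>e\<close> is fixed while \<open>t\<close>
  tends to \<open>0\<close> and is sent to \<open>0\<close> afterwards, which is harmless because
  the limit coefficient does not depend on it. Second, an excursion of \<open>Q\<close> beyond a
  fixed \<delta> costs \<open>t ^ 3\<close> only if \<open>e\<close> is at most
  \<delta>\<open>/ 6\<close>, whereas \<delta> comes from a Taylor expansion of an integral over the
  jumps above \<open>e\<close>. There is no circle: near \<open>0\<close> this integral is
  independent of \<open>e\<close>, since any jump that lifts a small \<open>x\<close> above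
  \<open>k\<close> is automatically a big one. The martingale condition enters because the direct
  computation pairs the jump rate of \<open>N\<close> with the tail of the tilted measure, while the
  starred functional has the tilted jump rate; the condition, split at \<open>e\<close>, exchanges
  the two rates.\<close>

lemma real_distributionI:
  "prob_space P \<Longrightarrow> sets P = sets borel \<Longrightarrow> real_distribution P"
  by (simp add: real_distribution_def real_distribution_axioms_def)

lemma real_distributionD:
  assumes "real_distribution P"
  shows "prob_space P" "finite_measure P" "sets P = sets borel" "space P = UNIV"
    "emeasure P UNIV = 1" "sigma_finite_measure P"
    "measure P UNIV = 1"
proof -
  interpret real_distribution P by fact
  show "prob_space P" "finite_measure P" "sigma_finite_measure P" by unfold_locales
  show "sets P = sets borel" "space P = UNIV" by simp_all
  then show "emeasure P UNIV = 1" "measure P UNIV = 1" using emeasure_space_1 prob_space by simp_all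
qed

lemma real_distribution_uniform_measure:
  assumes "sets N = sets borel" "emeasure N A \<noteq> 0" "emeasure N A \<noteq> \<infinity>"
  shows "real_distribution (uniform_measure N A)"
  using assms by (intro real_distributionI prob_space_uniform_measure) (auto simp: uniform_measure_def)

lemma real_distribution_convolution:
  assumes "real_distribution P" "real_distribution Q"
  shows "real_distribution (P \<star> Q)"
proof (rule real_distributionI)
  interpret P: real_distribution P by fact
  interpret Q: real_distribution Q by fact
  interpret PQ: pair_prob_space P Q ..
  show "prob_space (P \<star> Q)"
    unfolding convolution_def by (rule PQ.P.prob_space_distr) measurable
qed simp

lemma nn_integral_convolution':
  assumes "real_distribution P" "real_distribution Q" "f \<in> borel_measurable borel"
  shows "(\<integral>\<^sup>+x. f x \<partial>(P \<star> Q)) = (\<integral>\<^sup>+x. \<integral>\<^sup>+y. f (x + y) \<partial>Q \<partial>P)"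
  by (rule nn_integral_convolution) (use assms real_distributionD in auto)

lemma integral_convolution:
  fixes f :: "real \<Rightarrow> 'b::{banach, second_countable_topology}"
  assumes "real_distribution P" "real_distribution Q" and f: "integrable (P \<star> Q) f"
  shows "(LINT x|(P \<star> Q). f x) = (LINT x|P. LINT y|Q. f (x + y))"
proof -
  interpret P: real_distribution P by fact
  interpret Q: real_distribution Q by fact
  interpret PQ: pair_prob_space P Q ..
  have m[measurable]: "f \<in> borel_measurable borel"
    using f by (auto dest!: borel_measurable_integrable)
  have i: "integrable (P \<Otimes>\<^sub>M Q) (\<lambda>z. f (fst z + snd z))"
    using f unfolding convolution_def by (subst (asm) integrable_distr_eq) (auto simp: case_prod_beta)
  have "(LINT x|(P \<star> Q). f x) = (LINT z|(P \<Otimes>\<^sub>M Q). f (fst z + snd z))"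
    unfolding convolution_def by (subst integral_distr) (auto simp: case_prod_beta)
  also have "\<dots> = (LINT x|P. LINT y|Q. f (x + y))"
    using PQ.integral_fst'[OF i] by simp
  finally show ?thesis .
qed

lemma char_convolution:
  assumes P: "real_distribution P" and Q: "real_distribution Q"
  shows "char (P \<star> Q) u = char P u * char Q u"
proof -
  interpret P: real_distribution P by fact
  interpret Q: real_distribution Q by fact
  interpret PQ: real_distribution "P \<star> Q" by (rule real_distribution_convolution[OF P Q])
  have "char (P \<star> Q) u = (CLINT x|P. CLINT y|Q. iexp (u * (x + y)))"
    unfolding char_def by (rule integral_convolution[OF P Q]) (auto intro!: PQ.integrable_iexp)
  also have "\<dots> = (CLINT x|P. CLINT y|Q. iexp (u * x) * iexp (u * y))"
    by (simp add: distrib_left exp_add)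
  also have "\<dots> = char P u * char Q u"
    by (simp add: char_def)
  finally show ?thesis .
qed

lemma real_distribution_return: "real_distribution (return borel (a::real))"
  by (intro real_distributionI prob_space_return) auto

primrec conv_power :: "real measure \<Rightarrow> nat \<Rightarrow> real measure" where
  "conv_power P 0 = return borel 0"
| "conv_power P (Suc n) = (P \<star> conv_power P n)"

lemma real_distribution_conv_power:
  "real_distribution P \<Longrightarrow> real_distribution (conv_power P n)"
  by (induction n) (auto intro: real_distribution_return real_distribution_convolution)

lemma char_conv_power:
  "real_distribution P \<Longrightarrow> char (conv_power P n) u = char P u ^ n"
proof (induction n)
  case 0
  show ?case by (simp add: char_def integral_return)
qed (simp add: char_convolution real_distribution_conv_power)

lemma nn_integral_exp_convolution:
  assumes P: "real_distribution P" and Q: "real_distribution Q"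
  shows "(\<integral>\<^sup>+x. ennreal (exp (u * x)) \<partial>(P \<star> Q)) =
     (\<integral>\<^sup>+x. ennreal (exp (u * x)) \<partial>P) * (\<integral>\<^sup>+x. ennreal (exp (u * x)) \<partial>Q)"
proof -
  note [measurable_cong] = real_distributionD(3)[OF P] real_distributionD(3)[OF Q]
  have "(\<integral>\<^sup>+x. ennreal (exp (u * x)) \<partial>(P \<star> Q)) =
     (\<integral>\<^sup>+x. \<integral>\<^sup>+y. ennreal (exp (u * x)) * ennreal (exp (u * y)) \<partial>Q \<partial>P)"
    by (subst nn_integral_convolution'[OF P Q]) (auto simp: distrib_left exp_add ennreal_mult)
  also have "\<dots> = (\<integral>\<^sup>+x. ennreal (exp (u * x)) \<partial>P) * (\<integral>\<^sup>+x. ennreal (exp (u * x)) \<partial>Q)"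
    by (subst nn_integral_cmult, simp, subst nn_integral_multc) auto
  finally show ?thesis .
qed

lemma nn_integral_exp_conv_power:
  assumes P: "real_distribution P"
  shows "(\<integral>\<^sup>+x. ennreal (exp (u * x)) \<partial>conv_power P n) = (\<integral>\<^sup>+x. ennreal (exp (u * x)) \<partial>P) ^ n"
  by (induction n)
     (simp_all add: nn_integral_return nn_integral_exp_convolution[OF P real_distribution_conv_power[OF P]])

text \<open>Written as a mixture over the number of jumps, so that conditioning on this number is
  just the integral over a \<open>bind\<close>.\<close>

definition compound_poisson :: "real \<Rightarrow> real measure \<Rightarrow> real measure" where
  "compound_poisson r P = measure_pmf (poisson_pmf r) \<bind> conv_power P"

lemma conv_power_measurable:
  "real_distribution P \<Longrightarrow> conv_power P \<in> measurable (measure_pmf p) (subprob_algebra borel)"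
  using real_distributionD[OF real_distribution_conv_power, of P]
  by (auto simp: space_subprob_algebra intro!: prob_space_imp_subprob_space)

lemma real_distribution_compound_poisson:
  assumes "real_distribution P"
  shows "real_distribution (compound_poisson r P)"
proof (rule real_distributionI)
  note m = conv_power_measurable[OF assms]
  show "prob_space (compound_poisson r P)"
    unfolding compound_poisson_def
    by (rule measure_pmf.prob_space_bind[OF _ m])
       (simp add: real_distributionD(1)[OF real_distribution_conv_power[OF assms]])
  show "sets (compound_poisson r P) = sets borel"
    unfolding compound_poisson_def
    by (rule sets_bind) (simp_all add: real_distributionD(3)[OF real_distribution_conv_power[OF assms]])
qed

lemma nn_integral_compound_poisson:
  assumes "real_distribution P" "0 < r" "f \<in> borel_measurable borel"
  shows "(\<integral>\<^sup>+x. f x \<partial>compound_poisson r P) =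
    (\<Sum>n. ennreal (r ^ n / fact n * exp (- r)) * (\<integral>\<^sup>+x. f x \<partial>conv_power P n))"
  unfolding compound_poisson_def
  using assms
  by (subst nn_integral_bind[OF _ conv_power_measurable])
     (auto simp: nn_integral_measure_pmf nn_integral_count_space_nat)

text \<open>Adding \<open>B\<close> makes the integrand nonnegative, so the series comes from the
  \<open>nn_integral\<close> version; it is then removed again because the Poisson weights sum to
  one.\<close>

lemma integral_compound_poisson:
  fixes f :: "real \<Rightarrow> real"
  assumes P: "real_distribution P" and r: "0 < r" and f[measurable]: "f \<in> borel_measurable borel"
    and B: "\<And>x. \<bar>f x\<bar> \<le> B"
  shows "(\<lambda>n. r ^ n / fact n * exp (- r) * (LINT x|conv_power P n. f x)) sums
    (LINT x|compound_poisson r P. f x)"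
proof -
  let ?p = "\<lambda>n. r ^ n / fact n * exp (- r)"
  interpret C: real_distribution "compound_poisson r P"
    by (rule real_distribution_compound_poisson[OF P])
  interpret K: real_distribution "conv_power P n" for n
    by (rule real_distribution_conv_power[OF P])
  note K1 = real_distributionD(7)[OF real_distribution_conv_power[OF P]]
    and C1 = real_distributionD(7)[OF real_distribution_compound_poisson[OF P]]
  have i: "integrable (conv_power P n) f" for n
    using B by (intro K.integrable_const_bound[where B=B]) auto
  have iC: "integrable (compound_poisson r P) f"
    using B by (intro C.integrable_const_bound[where B=B]) auto
  have nn: "0 \<le> f x + B" for x using B[of x] by linarith
  have p1: "?p sums 1"
  proof -
    have "(\<lambda>n. r ^ n /\<^sub>R fact n * exp (- r)) sums (exp r * exp (- r))"
      by (intro sums_mult2 exp_converges)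
    then show ?thesis by (simp add: exp_minus divide_inverse_commute)
  qed
  have nnK: "(\<integral>\<^sup>+x. ennreal (f x + B) \<partial>conv_power P n) = ennreal ((LINT x|conv_power P n. f x) + B)" for n
    using i[of n] nn by (subst nn_integral_eq_integral) (auto simp: K1)
  have K0: "0 \<le> (LINT x|conv_power P n. f x) + B" for n
  proof -
    have "0 \<le> (LINT x|conv_power P n. f x + B)" using nn by (intro integral_nonneg_AE) auto
    then show ?thesis using i[of n] by (simp add: K1)
  qed
  have C0: "0 \<le> (LINT x|compound_poisson r P. f x) + B"
  proof -
    have "0 \<le> (LINT x|compound_poisson r P. f x + B)" using nn by (intro integral_nonneg_AE) auto
    then show ?thesis using iC by (simp add: C1)
  qed
  have "ennreal ((LINT x|compound_poisson r P. f x) + B) = (\<integral>\<^sup>+x. ennreal (f x + B) \<partial>compound_poisson r P)"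
    using iC nn by (subst nn_integral_eq_integral) (auto simp: C1)
  also have "\<dots> = (\<Sum>n. ennreal (?p n) * ennreal ((LINT x|conv_power P n. f x) + B))"
    by (subst nn_integral_compound_poisson[OF P r]) (auto simp: nnK)
  also have "\<dots> = (\<Sum>n. ennreal (?p n * ((LINT x|conv_power P n. f x) + B)))"
    by (intro arg_cong[where f=suminf] ext ennreal_mult[symmetric] K0) (use r in auto)
  finally have "(\<lambda>n. ennreal (?p n * ((LINT x|conv_power P n. f x) + B))) sums
      ennreal ((LINT x|compound_poisson r P. f x) + B)"
    by (simp add: summable_sums)
  then have "(\<lambda>n. ?p n * ((LINT x|conv_power P n. f x) + B)) sums ((LINT x|compound_poisson r P. f x) + B)"
    using r K0 C0 by (subst (asm) sums_ennreal) auto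
  from sums_diff[OF this sums_mult2[OF p1, of B]] show ?thesis
    by (simp add: distrib_left)
qed

text \<open>Real and imaginary parts are integrals of the bounded functions \<open>cos\<close> and
  \<open>sin\<close>, to which the real series applies; the resulting complex series is
  exponential.\<close>

lemma char_compound_poisson:
  assumes P: "real_distribution P" and r: "0 < r"
  shows "char (compound_poisson r P) u = exp (of_real r * (char P u - 1))"
proof -
  let ?p = "\<lambda>n. r ^ n / fact n * exp (- r)"
  have Re: "Re (char D u) = (LINT x|D. cos (u * x))" and Im: "Im (char D u) = (LINT x|D. sin (u * x))"
    if "real_distribution D" for D
  proof -
    interpret real_distribution D by fact
    have "integrable D (\<lambda>x. iexp (u * x))" by (auto intro!: integrable_iexp)
    then show "Re (char D u) = (LINT x|D. cos (u * x))" "Im (char D u) = (LINT x|D. sin (u * x))"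
      unfolding char_def by (simp_all add: integral_Re[symmetric] integral_Im[symmetric] Re_exp Im_exp)
  qed
  have ReIm: "Re (complex_of_real p * z) = p * Re z" "Im (complex_of_real p * z) = p * Im z" for p z
    by simp_all
  have 1: "(\<lambda>n. of_real (?p n) * char (conv_power P n) u) sums char (compound_poisson r P) u"
    unfolding sums_complex_iff ReIm
    using integral_compound_poisson[OF P r, of "\<lambda>x. cos (u * x)" 1]
      integral_compound_poisson[OF P r, of "\<lambda>x. sin (u * x)" 1]
    by (auto simp: Re Im real_distribution_conv_power[OF P] real_distribution_compound_poisson[OF P])
  have "(\<lambda>n. (of_real r * char P u) ^ n /\<^sub>R fact n * exp (- of_real r)) sums
      (exp (of_real r * char P u) * exp (- of_real r))"
    by (intro sums_mult2 exp_converges)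
  then have "(\<lambda>n. of_real (?p n) * char (conv_power P n) u) sums (exp (of_real r * char P u) * exp (- of_real r))"
    by (simp add: char_conv_power[OF P] power_mult_distrib scaleR_conv_of_real divide_inverse exp_of_real[symmetric] mult_ac)
  with 1 have "char (compound_poisson r P) u = exp (of_real r * char P u) * exp (- of_real r)"
    by (rule sums_unique2)
  then show ?thesis by (simp add: exp_add[symmetric] algebra_simps)
qed

lemma nn_integral_exp_compound_poisson:
  assumes P: "real_distribution P" and r: "0 < r" and m: "0 \<le> m"
    and mgf: "(\<integral>\<^sup>+x. ennreal (exp (u * x)) \<partial>P) = ennreal m"
  shows "(\<integral>\<^sup>+x. ennreal (exp (u * x)) \<partial>compound_poisson r P) = ennreal (exp (r * (m - 1)))"
proof -
  have "(\<integral>\<^sup>+x. ennreal (exp (u * x)) \<partial>compound_poisson r P) =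
     (\<Sum>n. ennreal ((r * m) ^ n / fact n * exp (- r)))"
  proof (subst nn_integral_compound_poisson[OF P r])
    have "ennreal (r ^ n / fact n * exp (- r)) * ennreal m ^ n = ennreal ((r * m) ^ n / fact n * exp (- r))" for n
      using r m by (simp add: ennreal_power ennreal_mult[symmetric] power_mult_distrib)
    then show "(\<Sum>n. ennreal (r ^ n / fact n * exp (- r)) * (\<integral>\<^sup>+x. ennreal (exp (u * x)) \<partial>conv_power P n)) =
        (\<Sum>n. ennreal ((r * m) ^ n / fact n * exp (- r)))"
      by (simp only: nn_integral_exp_conv_power[OF P] mgf)
  qed simp
  also have "(\<lambda>n. (r * m) ^ n /\<^sub>R fact n * exp (- r)) sums (exp (r * m) * exp (- r))"
    by (intro sums_mult2 exp_converges)
  then have "(\<Sum>n. ennreal ((r * m) ^ n / fact n * exp (- r))) = ennreal (exp (r * m) * exp (- r))"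
    using r m by (intro suminf_ennreal_eq) (auto simp: divide_inverse_commute)
  finally show ?thesis by (simp add: exp_add[symmetric] algebra_simps)
qed

text \<open>A push-forward instead of a normal density, so that \<open>s = 0\<close> is allowed and
  gives the point mass at \<open>m\<close>. This covers a vanishing Gaussian part, and deterministic
  shifts as well.\<close>

definition gauss :: "real \<Rightarrow> real \<Rightarrow> real measure" where
  "gauss m s = distr std_normal_distribution borel (\<lambda>x. m + s * x)"

lemma real_distribution_gauss: "real_distribution (gauss m s)"
proof (rule real_distributionI)
  interpret real_distribution std_normal_distribution by (rule real_dist_normal_dist)
  show "prob_space (gauss m s)" unfolding gauss_def by (rule prob_space_distr) simp
qed (simp add: gauss_def)

lemma char_gauss: "char (gauss m s) u = exp (\<i> * of_real (m * u) - of_real (s\<^sup>2 * u\<^sup>2 / 2))"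
proof -
  have "char (gauss m s) u = (CLINT x|std_normal_distribution. iexp (u * (m + s * x)))"
    unfolding char_def gauss_def by (subst integral_distr) auto
  also have "\<dots> = (CLINT x|std_normal_distribution. iexp (u * m) * iexp ((u * s) * x))"
    by (simp add: exp_add[symmetric] algebra_simps)
  also have "\<dots> = iexp (u * m) * char std_normal_distribution (u * s)"
    by (simp add: char_def)
  finally show ?thesis
    by (simp add: char_std_normal_distribution exp_of_real[symmetric] exp_add[symmetric] power_mult_distrib mult_ac)
qed

lemma nn_integral_exp_gauss:
  "(\<integral>\<^sup>+x. ennreal (exp (u * x)) \<partial>gauss m s) = ennreal (exp (u * m + s\<^sup>2 * u\<^sup>2 / 2))"
proof -
  \<comment> \<open>Completing the square turns the exponential weight into a shift of the mean by
    \<open>u * s\<close>.\<close>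
  have eq: "std_normal_density x * exp (u * (m + s * x)) =
      exp (u * m + s\<^sup>2 * u\<^sup>2 / 2) * normal_density (u * s) 1 x" for x
  proof -
    have "exp (- x\<^sup>2 / 2) * exp (u * (m + s * x)) = exp (u * m + s\<^sup>2 * u\<^sup>2 / 2) * exp (- (x - u * s)\<^sup>2 / 2)"
      unfolding exp_add[symmetric] by (rule arg_cong[where f=exp]) (simp add: field_simps power2_eq_square)
    then show ?thesis
      by (simp add: std_normal_density_def normal_density_def)
  qed
  have "(\<integral>\<^sup>+x. ennreal (exp (u * x)) \<partial>gauss m s) =
      (\<integral>\<^sup>+x. ennreal (std_normal_density x) * ennreal (exp (u * (m + s * x))) \<partial>lborel)"
    unfolding gauss_def by (subst nn_integral_distr) (auto simp: nn_integral_density)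
  also have "\<dots> = (\<integral>\<^sup>+x. ennreal (exp (u * m + s\<^sup>2 * u\<^sup>2 / 2)) * ennreal (normal_density (u * s) 1 x) \<partial>lborel)"
    by (simp add: ennreal_mult[symmetric] eq)
  also have "\<dots> = ennreal (exp (u * m + s\<^sup>2 * u\<^sup>2 / 2)) * (\<integral>\<^sup>+x. ennreal (normal_density (u * s) 1 x) \<partial>lborel)"
    by (rule nn_integral_cmult) auto
  also have "(\<integral>\<^sup>+x. ennreal (normal_density (u * s) 1 x) \<partial>lborel) = 1"
    using prob_space.emeasure_space_1[OF prob_space_normal_density[of 1 "u * s"]]
    by (simp add: emeasure_density)
  finally show ?thesis by simp
qed

lemma gauss_moments:
  "integrable (gauss m s) (\<lambda>x. x)" "(LINT x|gauss m s. x) = m"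
  "integrable (gauss m s) (\<lambda>x. x\<^sup>2)" "(LINT x|gauss m s. x\<^sup>2) = m\<^sup>2 + s\<^sup>2"
proof -
  let ?D = std_normal_distribution
  interpret D: real_distribution ?D by (rule real_dist_normal_dist)
  have i1: "integrable ?D (\<lambda>x. x)" and i2: "integrable ?D (\<lambda>x. x\<^sup>2)"
    using integrable_std_normal_distribution_moment[of 1] integrable_std_normal_distribution_moment[of 2] by auto
  have e1: "(LINT x|?D. x) = 0" using integral_std_normal_distribution_moment_odd[of 1] by simp
  have e2: "(LINT x|?D. x\<^sup>2) = 1" using std_normal_distribution_even_moments(1)[of 1] by (simp add: fact_2)
  have sq: "(m + s * x)\<^sup>2 = m\<^sup>2 + 2 * m * s * x + s\<^sup>2 * x\<^sup>2" for x by (simp add: power2_eq_square algebra_simps)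
  have lin: "(\<lambda>x. m + s * x) \<in> measurable ?D borel" by simp
  have j1: "integrable ?D (\<lambda>x. m + s * x)"
    by (intro Bochner_Integration.integrable_add integrable_mult_right i1 D.integrable_const)
  have j2: "integrable ?D (\<lambda>x. (m + s * x)\<^sup>2)"
    unfolding sq by (intro Bochner_Integration.integrable_add integrable_mult_right i1 i2 D.integrable_const)
  show "integrable (gauss m s) (\<lambda>x. x)"
    unfolding gauss_def by (rule iffD2[OF integrable_distr_eq[OF lin]]) (simp, rule j1)
  show "integrable (gauss m s) (\<lambda>x. x\<^sup>2)"
    unfolding gauss_def by (rule iffD2[OF integrable_distr_eq[OF lin]]) (simp, rule j2)
  have c: "(LINT x|?D. c) = c" for c :: real
    using real_distributionD(7)[OF real_dist_normal_dist] by simp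
  have "(LINT x|gauss m s. x) = (LINT x|?D. m + s * x)"
    unfolding gauss_def by (rule integral_distr[OF lin]) simp
  also have "\<dots> = (LINT x|?D. m) + s * (LINT x|?D. x)"
    by (subst Bochner_Integration.integral_add) (simp_all only: D.integrable_const integrable_mult_right i1 integral_mult_right_zero)
  finally show "(LINT x|gauss m s. x) = m" by (simp only: c e1)
  have "(LINT x|gauss m s. x\<^sup>2) = (LINT x|?D. (m + s * x)\<^sup>2)"
    unfolding gauss_def by (rule integral_distr[OF lin]) simp
  also have "\<dots> = (LINT x|?D. m\<^sup>2) + 2 * m * s * (LINT x|?D. x) + s\<^sup>2 * (LINT x|?D. x\<^sup>2)"
    unfolding sq by (simp only: Bochner_Integration.integral_add Bochner_Integration.integrable_add
      D.integrable_const integrable_mult_right i1 i2 integral_mult_right_zero)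
  finally show "(LINT x|gauss m s. x\<^sup>2) = m\<^sup>2 + s\<^sup>2" by (simp only: c e1 e2)
qed

subsection \<open>Limits of laws with bounded exponential moments\<close>

text \<open>Chebyshev with the weight \<open>exp x + exp (- x)\<close>, which dominates the
  exponential of the absolute value; only the exponents \<open>1\<close> and \<open>-1\<close> of
  the bound enter.\<close>

lemma tight_of_exp_bound:
  assumes P: "\<And>n. real_distribution (P n)"
    and B: "\<And>n u. (\<integral>\<^sup>+x. ennreal (exp (u * x)) \<partial>P n) \<le> ennreal (B u)"
  shows "tight P"
  unfolding tight_def
proof (intro conjI allI impI P)
  fix e :: real assume e: "0 < e"
  define C where "C = max 0 (B 1) + max 0 (B (-1))"
  \<comment> \<open>The logarithm makes \<open>exp (- R)\<close> at most \<open>e / (C + 1)\<close>;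
    the \<open>+ 1\<close> yields a strict inequality and covers \<open>C = 0\<close>, the maximum
    with \<open>1\<close> keeps the interval nonempty.\<close>
  define R where "R = max 1 (ln ((C + 1) / e))"
  have C0: "0 \<le> C" by (simp add: C_def)
  have "C * exp (- R) < e"
  proof -
    have "exp (- R) \<le> exp (- ln ((C + 1) / e))" by (simp add: R_def)
    also have "\<dots> = e / (C + 1)" using C0 e by (simp add: exp_minus field_simps)
    finally have "C * exp (- R) \<le> C * (e / (C + 1))" by (rule mult_left_mono) fact
    also have "\<dots> < e" using C0 e by (simp add: field_simps)
    finally show ?thesis .
  qed
  moreover have "1 - measure (P n) {- R<..R} \<le> C * exp (- R)" for n
  proof -
    interpret real_distribution "P n" by (rule P)
    have *: "indicator (- {- R<..R}) x \<le> ennreal (exp (- R)) * (ennreal (exp (1 * x)) + ennreal (exp (- 1 * x)))" for x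
    proof (cases "x \<in> {- R<..R}")
      case False
      then have "R \<le> \<bar>x\<bar>" by auto
      then have "1 \<le> exp (- R) * exp \<bar>x\<bar>" by (simp add: exp_add[symmetric])
      also have "\<dots> \<le> exp (- R) * (exp (1 * x) + exp (- 1 * x))" by (cases "0 \<le> x") auto
      finally have "ennreal 1 \<le> ennreal (exp (- R) * (exp (1 * x) + exp (- 1 * x)))" by (rule ennreal_leI)
      then show ?thesis using False by (simp add: ennreal_mult ennreal_plus)
    qed simp
    have "emeasure (P n) (- {- R<..R}) = (\<integral>\<^sup>+x. indicator (- {- R<..R}) x \<partial>P n)"
      by simp
    also have "\<dots> \<le> (\<integral>\<^sup>+x. ennreal (exp (- R)) * (ennreal (exp (1 * x)) + ennreal (exp (- 1 * x))) \<partial>P n)"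
      by (intro nn_integral_mono *)
    also have "\<dots> = ennreal (exp (- R)) * ((\<integral>\<^sup>+x. ennreal (exp (1 * x)) \<partial>P n) + (\<integral>\<^sup>+x. ennreal (exp (- 1 * x)) \<partial>P n))"
      by (subst nn_integral_cmult, simp, subst nn_integral_add) auto
    also have "\<dots> \<le> ennreal (exp (- R)) * (ennreal (B 1) + ennreal (B (-1)))"
      by (intro mult_left_mono add_mono B) auto
    also have "\<dots> \<le> ennreal (exp (- R)) * ennreal C"
      unfolding C_def by (subst ennreal_plus) (auto simp: max_def ennreal_neg)
    also have "\<dots> = ennreal (C * exp (- R))" using C0 by (simp add: ennreal_mult mult.commute)
    finally have "measure (P n) (- {- R<..R}) \<le> C * exp (- R)"
      unfolding emeasure_eq_measure by (subst (asm) ennreal_le_iff) (use C0 in auto)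
    moreover have "measure (P n) (- {- R<..R}) = 1 - measure (P n) {- R<..R}"
      using prob_compl[of "{- R<..R}"] unfolding Compl_eq_Diff_UNIV space_eq_univ by (simp only: events_eq_borel) auto
    ultimately show ?thesis by simp
  qed
  ultimately have "1 - e < measure (P n) {- R<..R}" for n
    by (smt (verit))
  moreover have "- R < R" by (simp add: R_def)
  ultimately show "\<exists>a b. a < b \<and> (\<forall>n. 1 - e < measure (P n) {a<..b})" by blast
qed

text \<open>Weak convergence tests bounded continuous functions only. The exponential is therefore
  capped at \<open>m\<close>, and monotone convergence removes the cap after the limit in
  \<open>n\<close>.\<close>

lemma exp_bound_weak_limit:
  assumes P: "\<And>n. real_distribution (P n)" and Q: "real_distribution Q"
    and w: "weak_conv_m P Q"
    and B: "\<And>n. (\<integral>\<^sup>+x. ennreal (exp (u * x)) \<partial>P n) \<le> ennreal B"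
  shows "(\<integral>\<^sup>+x. ennreal (exp (u * x)) \<partial>Q) \<le> ennreal B"
proof -
  interpret Q: real_distribution Q by (rule Q)
  \<comment> \<open>A negative \<open>B\<close> would turn \<open>ennreal B\<close> into
    \<open>0\<close>, which is impossible for the integral of a strictly positive function.\<close>
  have B0: "0 \<le> B"
  proof (rule ccontr)
    assume "\<not> 0 \<le> B"
    then have 0: "(\<integral>\<^sup>+x. ennreal (exp (u * x)) \<partial>P 0) = 0" using B[of 0] by (simp add: ennreal_neg)
    interpret P0: real_distribution "P 0" by (rule P)
    from 0 have "AE x in P 0. False" by (subst (asm) nn_integral_0_iff_AE) (auto simp: ennreal_eq_0_iff)
    then show False by simp
  qed
  have b: "(\<integral>\<^sup>+x. ennreal (min (exp (u * x)) (real m)) \<partial>Q) \<le> ennreal B" for m :: nat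
  proof -
    have "(\<lambda>n. LINT x|P n. min (exp (u * x)) (real m)) \<longlonglongrightarrow> (LINT x|Q. min (exp (u * x)) (real m))"
      by (rule weak_conv_imp_integral_bdd_continuous_conv[OF P Q w, where B="real m"])
         (auto intro!: continuous_intros)
    moreover have "(LINT x|P n. min (exp (u * x)) (real m)) \<le> B" for n
    proof -
      interpret real_distribution "P n" by (rule P)
      have i: "integrable (P n) (\<lambda>x. min (exp (u * x)) (real m))"
        by (rule integrable_const_bound[where B="real m"]) auto
      have "ennreal (LINT x|P n. min (exp (u * x)) (real m)) = (\<integral>\<^sup>+x. ennreal (min (exp (u * x)) (real m)) \<partial>P n)"
        using i by (intro nn_integral_eq_integral[symmetric]) auto
      also have "\<dots> \<le> (\<integral>\<^sup>+x. ennreal (exp (u * x)) \<partial>P n)"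
        by (intro nn_integral_mono ennreal_leI) auto
      also have "\<dots> \<le> ennreal B" by (rule B)
      finally show ?thesis using B0 by simp
    qed
    ultimately have le: "(LINT x|Q. min (exp (u * x)) (real m)) \<le> B"
      by (intro LIMSEQ_le_const2) auto
    have "integrable Q (\<lambda>x. min (exp (u * x)) (real m))"
      by (rule Q.integrable_const_bound[where B="real m"]) auto
    then have "(\<integral>\<^sup>+x. ennreal (min (exp (u * x)) (real m)) \<partial>Q) = ennreal (LINT x|Q. min (exp (u * x)) (real m))"
      by (intro nn_integral_eq_integral) auto
    with le show ?thesis by (simp add: ennreal_leI)
  qed
  have "ennreal (exp (u * x)) = (SUP m. ennreal (min (exp (u * x)) (real m)))" for x
  proof (rule antisym)
    obtain m where "exp (u * x) \<le> real m" using real_arch_simple by blast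
    then show "ennreal (exp (u * x)) \<le> (SUP m. ennreal (min (exp (u * x)) (real m)))"
      by (intro SUP_upper2[of m]) auto
  qed (auto intro!: SUP_least ennreal_leI)
  then have "(\<integral>\<^sup>+x. ennreal (exp (u * x)) \<partial>Q) = (\<integral>\<^sup>+x. (SUP m. ennreal (min (exp (u * x)) (real m))) \<partial>Q)"
    by simp
  also have "\<dots> = (SUP m. \<integral>\<^sup>+x. ennreal (min (exp (u * x)) (real m)) \<partial>Q)"
    by (rule nn_integral_monotone_convergence_SUP)
       (auto simp: incseq_def le_fun_def intro!: ennreal_leI min.mono)
  also have "\<dots> \<le> ennreal B" by (intro SUP_least b)
  finally show ?thesis .
qed

text \<open>The uniform exponential bound replaces continuity of \<open>c\<close> at
  \<open>0\<close>: it gives tightness, hence a subsequential weak limit, whose characteristic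
  function must be \<open>c\<close>. The same bound then passes to the limit.\<close>

lemma exists_limit_distribution:
  assumes P: "\<And>n. real_distribution (P n)"
    and B: "\<And>n u. (\<integral>\<^sup>+x. ennreal (exp (u * x)) \<partial>P n) \<le> ennreal (B u)"
    and c: "\<And>u. (\<lambda>n. char (P n) u) \<longlonglongrightarrow> c u"
  shows "\<exists>Q. real_distribution Q \<and> (\<forall>u. char Q u = c u) \<and>
     (\<forall>u. (\<integral>\<^sup>+x. ennreal (exp (u * x)) \<partial>Q) \<le> ennreal (B u))"
proof -
  have "strict_mono (id :: nat \<Rightarrow> nat)" by (simp add: strict_mono_def)
  from tight_imp_convergent_subsubsequence[OF tight_of_exp_bound[of P, OF P B] this]
  obtain r Q where r: "strict_mono (r :: nat \<Rightarrow> nat)" and Q: "real_distribution Q"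
    and w: "weak_conv_m (P \<circ> id \<circ> r) Q" by blast
  let ?P = "P \<circ> id \<circ> r"
  have P': "real_distribution (?P n)" for n by (simp add: P)
  have "char Q u = c u" for u
  proof -
    have "(\<lambda>n. char (?P n) u) \<longlonglongrightarrow> char Q u" by (rule levy_continuity1[OF P' Q w])
    moreover have "(\<lambda>n. char (?P n) u) \<longlonglongrightarrow> c u"
      using LIMSEQ_subseq_LIMSEQ[OF c r] by (simp add: o_def)
    ultimately show ?thesis by (rule LIMSEQ_unique)
  qed
  moreover have "(\<integral>\<^sup>+x. ennreal (exp (u * x)) \<partial>Q) \<le> ennreal (B u)" for u
    by (rule exp_bound_weak_limit[OF P' Q w]) (simp add: B)
  ultimately show ?thesis using Q by blast
qed

lemma exp_minus_linear_le:
  fixes y :: real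
  assumes "\<bar>y\<bar> \<le> c"
  shows "exp y - 1 - y \<le> y\<^sup>2 / 2 * exp c"
proof (cases "y = 0")
  case False
  obtain s where s: "\<bar>s\<bar> < \<bar>y\<bar>" "exp y = (\<Sum>m<2. y ^ m / fact m) + exp s / fact 2 * y ^ 2"
    using Maclaurin_exp_lt[OF False, of 2] by auto
  then have "exp y - 1 - y = y\<^sup>2 / 2 * exp s" by (simp add: eval_nat_numeral)
  also have "\<dots> \<le> y\<^sup>2 / 2 * exp c" using s assms by (intro mult_left_mono) auto
  finally show ?thesis .
qed simp

lemma cmod_iexp_linear_le:
  fixes y :: real
  shows "cmod (iexp y - 1 - \<i> * of_real y) \<le> y\<^sup>2 / 2"
  using iexp_approx1[of y 1] by (simp add: eval_nat_numeral algebra_simps)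

subsection \<open>The law of the compensated small jumps\<close>

lemma levy_measure_sets: "levy_measure N \<Longrightarrow> sets N = sets borel"
  and levy_measure_space: "levy_measure N \<Longrightarrow> space N = UNIV"
  using sets_eq_imp_space_eq[of N borel] by (auto simp: levy_measure_def)

lemma levy_measure_integrable_min:
  assumes "levy_measure N"
  shows "integrable N (\<lambda>x. min 1 (x\<^sup>2))"
proof -
  note [measurable_cong] = levy_measure_sets[OF assms]
  show ?thesis
    using assms by (intro integrableI_bounded) (auto simp: levy_measure_def)
qed

lemma levy_measure_finite:
  assumes N: "levy_measure N" and a: "0 < a"
  shows "emeasure N {x. a < \<bar>x\<bar>} < \<infinity>"
proof -
  note [measurable_cong] = levy_measure_sets[OF N]
  let ?c = "min 1 (a\<^sup>2)"
  have c: "0 < ?c" using a by simp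
  have "integrable N (\<lambda>x. indicator {x. a < \<bar>x\<bar>} x *\<^sub>R (1::real))"
  proof (rule Bochner_Integration.integrable_bound)
    show "integrable N (\<lambda>x. (1 / ?c) * min 1 (x\<^sup>2))"
      by (intro integrable_mult_right levy_measure_integrable_min N)
    have "1 \<le> (1 / ?c) * min 1 (x\<^sup>2)" if "a < \<bar>x\<bar>" for x
    proof -
      have "a\<^sup>2 \<le> x\<^sup>2" using that a by (simp add: abs_le_square_iff[symmetric])
      then have "?c \<le> min 1 (x\<^sup>2)" by (simp add: min_def)
      then show ?thesis using c by (simp add: pos_le_divide_eq)
    qed
    then show "AE x in N. norm (indicator {x. a < \<bar>x\<bar>} x *\<^sub>R (1::real)) \<le> norm ((1 / ?c) * min 1 (x\<^sup>2))"
      by (auto simp: indicator_def)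
  qed measurable
  then have "integrable N (indicator {x. a < \<bar>x\<bar>} :: real \<Rightarrow> real)" by simp
  moreover have "{x. a < \<bar>x\<bar>} \<in> sets N" by measurable
  ultimately show ?thesis
    by (simp add: integrable_indicator_iff levy_measure_space[OF N])
qed

lemma levy_measure_integrable_square:
  assumes N: "levy_measure N" and e: "e \<le> 1"
  shows "set_integrable N {x. \<bar>x\<bar> \<le> e} (\<lambda>x. x\<^sup>2)"
proof -
  note [measurable_cong] = levy_measure_sets[OF N]
  have "x\<^sup>2 \<le> min 1 (x\<^sup>2)" if "\<bar>x\<bar> \<le> e" for x :: real
    using that e power_mono[of "\<bar>x\<bar>" 1 2] by simp
  then show ?thesis
    unfolding set_integrable_def
    by (intro Bochner_Integration.integrable_bound[OF levy_measure_integrable_min[OF N]])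
       (auto simp: indicator_def)
qed

lemma integral_uniform_measure:
  fixes f :: "'a \<Rightarrow> 'b::{banach, second_countable_topology}"
  assumes [measurable]: "A \<in> sets N" "f \<in> borel_measurable N"
    and A: "emeasure N A \<noteq> 0" "emeasure N A \<noteq> \<infinity>"
  shows "(LINT x|uniform_measure N A. f x) = (1 / measure N A) *\<^sub>R (LINT x:A|N. f x)"
proof -
  have m: "0 < measure N A" and e: "emeasure N A = ennreal (measure N A)"
    using A by (auto simp: emeasure_eq_ennreal_measure less_top top.not_eq_extremum)
       (metis A emeasure_eq_ennreal_measure ennreal_0 infinity_ennreal_def measure_nonneg order_le_less)
  have "uniform_measure N A = density N (\<lambda>x. ennreal (indicator A x / measure N A))"
    unfolding uniform_measure_def
    using m by (intro arg_cong[where f="density N"] ext) (auto simp: e indicator_def divide_ennreal[of 1, simplified])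
  then have "(LINT x|uniform_measure N A. f x) = (LINT x|N. (indicator A x / measure N A) *\<^sub>R f x)"
    by (simp add: integral_density)
  also have "\<dots> = (LINT x|N. (1 / measure N A) *\<^sub>R (indicator A x *\<^sub>R f x))"
    by simp
  also have "\<dots> = (1 / measure N A) *\<^sub>R (LINT x:A|N. f x)"
    unfolding set_lebesgue_integral_def by (rule integral_scaleR_right)
  finally show ?thesis .
qed

lemma set_integrable_bounded:
  fixes f :: "real \<Rightarrow> 'b::{banach, second_countable_topology}"
  assumes N: "sets N = sets borel" and A: "A \<in> sets borel" and fin: "emeasure N A < \<infinity>"
    and f: "f \<in> borel_measurable borel" and B: "\<And>x. x \<in> A \<Longrightarrow> norm (f x) \<le> B"
  shows "set_integrable N A f"
proof -
  note [measurable_cong] = N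
  show ?thesis
    unfolding set_integrable_def using assms
    by (intro integrableI_bounded_set_indicator[where B=B]) auto
qed

lemma char_compound_poisson_uniform:
  assumes N: "sets N = sets borel" and A[measurable]: "A \<in> sets borel"
    and fin: "emeasure N A \<noteq> 0" "emeasure N A \<noteq> \<infinity>" and t: "0 < t"
  shows "char (compound_poisson (t * measure N A) (uniform_measure N A)) u =
     exp (of_real t * (CLINT x:A|N. iexp (u * x) - 1))"
proof -
  note [measurable_cong] = N
  have m: "0 < measure N A"
    using fin by (simp add: measure_def enn2real_positive_iff top.not_eq_extremum zero_less_iff_neq_zero)
  have i1: "set_integrable N A (\<lambda>x. iexp (u * x))"
    unfolding set_integrable_def using fin
    by (intro integrableI_bounded_set_indicator[where B=1]) (auto simp: N top.not_eq_extremum)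
  have i2: "set_integrable N A (\<lambda>x. 1 :: complex)"
    unfolding set_integrable_def using fin
    by (intro integrableI_bounded_set_indicator[where B=1]) (auto simp: N top.not_eq_extremum)
  have "char (uniform_measure N A) u = (1 / measure N A) *\<^sub>R (CLINT x:A|N. iexp (u * x))"
    unfolding char_def using fin by (intro integral_uniform_measure) (auto simp: N)
  moreover have "(CLINT x:A|N. 1) = of_real (measure N A)"
    using set_integral_const[of A N "1::complex"] fin by (simp add: N scaleR_conv_of_real)
  ultimately have "of_real (measure N A) * (char (uniform_measure N A) u - 1) = (CLINT x:A|N. iexp (u * x) - 1)"
    using m set_integral_diff(2)[OF i1 i2] by (simp add: scaleR_conv_of_real right_diff_distrib)
  then show ?thesis
    using m t by (subst char_compound_poisson) (auto simp: mult.assoc intro!: real_distribution_uniform_measure[OF N fin])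
qed

lemma nn_integral_exp_compound_poisson_uniform:
  assumes N: "sets N = sets borel" and A[measurable]: "A \<in> sets borel"
    and fin: "emeasure N A \<noteq> 0" "emeasure N A \<noteq> \<infinity>" and t: "0 < t"
    and i: "set_integrable N A (\<lambda>x. exp (u * x))"
  shows "(\<integral>\<^sup>+x. ennreal (exp (u * x)) \<partial>compound_poisson (t * measure N A) (uniform_measure N A)) =
     ennreal (exp (t * (LINT x:A|N. exp (u * x) - 1)))"
proof -
  note [measurable_cong] = N
  have m: "0 < measure N A"
    using fin by (simp add: measure_def enn2real_positive_iff top.not_eq_extremum zero_less_iff_neq_zero)
  have e: "emeasure N A = ennreal (measure N A)"
    using fin by (intro emeasure_eq_ennreal_measure) auto
  let ?I = "LINT x:A|N. exp (u * x)"
  have I0: "0 \<le> ?I" unfolding set_lebesgue_integral_def by (intro integral_nonneg_AE) auto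
  have i2: "set_integrable N A (\<lambda>x. 1 :: real)"
    unfolding set_integrable_def using fin
    by (intro integrableI_bounded_set_indicator[where B=1]) (auto simp: N top.not_eq_extremum)
  have "(\<integral>\<^sup>+x. ennreal (exp (u * x)) \<partial>uniform_measure N A) =
      (\<integral>\<^sup>+x. ennreal (exp (u * x)) * indicator A x \<partial>N) / emeasure N A"
    using A N by (intro nn_integral_uniform_measure) auto
  also have "(\<integral>\<^sup>+x. ennreal (exp (u * x)) * indicator A x \<partial>N) = (\<integral>\<^sup>+x. ennreal (indicator A x *\<^sub>R exp (u * x)) \<partial>N)"
    by (intro nn_integral_cong) (auto simp: indicator_def)
  also have "\<dots> = ennreal ?I"
    using i unfolding set_lebesgue_integral_def set_integrable_def by (intro nn_integral_eq_integral) auto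
  also have "ennreal ?I / emeasure N A = ennreal (?I / measure N A)"
    using m I0 by (simp add: e divide_ennreal)
  finally have *: "(\<integral>\<^sup>+x. ennreal (exp (u * x)) \<partial>uniform_measure N A) = ennreal (?I / measure N A)" .
  have "(LINT x:A|N. 1) = measure N A"
    using set_integral_const[of A N "1::real"] fin by (simp add: N)
  then have "t * measure N A * (?I / measure N A - 1) = t * (LINT x:A|N. exp (u * x) - 1)"
    using m set_integral_diff(2)[OF i i2] by (simp add: right_diff_distrib mult.assoc)
  then show ?thesis
    using m t I0 by (subst nn_integral_exp_compound_poisson[OF _ _ _ *])
      (auto intro!: real_distribution_uniform_measure[OF N fin])
qed

text \<open>\<open>N\<close> may have infinite mass near \<open>0\<close>, so the law is a limit of
  compensated compound Poisson laws with jumps bounded away from \<open>0\<close>. Compensation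
  leaves integrands of second order in \<open>x\<close>, controlled by the variance on
  \<open>{x. \<bar>x\<bar> \<le> e}\<close> uniformly in the cut-off. The hypothesis
  \<open>pos\<close> makes the normalised jump laws well defined.\<close>

lemma exists_small_jump_distribution:
  assumes N: "levy_measure N" and e: "0 < e" "e \<le> 1" and t: "0 < t"
    and pos: "\<And>a. 0 < a \<Longrightarrow> a < e \<Longrightarrow> emeasure N {x. a < \<bar>x\<bar> \<and> \<bar>x\<bar> \<le> e} \<noteq> 0"
  shows "\<exists>J. real_distribution J \<and>
     (\<forall>u. char J u = exp (of_real t * (CLINT x:{x. \<bar>x\<bar> \<le> e}|N. iexp (u * x) - 1 - \<i> * of_real (u * x)))) \<and>
     (\<forall>u. (\<integral>\<^sup>+x. ennreal (exp (u * x)) \<partial>J) \<le>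
        ennreal (exp (t * (u\<^sup>2 / 2 * exp (\<bar>u\<bar> * e) * (LINT x:{x. \<bar>x\<bar> \<le> e}|N. x\<^sup>2)))))"
proof -
  note sN = levy_measure_sets[OF N]
  note [measurable_cong] = sN
  define E where "E = {x::real. \<bar>x\<bar> \<le> e}"
  \<comment> \<open>With \<open>n + 2\<close> the lower cut-off lies strictly below \<open>e\<close>
    already for \<open>n = 0\<close>, as \<open>pos\<close> requires.\<close>
  define A where "A n = {x. e / real (n + 2) < \<bar>x\<bar> \<and> \<bar>x\<bar> \<le> e}" for n :: nat
  define c where "c n = (LINT x:A n|N. x)" for n
  \<comment> \<open>The degenerate \<open>gauss\<close> factor is the shift that compensates the
    jumps in \<open>A n\<close>.\<close>
  define P where "P n = (gauss (- t * c n) 0 \<star> compound_poisson (t * measure N (A n)) (uniform_measure N (A n)))" for n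
  have A[measurable]: "A n \<in> sets borel" for n unfolding A_def by measurable
  have E[measurable]: "E \<in> sets borel" unfolding E_def by measurable
  have AE: "A n \<subseteq> E" for n by (auto simp: A_def E_def)
  have d: "0 < e / real (n + 2)" "e / real (n + 2) < e" for n
    using e by (auto simp: field_simps add_pos_nonneg)
  have A0: "emeasure N (A n) \<noteq> 0" for n unfolding A_def by (intro pos d)
  have Afin: "emeasure N (A n) < \<infinity>" for n
  proof -
    have "emeasure N (A n) \<le> emeasure N {x. e / real (n + 2) < \<bar>x\<bar>}"
      by (intro emeasure_mono) (auto simp: A_def)
    then show ?thesis using levy_measure_finite[OF N d(1)[of n]] by (rule le_less_trans)
  qed
  have A1: "emeasure N (A n) \<noteq> \<infinity>" for n using Afin[of n] by simp
  have uA: "real_distribution (uniform_measure N (A n))" for n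
    by (rule real_distribution_uniform_measure[OF sN A0 A1])
  have P: "real_distribution (P n)" for n
    unfolding P_def by (intro real_distribution_convolution real_distribution_gauss real_distribution_compound_poisson uA)
  note b = set_integrable_bounded[OF sN A Afin]
  have i_id: "set_integrable N (A n) (\<lambda>x. x)" for n by (rule b[where B=e]) (auto simp: A_def)
  have i_1: "set_integrable N (A n) (\<lambda>x. 1::real)" for n by (rule b[where B=1]) auto
  have i_exp: "set_integrable N (A n) (\<lambda>x. exp (u * x))" for n u
  proof (rule b[where B="exp (\<bar>u\<bar> * e)"])
    fix x assume "x \<in> A n"
    then have "u * x \<le> \<bar>u\<bar> * e" unfolding A_def
      by (metis (mono_tags, lifting) abs_ge_self abs_ge_zero abs_mult mem_Collect_eq mult_left_mono order_trans)
    then show "norm (exp (u * x)) \<le> exp (\<bar>u\<bar> * e)" by simp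
  qed measurable
  have i_sq: "set_integrable N E (\<lambda>x. x\<^sup>2)"
    unfolding E_def by (rule levy_measure_integrable_square[OF N e(2)])
  have i_iexp: "set_integrable N (A n) (\<lambda>x. iexp (u * x) - 1)" for n u
    by (rule b[where B="2"]) (auto intro: order_trans[OF norm_triangle_ineq4])
  have i_cid: "set_integrable N (A n) (\<lambda>x. \<i> * of_real (u * x))" for n u
    by (rule b[where B="\<bar>u\<bar> * e"]) (auto simp: A_def norm_mult intro: mult_left_mono)
  let ?g = "\<lambda>u x. iexp (u * x) - 1 - \<i> * of_real (u * x)"
  have charP: "char (P n) u = exp (of_real t * (CLINT x:A n|N. ?g u x))" for n u
  proof -
    have "(CLINT x:A n|N. \<i> * of_real (u * x)) = (CLINT x|N. (\<i> * of_real u) * of_real (indicator (A n) x *\<^sub>R x))"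
      unfolding set_lebesgue_integral_def
      by (intro Bochner_Integration.integral_cong) (auto simp: indicator_def)
    also have "\<dots> = (\<i> * of_real u) * of_real (LINT x|N. indicator (A n) x *\<^sub>R x)"
      using i_id[of n] unfolding set_integrable_def by (simp only: integral_mult_right_zero integral_of_real)
    finally have "(CLINT x:A n|N. \<i> * of_real (u * x)) = \<i> * of_real (u * c n)"
      by (simp add: c_def set_lebesgue_integral_def mult.assoc)
    then have D: "(CLINT x:A n|N. ?g u x) = (CLINT x:A n|N. iexp (u * x) - 1) - \<i> * of_real (u * c n)"
      using set_integral_diff(2)[OF i_iexp i_cid] by simp
    define I where "I = (CLINT x:A n|N. iexp (u * x) - 1)"
    have "char (P n) u = exp (\<i> * of_real (- t * c n * u)) * exp (of_real t * I)"
      unfolding P_def I_def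
      by (subst char_convolution)
         (simp_all add: real_distribution_gauss real_distribution_compound_poisson uA char_gauss
           char_compound_poisson_uniform[OF sN A A0 A1 t])
    also have "\<dots> = exp (of_real t * (I - \<i> * of_real (u * c n)))"
      by (simp add: exp_add[symmetric] right_diff_distrib mult_ac)
    finally show ?thesis unfolding D I_def .
  qed
  have lim: "(\<lambda>n. CLINT x:A n|N. ?g u x) \<longlonglongrightarrow> (CLINT x:E|N. ?g u x)" for u
    unfolding set_lebesgue_integral_def
  proof (rule integral_dominated_convergence[where w="\<lambda>x. u\<^sup>2 / 2 * (indicator E x *\<^sub>R x\<^sup>2)"])
    show "integrable N (\<lambda>x. u\<^sup>2 / 2 * (indicator E x *\<^sub>R x\<^sup>2))"
      using i_sq unfolding set_integrable_def by (intro integrable_mult_right)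
    show "AE x in N. (\<lambda>n. indicator (A n) x *\<^sub>R ?g u x) \<longlonglongrightarrow> indicator E x *\<^sub>R ?g u x"
    proof (intro AE_I2)
      fix x
      \<comment> \<open>A nonzero \<open>x\<close> is eventually above the lower cut-off; at
        \<open>x = 0\<close>, which lies in \<open>E\<close> but in no \<open>A n\<close>, the
        integrand vanishes.\<close>
      have "\<forall>\<^sub>F n in sequentially. indicator (A n) x *\<^sub>R ?g u x = indicator E x *\<^sub>R ?g u x"
      proof (cases "x = 0")
        case False
        then obtain m :: nat where m: "e / \<bar>x\<bar> < real m" using reals_Archimedean2 by blast
        have "e / real (n + 2) < \<bar>x\<bar>" if "m \<le> n" for n
        proof -
          have "e / \<bar>x\<bar> < real (n + 2)" using m that by linarith
          then show ?thesis using False e by (simp add: field_simps)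
        qed
        then show ?thesis unfolding eventually_sequentially
          by (intro exI[of _ m]) (auto simp: A_def E_def indicator_def)
      qed simp
      then show "(\<lambda>n. indicator (A n) x *\<^sub>R ?g u x) \<longlonglongrightarrow> indicator E x *\<^sub>R ?g u x"
        by (rule tendsto_eventually)
    qed
    show "AE x in N. norm (indicator (A n) x *\<^sub>R ?g u x) \<le> u\<^sup>2 / 2 * (indicator E x *\<^sub>R x\<^sup>2)" for n
    proof (intro AE_I2)
      fix x
      have "cmod (?g u x) \<le> u\<^sup>2 / 2 * x\<^sup>2"
        using cmod_iexp_linear_le[of "u * x"] by (simp add: power_mult_distrib)
      then show "norm (indicator (A n) x *\<^sub>R ?g u x) \<le> u\<^sup>2 / 2 * (indicator E x *\<^sub>R x\<^sup>2)"
        using AE[of n] by (auto simp: indicator_def)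
    qed
  qed measurable
  define B where "B u = exp (t * (u\<^sup>2 / 2 * exp (\<bar>u\<bar> * e) * (LINT x:E|N. x\<^sup>2)))" for u
  have mgf: "(\<integral>\<^sup>+x. ennreal (exp (u * x)) \<partial>P n) \<le> ennreal (B u)" for n u
  proof -
    have "(\<integral>\<^sup>+x. ennreal (exp (u * x)) \<partial>P n) =
        ennreal (exp (u * (- t * c n)) * exp (t * (LINT x:A n|N. exp (u * x) - 1)))"
      unfolding P_def
      by (subst nn_integral_exp_convolution)
         (simp_all add: real_distribution_gauss real_distribution_compound_poisson uA
            nn_integral_exp_gauss nn_integral_exp_compound_poisson_uniform[OF sN A A0 A1 t i_exp] ennreal_mult)
    also have "exp (u * (- t * c n)) * exp (t * (LINT x:A n|N. exp (u * x) - 1)) =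
        exp (t * ((LINT x:A n|N. exp (u * x) - 1) - u * c n))"
      by (simp add: exp_add[symmetric] algebra_simps)
    also have "(LINT x:A n|N. exp (u * x) - 1) - u * c n = (LINT x:A n|N. (exp (u * x) - 1) - u * x)"
      unfolding c_def using i_exp[of n u] i_1[of n] i_id[of n]
      by (simp add: set_integral_diff set_integral_mult_right)
    finally have eq: "(\<integral>\<^sup>+x. ennreal (exp (u * x)) \<partial>P n) =
        ennreal (exp (t * (LINT x:A n|N. (exp (u * x) - 1) - u * x)))" .
    have "(LINT x:A n|N. (exp (u * x) - 1) - u * x) \<le> (LINT x:E|N. (u\<^sup>2 / 2 * exp (\<bar>u\<bar> * e)) * x\<^sup>2)"
      unfolding set_lebesgue_integral_def
    proof (rule integral_mono)
      show "integrable N (\<lambda>x. indicator (A n) x *\<^sub>R (exp (u * x) - 1 - u * x))"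
        using i_exp[of n u] i_1[of n] i_id[of n]
        by (fold set_integrable_def) (intro set_integral_diff set_integrable_mult_right)
      show "integrable N (\<lambda>x. indicator E x *\<^sub>R (u\<^sup>2 / 2 * exp (\<bar>u\<bar> * e) * x\<^sup>2))"
        using i_sq by (fold set_integrable_def) (intro set_integrable_mult_right)
      fix x
      have "exp (u * x) - 1 - u * x \<le> (u\<^sup>2 / 2 * exp (\<bar>u\<bar> * e)) * x\<^sup>2" if "\<bar>x\<bar> \<le> e"
        using exp_minus_linear_le[of "u * x" "\<bar>u\<bar> * e"] mult_left_mono[OF that abs_ge_zero[of u]]
        by (simp add: abs_mult power_mult_distrib mult_ac)
      then show "indicator (A n) x *\<^sub>R (exp (u * x) - 1 - u * x) \<le>
          indicator E x *\<^sub>R (u\<^sup>2 / 2 * exp (\<bar>u\<bar> * e) * x\<^sup>2)"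
        by (auto simp: indicator_def A_def E_def)
    qed
    also have "\<dots> = (u\<^sup>2 / 2 * exp (\<bar>u\<bar> * e)) * (LINT x:E|N. x\<^sup>2)" by simp
    finally show ?thesis unfolding eq B_def using t by (intro ennreal_leI) simp
  qed
  have "(\<lambda>n. char (P n) u) \<longlonglongrightarrow> exp (of_real t * (CLINT x:E|N. ?g u x))" for u
    unfolding charP by (intro tendsto_intros lim)
  from exists_limit_distribution[OF P mgf this] show ?thesis
    unfolding B_def E_def .
qed

subsection \<open>Splitting off the big jumps\<close>

text \<open>Both sides have the same characteristic function. For jumps between \<open>e\<close> and
  \<open>1\<close> the compensator in \<open>levy_exponent\<close> is linear in \<open>u\<close>
  with finite coefficient; moving it into the drift \<beta> leaves the jumps above \<open>e\<close>
  uncompensated, hence compound Poisson.\<close>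

lemma levy_decomposition:
  assumes N: "levy_measure N" and e: "0 < e" "e \<le> 1" and t: "0 < t"
    and pos: "\<And>a. 0 < a \<Longrightarrow> a < e \<Longrightarrow> emeasure N {x. a < \<bar>x\<bar> \<and> \<bar>x\<bar> \<le> e} \<noteq> 0"
    and posB: "emeasure N {x. e < \<bar>x\<bar>} \<noteq> 0"
    and \<mu>: "real_distribution \<mu>" "\<And>u. char \<mu> u = exp (of_real t * levy_exponent b \<sigma> N u)"
  defines "\<beta> \<equiv> b - (LINT x:{x. e < \<bar>x\<bar> \<and> \<bar>x\<bar> \<le> 1}|N. x)"
    and "v \<equiv> (LINT x:{x. \<bar>x\<bar> \<le> e}|N. x\<^sup>2)"
  shows "\<exists>J. real_distribution J \<and>
     (\<forall>u. (\<integral>\<^sup>+x. ennreal (exp (u * x)) \<partial>J) \<le> ennreal (exp (t * (u\<^sup>2 / 2 * exp (\<bar>u\<bar> * e) * v)))) \<and>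
     \<mu> = ((gauss (t * \<beta>) (\<sigma> * sqrt t) \<star> J) \<star>
        compound_poisson (t * measure N {x. e < \<bar>x\<bar>}) (uniform_measure N {x. e < \<bar>x\<bar>}))"
proof -
  note sN = levy_measure_sets[OF N]
  note [measurable_cong] = sN
  define E where "E = {x::real. \<bar>x\<bar> \<le> e}"
  define B where "B = {x::real. e < \<bar>x\<bar>}"
  define C where "C = {x::real. e < \<bar>x\<bar> \<and> \<bar>x\<bar> \<le> 1}"
  have [measurable]: "E \<in> sets borel" "B \<in> sets borel" "C \<in> sets borel"
    unfolding E_def B_def C_def by measurable
  have Bfin: "emeasure N B < \<infinity>" unfolding B_def by (rule levy_measure_finite[OF N e(1)])
  have "emeasure N C \<le> emeasure N B" by (intro emeasure_mono) (auto simp: C_def B_def)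
  then have Cfin: "emeasure N C < \<infinity>" using Bfin by (rule le_less_trans)
  have B1: "emeasure N B \<noteq> \<infinity>" and B0: "emeasure N B \<noteq> 0" using Bfin posB by (auto simp: B_def)
  obtain J where J: "real_distribution J"
    and cJ: "\<And>u. char J u = exp (of_real t * (CLINT x:E|N. iexp (u * x) - 1 - \<i> * of_real (u * x)))"
    and mJ: "\<And>u. (\<integral>\<^sup>+x. ennreal (exp (u * x)) \<partial>J) \<le> ennreal (exp (t * (u\<^sup>2 / 2 * exp (\<bar>u\<bar> * e) * v)))"
    using exists_small_jump_distribution[OF N e t pos] unfolding E_def v_def by blast
  have uB: "real_distribution (uniform_measure N B)"
    by (rule real_distribution_uniform_measure[OF sN B0 B1])
  let ?R = "((gauss (t * \<beta>) (\<sigma> * sqrt t) \<star> J) \<star> compound_poisson (t * measure N B) (uniform_measure N B))"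
  have R: "real_distribution ?R"
    by (intro real_distribution_convolution real_distribution_gauss J real_distribution_compound_poisson uB)
  have "char \<mu> u = char ?R u" for u
  proof -
    let ?g = "\<lambda>x. iexp (u * x) - 1 - \<i> * of_real (u * x)"
    have iE: "set_integrable N E ?g"
      unfolding set_integrable_def
    proof (rule Bochner_Integration.integrable_bound)
      show "integrable N (\<lambda>x. u\<^sup>2 / 2 * (indicator E x *\<^sub>R x\<^sup>2))"
        using levy_measure_integrable_square[OF N e(2)] unfolding set_integrable_def E_def
        by (intro integrable_mult_right)
      have "cmod (?g x) \<le> u\<^sup>2 / 2 * x\<^sup>2" for x
        using cmod_iexp_linear_le[of "u * x"] by (simp add: power_mult_distrib)
      then show "AE x in N. norm (indicator E x *\<^sub>R ?g x) \<le> norm (u\<^sup>2 / 2 * (indicator E x *\<^sub>R x\<^sup>2))"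
        by (auto simp: indicator_def)
    qed measurable
    have iB: "set_integrable N B (\<lambda>x. iexp (u * x) - 1)"
      by (rule set_integrable_bounded[OF sN _ Bfin, where B=2]) (auto intro: order_trans[OF norm_triangle_ineq4])
    have iC: "set_integrable N C (\<lambda>x. x)"
      by (rule set_integrable_bounded[OF sN _ Cfin, where B=1]) (auto simp: C_def)
    have split: "iexp (u * x) - 1 - \<i> * of_real (u * x * indicator {-1..1} x) =
        indicator E x *\<^sub>R ?g x + indicator B x *\<^sub>R (iexp (u * x) - 1) -
        (\<i> * of_real u) * of_real (indicator C x *\<^sub>R x)" for x
      using e by (auto simp: indicator_def E_def B_def C_def)
    have "(CLINT x|N. iexp (u * x) - 1 - \<i> * of_real (u * x * indicator {-1..1} x)) =
        (CLINT x:E|N. ?g x) + (CLINT x:B|N. iexp (u * x) - 1) - (\<i> * of_real u) * of_real (LINT x:C|N. x)"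
      using iE iB iC unfolding split set_lebesgue_integral_def set_integrable_def
      by (simp only: Bochner_Integration.integral_diff Bochner_Integration.integral_add
          Bochner_Integration.integrable_add integrable_mult_right integrable_of_real
          integral_mult_right_zero integral_of_real)
    then have "levy_exponent b \<sigma> N u = (\<i> * of_real (\<beta> * u) - of_real (\<sigma>\<^sup>2 * u\<^sup>2 / 2)) +
        (CLINT x:E|N. ?g x) + (CLINT x:B|N. iexp (u * x) - 1)"
      unfolding levy_exponent_def \<beta>_def C_def[symmetric] by (simp add: algebra_simps)
    then have "char \<mu> u = exp (of_real t * (\<i> * of_real (\<beta> * u) - of_real (\<sigma>\<^sup>2 * u\<^sup>2 / 2))) *
        exp (of_real t * (CLINT x:E|N. ?g x)) * exp (of_real t * (CLINT x:B|N. iexp (u * x) - 1))"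
      by (simp only: \<mu>(2) distrib_left exp_add)
    also have "of_real t * (\<i> * of_real (\<beta> * u) - of_real (\<sigma>\<^sup>2 * u\<^sup>2 / 2)) =
        \<i> * of_real (t * \<beta> * u) - of_real ((\<sigma> * sqrt t)\<^sup>2 * u\<^sup>2 / 2)"
      using t by (simp add: right_diff_distrib power_mult_distrib mult_ac of_real_power[symmetric] del: of_real_power)
    finally show ?thesis
      by (simp add: char_convolution real_distribution_convolution real_distribution_gauss J
          real_distribution_compound_poisson uB char_gauss cJ char_compound_poisson_uniform[OF sN _ B0 B1 t])
  qed
  then have "\<mu> = ?R" by (intro Levy_uniqueness[OF \<mu>(1) R] ext)
  then show ?thesis using J mJ unfolding B_def by blast
qed

section \<open>Moments deduced from exponential bounds\<close>

lemma abs_le_one_plus_square: "\<bar>x\<bar> \<le> 1 + (x::real)\<^sup>2"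
  using zero_le_power2[of "\<bar>x\<bar> - 1"] by (simp add: power2_diff)

lemma integrable_nn_bound:
  fixes f g :: "real \<Rightarrow> real"
  assumes "f \<in> borel_measurable M" and "(\<integral>\<^sup>+x. ennreal (f x) \<partial>M) \<le> ennreal c" and "\<And>x. 0 \<le> f x" "0 \<le> c"
  shows "integrable M f" "integral\<^sup>L M f \<le> c"
proof -
  show i: "integrable M f"
    using assms by (intro integrableI_bounded) (auto intro: le_less_trans)
  show "integral\<^sup>L M f \<le> c"
    using nn_integral_eq_integral[OF i] assms by auto
qed

lemma square_le_exp_sum: "x\<^sup>2 / 2 \<le> exp x + exp (- x) - (2::real)"
proof -
  have *: "y\<^sup>2 / 2 \<le> exp y + exp (- y) - 2" if "0 \<le> y" for y :: real
    using exp_lower_Taylor_quadratic[OF that] exp_ge_add_one_self[of "- y"] by linarith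
  show ?thesis using *[of x] *[of "- x"] by (cases "0 \<le> x") (auto simp: add.commute)
qed

text \<open>The constant \<open>4\<close> is crude. It does no harm: the lemma is applied with \<open>w\<close> of the order of \<open>t\<close>
  times the variance of the jumps of size at most \<open>e\<close>, which vanishes with \<open>e\<close>.\<close>

lemma moments_of_exp_bound:
  assumes J: "real_distribution J" and w: "0 \<le> w"
    and b1: "(\<integral>\<^sup>+x. ennreal (exp x) \<partial>J) \<le> ennreal (1 + w)"
    and b2: "(\<integral>\<^sup>+x. ennreal (exp (- x)) \<partial>J) \<le> ennreal (1 + w)"
  shows "integrable J (\<lambda>x. x)" "\<bar>LINT x|J. x\<bar> \<le> w" "integrable J (\<lambda>x. x\<^sup>2)"
    "0 \<le> (LINT x|J. x\<^sup>2)" "(LINT x|J. x\<^sup>2) \<le> 4 * w"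
proof -
  interpret real_distribution J by (rule J)
  note one = real_distributionD(7)[OF J]
  note e1 = integrable_nn_bound[OF _ b1] and e2 = integrable_nn_bound[OF _ b2]
  have i1: "integrable J exp" "integral\<^sup>L J exp \<le> 1 + w" using e1 w by auto
  have i2: "integrable J (\<lambda>x. exp (- x))" "(LINT x|J. exp (- x)) \<le> 1 + w" using e2 w by auto
  have i3: "integrable J (\<lambda>x. exp x + exp (- x) - 2)" using i1 i2 by auto
  have x1: "exp x + exp (- x) - 2 \<ge> x\<^sup>2 / 2" for x :: real by (rule square_le_exp_sum)
  show sq: "integrable J (\<lambda>x. x\<^sup>2)"
  proof (rule Bochner_Integration.integrable_bound)
    show "integrable J (\<lambda>x. 2 * (exp x + exp (- x) - 2))" using i3 by (intro integrable_mult_right)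
    show "AE x in J. norm (x\<^sup>2) \<le> norm (2 * (exp x + exp (- x) - 2))"
    proof (intro AE_I2)
      fix x :: real
      have "x\<^sup>2 \<le> 2 * (exp x + exp (- x) - 2)" using mult_left_mono[OF x1[of x], of 2] by simp
      then show "norm (x\<^sup>2) \<le> norm (2 * (exp x + exp (- x) - 2))" by (simp add: abs_if)
    qed
  qed simp
  show id: "integrable J (\<lambda>x. x)"
  proof (rule Bochner_Integration.integrable_bound)
    show "integrable J (\<lambda>x. 1 + x\<^sup>2)" using sq by auto
    show "AE x in J. norm x \<le> norm (1 + x\<^sup>2)" using abs_le_one_plus_square by auto
  qed simp
  show "0 \<le> (LINT x|J. x\<^sup>2)" by (intro integral_nonneg_AE) auto
  \<comment> \<open>The linear parts of the two exponentials cancel in their sum, so an excess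
    \<open>w\<close> of both exponential moments over \<open>1\<close> bounds the second
    moment.\<close>
  have "(LINT x|J. x\<^sup>2 / 2) \<le> (LINT x|J. exp x + exp (- x) - 2)"
    using sq i3 by (intro integral_mono x1) auto
  also have "\<dots> = integral\<^sup>L J exp + (LINT x|J. exp (- x)) - 2" using i1 i2 one by simp
  finally show "(LINT x|J. x\<^sup>2) \<le> 4 * w" using i1 i2 by simp
  have "(LINT x|J. 1 + x) \<le> integral\<^sup>L J exp" "(LINT x|J. 1 + - x) \<le> (LINT x|J. exp (- x))"
    using id i1 i2 by (intro integral_mono exp_ge_add_one_self; auto)+
  then show "\<bar>LINT x|J. x\<bar> \<le> w" using id i1 i2 one by simp
qed

lemma convolution_moments:
  assumes P: "real_distribution P" and Q: "real_distribution Q"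
    and P1: "integrable P (\<lambda>x. x)" and P2: "integrable P (\<lambda>x. x\<^sup>2)"
    and Q1: "integrable Q (\<lambda>x. x)" and Q2: "integrable Q (\<lambda>x. x\<^sup>2)"
  shows "integrable (P \<star> Q) (\<lambda>x. x)" "(LINT x|(P \<star> Q). x) = (LINT x|P. x) + (LINT x|Q. x)"
    "integrable (P \<star> Q) (\<lambda>x. x\<^sup>2)"
    "(LINT x|(P \<star> Q). x\<^sup>2) = (LINT x|P. x\<^sup>2) + 2 * (LINT x|P. x) * (LINT x|Q. x) + (LINT x|Q. x\<^sup>2)"
proof -
  interpret P: real_distribution P by (rule P)
  interpret Q: real_distribution Q by (rule Q)
  interpret PQ: real_distribution "P \<star> Q" by (rule real_distribution_convolution[OF P Q])
  note one = real_distributionD(7)[OF P] real_distributionD(7)[OF Q]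
  show s: "integrable (P \<star> Q) (\<lambda>x. x\<^sup>2)"
  proof (rule integrableI_bounded)
    have "(\<integral>\<^sup>+x. ennreal (norm (x\<^sup>2)) \<partial>(P \<star> Q)) \<le> (\<integral>\<^sup>+x. \<integral>\<^sup>+y. ennreal (2 * x\<^sup>2) + ennreal (2 * y\<^sup>2) \<partial>Q \<partial>P)"
    proof (subst nn_integral_convolution'[OF P Q], simp, intro nn_integral_mono)
      fix x y :: real
      have "(x + y)\<^sup>2 \<le> 2 * x\<^sup>2 + 2 * y\<^sup>2" using zero_le_power2[of "x - y"] by (simp add: power2_eq_square algebra_simps)
      then have "ennreal (norm ((x + y)\<^sup>2)) \<le> ennreal (2 * x\<^sup>2 + 2 * y\<^sup>2)" by (intro ennreal_leI) simp
      also have "\<dots> = ennreal (2 * x\<^sup>2) + ennreal (2 * y\<^sup>2)" by (rule ennreal_plus) auto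
      finally show "ennreal (norm ((x + y)\<^sup>2)) \<le> ennreal (2 * x\<^sup>2) + ennreal (2 * y\<^sup>2)" .
    qed
    also have "\<dots> = (\<integral>\<^sup>+x. ennreal (2 * x\<^sup>2) \<partial>P) + (\<integral>\<^sup>+y. ennreal (2 * y\<^sup>2) \<partial>Q)"
      by (subst nn_integral_add, simp, simp, subst nn_integral_add)
         (simp_all add: real_distributionD(5)[OF P] real_distributionD(5)[OF Q])
    also have "\<dots> = ennreal (LINT x|P. 2 * x\<^sup>2) + ennreal (LINT x|Q. 2 * x\<^sup>2)"
      using P2 Q2 by (subst (1 2) nn_integral_eq_integral) auto
    also have "\<dots> < \<infinity>" by simp
    finally show "(\<integral>\<^sup>+x. ennreal (norm (x\<^sup>2)) \<partial>(P \<star> Q)) < \<infinity>" .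
  qed simp
  show i: "integrable (P \<star> Q) (\<lambda>x. x)"
  proof (rule Bochner_Integration.integrable_bound)
    show "integrable (P \<star> Q) (\<lambda>x. 1 + x\<^sup>2)" using s by auto
    show "AE x in (P \<star> Q). norm x \<le> norm (1 + x\<^sup>2)" using abs_le_one_plus_square by auto
  qed simp
  have "(LINT x|(P \<star> Q). x) = (LINT x|P. LINT y|Q. x + y)" by (rule integral_convolution[OF P Q i])
  also have "\<dots> = (LINT x|P. x + (LINT y|Q. y))" using Q1 one by simp
  also have "\<dots> = (LINT x|P. x) + (LINT x|Q. x)" using P1 one by simp
  finally show "(LINT x|(P \<star> Q). x) = (LINT x|P. x) + (LINT x|Q. x)" .
  have "(LINT x|(P \<star> Q). x\<^sup>2) = (LINT x|P. LINT y|Q. (x + y)\<^sup>2)" by (rule integral_convolution[OF P Q s])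
  also have "\<dots> = (LINT x|P. x\<^sup>2 + (2 * (LINT y|Q. y)) * x + (LINT y|Q. y\<^sup>2))"
    using Q1 Q2 one by (simp add: power2_sum ac_simps)
  also have "\<dots> = (LINT x|P. x\<^sup>2) + 2 * (LINT x|P. x) * (LINT x|Q. x) + (LINT x|Q. x\<^sup>2)"
    using P1 P2 one by simp
  finally show "(LINT x|(P \<star> Q). x\<^sup>2) = (LINT x|P. x\<^sup>2) + 2 * (LINT x|P. x) * (LINT x|Q. x) + (LINT x|Q. x\<^sup>2)" .
qed

subsection \<open>Estimates for the small-jump law\<close>

definition payoff :: "real \<Rightarrow> real \<Rightarrow> real" where
  "payoff k x = max 0 (exp x - exp k)"

lemma payoff_measurable [measurable]: "payoff k \<in> borel_measurable borel"
  unfolding payoff_def by measurable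

lemma payoff_nonneg: "0 \<le> payoff k x"
  and payoff_le_exp: "payoff k x \<le> exp x"
  and payoff_zero: "x \<le> k \<Longrightarrow> payoff k x = 0"
  by (auto simp: payoff_def)

text \<open>As a function of \<open>exp x\<close>, the payoff is Lipschitz with constant
  one.\<close>

lemma payoff_diff_le: "\<bar>payoff k (x + y) - payoff k y\<bar> \<le> \<bar>exp x - 1\<bar> * exp y"
proof -
  have "\<bar>payoff k (x + y) - payoff k y\<bar> \<le> \<bar>exp (x + y) - exp y\<bar>"
    unfolding payoff_def by (auto simp: max_def)
  also have "exp (x + y) - exp y = (exp x - 1) * exp y" by (simp add: exp_add algebra_simps)
  finally show ?thesis by (simp add: abs_mult)
qed

text \<open>Exponential Chebyshev with exponent \<open>3 / \<delta> * ln (1 / t)\<close>, which turns \<open>exp (- p * \<delta>)\<close> into \<open>t ^ 3\<close>.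
  For jumps of size at most \<open>\<delta> / 6\<close> the price in the exponent is only a factor \<open>t powr (- 1 / 2)\<close>.\<close>

definition tail_bound :: "real \<Rightarrow> real \<Rightarrow> real \<Rightarrow> real \<Rightarrow> real \<Rightarrow> real" where
  "tail_bound \<beta> s v \<delta> t = 2 * t ^ 3 * exp (t * ((2 + 3 / \<delta> * ln (1 / t)) * \<bar>\<beta>\<bar> +
     (2 + 3 / \<delta> * ln (1 / t))\<^sup>2 / 2 * (s + exp 2 * t powr (- 1 / 2) * v)))"

text \<open>\<open>Q\<close> stands for the law at time \<open>t\<close> of the process without its jumps larger than \<open>e\<close>: its drift
  is \<open>\<beta>\<close>, its Gaussian variance \<open>s\<close>, and \<open>v\<close> is the variance rate of its jumps.\<close>

locale small_jump_law = real_distribution Q for Q +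
  fixes t \<beta> s e v w :: real
  assumes t: "0 < t" "t < 1" and s: "0 \<le> s" and e: "0 < e" "e \<le> 1" and v: "0 \<le> v" and w: "0 \<le> w"
    and mgf: "\<And>u. (\<integral>\<^sup>+x. ennreal (exp (u * x)) \<partial>Q) \<le>
        ennreal (exp (t * (u * \<beta> + u\<^sup>2 / 2 * (s + exp (\<bar>u\<bar> * e) * v))))"
    and integrable_id: "integrable Q (\<lambda>x. x)" and integrable_square: "integrable Q (\<lambda>x. x\<^sup>2)"
    and mean: "\<bar>(LINT x|Q. x) - t * \<beta>\<bar> \<le> w"
    and second: "\<bar>(LINT x|Q. x\<^sup>2) - t * s\<bar> \<le> t\<^sup>2 * \<beta>\<^sup>2 + 2 * t * \<bar>\<beta>\<bar> * w + 4 * w"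
begin

definition "mgf_bound u = exp (t * (u * \<beta> + u\<^sup>2 / 2 * (s + exp (\<bar>u\<bar> * e) * v)))"

lemma one: "measure Q UNIV = 1"
  using prob_space by simp

lemma integrable_exp: "integrable Q (\<lambda>x. exp (u * x))"
  and integral_exp_le: "(LINT x|Q. exp (u * x)) \<le> mgf_bound u"
  using integrable_nn_bound[OF _ mgf[of u]] unfolding mgf_bound_def by auto

lemma exp_abs_le: "exp (u * \<bar>x\<bar>) \<le> exp (u * x) + exp (- u * x :: real)"
  by (cases "0 \<le> x") auto

text \<open>The weight with exponent \<open>2\<close> dominates the payoff, polynomials of degree
  two and all functions bounded by a multiple of \<open>exp x\<close>, so this one estimate serves
  both \<open>payoff_expectation\<close> and \<open>quadratic_expansion\<close>.\<close>

lemma tail: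
  assumes \<delta>: "0 < \<delta>" "e \<le> \<delta> / 6"
  shows "integrable Q (\<lambda>x. indicator {x. \<delta> \<le> \<bar>x\<bar>} x * exp (2 * \<bar>x\<bar>))"
    "(LINT x|Q. indicator {x. \<delta> \<le> \<bar>x\<bar>} x * exp (2 * \<bar>x\<bar>)) \<le> tail_bound \<beta> s v \<delta> t"
proof -
  define p where "p = 3 / \<delta> * ln (1 / t)"
  \<comment> \<open>The summand \<open>2\<close> absorbs the weight; \<open>p\<close> produces the
    factor \<open>t ^ 3\<close> outside the \<delta>-neighbourhood of \<open>0\<close>.\<close>
  define q where "q = 2 + p"
  have l: "0 < ln (1 / t)" using t by (intro ln_gt_zero) auto
  have p: "0 < p" unfolding p_def using l \<delta> by simp
  have q: "0 < q" unfolding q_def using p by simp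
  have pd: "exp (- p * \<delta>) = t ^ 3"
  proof -
    have "- p * \<delta> = 3 * ln t" unfolding p_def using \<delta> t by (simp add: ln_div)
    then show ?thesis using t by (simp add: exp_of_nat_mult[of 3 "ln t", simplified])
  qed
  have qe: "exp (q * e) \<le> exp 2 * t powr (- 1 / 2)"
  proof -
    have "p * e \<le> p * (\<delta> / 6)" using p \<delta> by (intro mult_left_mono) auto
    also have "\<dots> = - 1 / 2 * ln t" unfolding p_def using \<delta> t by (simp add: ln_div)
    finally have "q * e \<le> 2 + - 1 / 2 * ln t" unfolding q_def using e by (simp add: distrib_right)
    then have "exp (q * e) \<le> exp (2 + - 1 / 2 * ln t)" by simp
    also have "\<dots> = exp 2 * t powr (- 1 / 2)" using t by (simp only: exp_add powr_def) simp
    finally show ?thesis .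
  qed
  have pt: "indicator {x. \<delta> \<le> \<bar>x\<bar>} x * exp (2 * \<bar>x\<bar>) \<le> t ^ 3 * (exp (q * x) + exp (- q * x))" for x
  proof (cases "\<delta> \<le> \<bar>x\<bar>")
    case True
    then have "p * \<delta> \<le> p * \<bar>x\<bar>" using p by simp
    then have "exp (2 * \<bar>x\<bar>) \<le> exp (- p * \<delta> + q * \<bar>x\<bar>)" unfolding q_def by (simp add: distrib_right)
    also have "\<dots> = t ^ 3 * exp (q * \<bar>x\<bar>)" unfolding exp_add pd ..
    also have "\<dots> \<le> t ^ 3 * (exp (q * x) + exp (- q * x))"
      using t by (intro mult_left_mono exp_abs_le) auto
    finally show ?thesis using True by simp
  qed (use t in \<open>auto intro!: mult_nonneg_nonneg add_nonneg_nonneg\<close>)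
  have i: "integrable Q (\<lambda>x. t ^ 3 * (exp (q * x) + exp (- q * x)))"
    using integrable_exp by (intro integrable_mult_right Bochner_Integration.integrable_add)
  show i': "integrable Q (\<lambda>x. indicator {x. \<delta> \<le> \<bar>x\<bar>} x * exp (2 * \<bar>x\<bar>))"
    by (rule Bochner_Integration.integrable_bound[OF i]) (use pt in \<open>auto intro!: AE_I2 order_trans[OF _ abs_ge_self]\<close>)
  have M: "mgf_bound u \<le> exp (t * (q * \<bar>\<beta>\<bar> + q\<^sup>2 / 2 * (s + exp 2 * t powr (- 1 / 2) * v)))"
    if "u = q \<or> u = - q" for u
  proof -
    have "u * \<beta> \<le> \<bar>u\<bar> * \<bar>\<beta>\<bar>" by (metis abs_ge_self abs_mult)
    then have "u * \<beta> \<le> q * \<bar>\<beta>\<bar>" using that q by auto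
    moreover have "u\<^sup>2 / 2 * (s + exp (\<bar>u\<bar> * e) * v) \<le> q\<^sup>2 / 2 * (s + exp 2 * t powr (- 1 / 2) * v)"
      using that q qe v by (auto intro!: mult_left_mono mult_right_mono)
    ultimately show ?thesis unfolding mgf_bound_def using t by (auto intro!: mult_left_mono add_mono)
  qed
  have "(LINT x|Q. indicator {x. \<delta> \<le> \<bar>x\<bar>} x * exp (2 * \<bar>x\<bar>)) \<le> (LINT x|Q. t ^ 3 * (exp (q * x) + exp (- q * x)))"
    by (intro integral_mono i i' pt)
  also have "\<dots> = t ^ 3 * ((LINT x|Q. exp (q * x)) + (LINT x|Q. exp (- q * x)))"
    using integrable_exp[of q] integrable_exp[of "- q"] by simp
  also have "\<dots> \<le> t ^ 3 * (mgf_bound q + mgf_bound (- q))"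
    using t by (intro mult_left_mono add_mono integral_exp_le) auto
  also have "\<dots> \<le> tail_bound \<beta> s v \<delta> t"
    unfolding tail_bound_def p_def[symmetric] q_def[symmetric] using M[of q] M[of "- q"] t by simp
  finally show "(LINT x|Q. indicator {x. \<delta> \<le> \<bar>x\<bar>} x * exp (2 * \<bar>x\<bar>)) \<le> tail_bound \<beta> s v \<delta> t" .
qed

lemma payoff_expectation:
  assumes \<delta>: "0 < \<delta>" "e \<le> \<delta> / 6" "\<delta> \<le> k"
  shows "(LINT x|Q. payoff k x) \<le> tail_bound \<beta> s v \<delta> t"
proof -
  have pt: "payoff k x \<le> indicator {x. \<delta> \<le> \<bar>x\<bar>} x * exp (2 * \<bar>x\<bar>)" for x
  proof (cases "k \<le> x")
    case True
    then have \<delta>x: "\<delta> \<le> \<bar>x\<bar>" using \<delta> by auto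
    have "exp x \<le> exp (2 * \<bar>x\<bar>)" by simp
    with payoff_le_exp[of k x] have "payoff k x \<le> exp (2 * \<bar>x\<bar>)" by (rule order_trans)
    with \<delta>x show ?thesis by simp
  qed (auto simp: payoff_zero)
  have "(LINT x|Q. payoff k x) \<le> (LINT x|Q. indicator {x. \<delta> \<le> \<bar>x\<bar>} x * exp (2 * \<bar>x\<bar>))"
  proof (rule integral_mono[OF _ tail(1) pt])
    show "integrable Q (payoff k)"
      by (rule Bochner_Integration.integrable_bound[OF integrable_exp[of 1]])
         (auto simp: payoff_nonneg payoff_le_exp)
  qed fact+
  with tail(2)[OF \<delta>(1,2)] show ?thesis by simp
qed

text \<open>Young's inequality with a free parameter \<open>r\<close> reduces the claim to the
  square of \<open>exp x - 1\<close>, which is at most \<open>exp (2 * x) - 1 - 2 * x\<close>. The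
  expectation of the latter is \<open>O(t)\<close>, so \<open>r = sqrt t\<close> later gives a bound
  of order \<open>sqrt t\<close>.\<close>

lemma abs_exp_minus_one:
  assumes r: "0 < r"
  shows "integrable Q (\<lambda>x. \<bar>exp x - 1\<bar>)"
    "(LINT x|Q. \<bar>exp x - 1\<bar>) \<le> (r + (mgf_bound 2 - 1 - 2 * t * \<beta> + 2 * w) / r) / 2"
proof -
  have i1: "integrable Q exp" using integrable_exp[of 1] by simp
  show i: "integrable Q (\<lambda>x. \<bar>exp x - 1\<bar>)" using i1 by auto
  have pt: "\<bar>exp x - 1\<bar> \<le> r / 2 + (exp (2 * x) - 1 - 2 * x) / (2 * r)" for x :: real
  proof -
    have "2 * r * \<bar>exp x - 1\<bar> \<le> r\<^sup>2 + (exp x - 1)\<^sup>2"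
      using zero_le_power2[of "r - \<bar>exp x - 1\<bar>"] by (simp add: power2_diff mult_ac)
    also have "(exp x - 1)\<^sup>2 \<le> exp (2 * x) - 1 - 2 * x"
    proof -
      have "(exp x - 1)\<^sup>2 = exp (2 * x) - 2 * exp x + 1" by (simp add: power2_diff exp_double)
      with exp_ge_add_one_self[of x] show ?thesis by linarith
    qed
    finally show ?thesis using r by (simp add: field_simps power2_eq_square)
  qed
  have j: "integrable Q (\<lambda>x. r / 2 + (exp (2 * x) - 1 - 2 * x) / (2 * r))"
    using integrable_exp[of 2] integrable_id by auto
  have "(LINT x|Q. \<bar>exp x - 1\<bar>) \<le> (LINT x|Q. r / 2 + (exp (2 * x) - 1 - 2 * x) / (2 * r))"
    by (intro integral_mono i j pt)
  also have "\<dots> = r / 2 + ((LINT x|Q. exp (2 * x)) - 1 - 2 * (LINT x|Q. x)) / (2 * r)"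
    using integrable_exp[of 2] integrable_id one by simp
  also have "\<dots> \<le> r / 2 + (mgf_bound 2 - 1 - 2 * t * \<beta> + 2 * w) / (2 * r)"
    using integral_exp_le[of 2] mean r by (intro add_left_mono divide_right_mono) auto
  also have "\<dots> = (r + (mgf_bound 2 - 1 - 2 * t * \<beta> + 2 * w) / r) / 2"
    by (simp add: add_divide_distrib)
  finally show "(LINT x|Q. \<bar>exp x - 1\<bar>) \<le> (r + (mgf_bound 2 - 1 - 2 * t * \<beta> + 2 * w) / r) / 2" .
qed

text \<open>Inside the \<delta>-neighbourhood the Taylor error is integrated against the second
  moment, which is \<open>O(t)\<close>; outside, growth at most \<open>exp x\<close> lets
  \<open>tail\<close> bound the function and its Taylor polynomial together. \<open>V\<close> is the
  error bound of the locale assumption \<open>second\<close>.\<close>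

lemma quadratic_expansion:
  fixes F :: "real \<Rightarrow> real"
  assumes F[measurable]: "F \<in> borel_measurable borel" and A: "\<And>x. \<bar>F x\<bar> \<le> A * exp x" and A0: "0 \<le> A"
    and \<delta>: "0 < \<delta>" "e \<le> \<delta> / 6" and \<eta>: "0 \<le> \<eta>"
    and near: "\<And>x. \<bar>x\<bar> \<le> \<delta> \<Longrightarrow> \<bar>F x - F0 - F1 * x - F2 / 2 * x\<^sup>2\<bar> \<le> \<eta> * x\<^sup>2"
  defines "V \<equiv> t\<^sup>2 * \<beta>\<^sup>2 + 2 * t * \<bar>\<beta>\<bar> * w + 4 * w"
  shows "\<bar>(LINT x|Q. F x) - (F0 + F1 * (t * \<beta>) + F2 / 2 * (t * s))\<bar> \<le>
    \<bar>F1\<bar> * w + \<bar>F2\<bar> / 2 * V + \<eta> * (t * s + V) + (A + \<bar>F0\<bar> + \<bar>F1\<bar> + \<bar>F2\<bar>) * tail_bound \<beta> s v \<delta> t"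
proof -
  define K where "K = A + \<bar>F0\<bar> + \<bar>F1\<bar> + \<bar>F2\<bar>"
  have K: "0 \<le> K" using A0 by (simp add: K_def)
  let ?T = "\<lambda>x. indicator {x. \<delta> \<le> \<bar>x\<bar>} x * exp (2 * \<bar>x\<bar>)"
  let ?D = "\<lambda>x. F x - F0 - F1 * x - F2 / 2 * x\<^sup>2"
  have pt: "\<bar>?D x\<bar> \<le> \<eta> * x\<^sup>2 + K * ?T x" for x
  proof (cases "\<bar>x\<bar> \<le> \<delta>")
    case True
    with near[OF True] K show ?thesis
      by (auto simp: indicator_def intro: order_trans add_increasing2)
  next
    case False
    have a: "1 + \<bar>x\<bar> + x\<^sup>2 / 2 \<le> exp \<bar>x\<bar>" using exp_lower_Taylor_quadratic[of "\<bar>x\<bar>"] by simp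
    have b: "exp \<bar>x\<bar> \<le> exp (2 * \<bar>x\<bar>)" and c: "0 \<le> x\<^sup>2" by simp_all
    have 1: "1 \<le> exp (2 * \<bar>x\<bar>)" "\<bar>x\<bar> \<le> exp (2 * \<bar>x\<bar>)" "x\<^sup>2 / 2 \<le> exp (2 * \<bar>x\<bar>)"
      using a b c by linarith+
    have 14: "exp x \<le> exp (2 * \<bar>x\<bar>)" by simp
    have "\<bar>?D x\<bar> \<le> \<bar>F x\<bar> + \<bar>F0\<bar> + \<bar>F1\<bar> * \<bar>x\<bar> + \<bar>F2\<bar> * (x\<^sup>2 / 2)"
      using abs_triangle_ineq4[of "F x - F0 - F1 * x" "F2 / 2 * x\<^sup>2"] abs_triangle_ineq4[of "F x - F0" "F1 * x"]
        abs_triangle_ineq4[of "F x" F0] by (simp add: abs_mult)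
    also have "\<dots> \<le> A * exp (2 * \<bar>x\<bar>) + \<bar>F0\<bar> * exp (2 * \<bar>x\<bar>) + \<bar>F1\<bar> * exp (2 * \<bar>x\<bar>) + \<bar>F2\<bar> * exp (2 * \<bar>x\<bar>)"
    proof (intro add_mono)
      show "\<bar>F x\<bar> \<le> A * exp (2 * \<bar>x\<bar>)"
        using A[of x] mult_left_mono[OF 14 A0] by linarith
      show "\<bar>F0\<bar> \<le> \<bar>F0\<bar> * exp (2 * \<bar>x\<bar>)" using mult_left_mono[OF 1(1), of "\<bar>F0\<bar>"] by simp
    qed (intro mult_left_mono 1, simp)+
    also have "\<dots> = K * ?T x" unfolding K_def using False by (simp add: distrib_right)
    finally show ?thesis using \<eta> by (simp add: add_increasing)
  qed
  have iF: "integrable Q F"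
    by (rule Bochner_Integration.integrable_bound[OF integrable_mult_right[OF integrable_exp[of 1], of A]])
       (use A A0 in \<open>auto simp: abs_mult intro!: AE_I2\<close>)
  note iT = tail(1)[OF \<delta>]
  have iD: "integrable Q ?D" using iF integrable_id integrable_square by auto
  have ED: "(LINT x|Q. ?D x) = (LINT x|Q. F x) - F0 - F1 * (LINT x|Q. x) - F2 / 2 * (LINT x|Q. x\<^sup>2)"
    using iF integrable_id integrable_square one by simp
  have "\<bar>LINT x|Q. ?D x\<bar> \<le> (LINT x|Q. \<bar>?D x\<bar>)" by (rule integral_abs_bound)
  also have "\<dots> \<le> (LINT x|Q. \<eta> * x\<^sup>2 + K * ?T x)"
    using iD integrable_square iT by (intro integral_mono pt) auto
  also have "\<dots> = \<eta> * (LINT x|Q. x\<^sup>2) + K * (LINT x|Q. ?T x)"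
    using integrable_square iT by simp
  also have "\<dots> \<le> \<eta> * (t * s + V) + K * tail_bound \<beta> s v \<delta> t"
    using tail(2)[OF \<delta>] second \<eta> K unfolding V_def[symmetric] by (intro add_mono mult_left_mono) auto
  finally have 1: "\<bar>LINT x|Q. ?D x\<bar> \<le> \<eta> * (t * s + V) + K * tail_bound \<beta> s v \<delta> t" .
  have 2: "\<bar>F1 * (LINT x|Q. x) - F1 * (t * \<beta>)\<bar> \<le> \<bar>F1\<bar> * w"
    unfolding right_diff_distrib[symmetric] abs_mult by (intro mult_left_mono mean) simp
  have "\<bar>F2 / 2 * (LINT x|Q. x\<^sup>2) - F2 / 2 * (t * s)\<bar> \<le> \<bar>F2 / 2\<bar> * V"
    unfolding right_diff_distrib[symmetric] abs_mult V_def by (intro mult_left_mono second) simp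
  then have 3: "\<bar>F2 / 2 * (LINT x|Q. x\<^sup>2) - F2 / 2 * (t * s)\<bar> \<le> \<bar>F2\<bar> / 2 * V" by simp
  show ?thesis using 1 2 3 unfolding ED K_def[symmetric] by linarith
qed

end

subsection \<open>Expansion in the number of big jumps\<close>

lemma exp_tail_le:
  fixes X :: real
  assumes X: "0 \<le> X"
  shows "summable (\<lambda>n. X ^ (n + 3) / fact (n + 3))" "(\<Sum>n. X ^ (n + 3) / fact (n + 3)) \<le> X ^ 3 * exp X"
proof -
  have s: "(\<lambda>n. X ^ 3 * (X ^ n / fact n)) sums (X ^ 3 * exp X)"
    using sums_mult[OF exp_converges[of X], of "X ^ 3"] by (simp add: divide_inverse_commute)
  have le: "X ^ (n + 3) / fact (n + 3) \<le> X ^ 3 * (X ^ n / fact n)" for n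
  proof -
    have "(fact n :: real) \<le> fact (n + 3)" by (rule fact_mono) simp
    then have "X ^ (n + 3) / fact (n + 3) \<le> X ^ (n + 3) / fact n"
      using X by (intro divide_left_mono) auto
    then show ?thesis by (simp add: power_add mult.commute)
  qed
  show sm: "summable (\<lambda>n. X ^ (n + 3) / fact (n + 3))"
    by (rule summable_comparison_test'[OF sums_summable[OF s]]) (use le X in auto)
  have "(\<Sum>n. X ^ (n + 3) / fact (n + 3)) \<le> (\<Sum>n. X ^ 3 * (X ^ n / fact n))"
    by (intro suminf_le le sm sums_summable[OF s])
  then show "(\<Sum>n. X ^ (n + 3) / fact (n + 3)) \<le> X ^ 3 * exp X" using sums_unique[OF s] by simp
qed

text \<open>Intended for the law of \<open>n\<close> big jumps, whose exponential moment is the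
  \<open>n\<close>-th power of that of a single jump; the bounds are explicit in the shift
  \<open>x\<close> so that they can be integrated over \<open>Q\<close>.\<close>

lemma payoff_shift_integral:
  assumes P: "real_distribution P" and a: "0 \<le> a" "(\<integral>\<^sup>+z. ennreal (exp z) \<partial>P) = ennreal a"
  shows "integrable P (\<lambda>z. payoff k (x + z))"
    "0 \<le> (LINT z|P. payoff k (x + z))" "(LINT z|P. payoff k (x + z)) \<le> a * exp x"
    "(\<integral>\<^sup>+z. ennreal (payoff k (x + z)) \<partial>P) = ennreal (LINT z|P. payoff k (x + z))"
    "\<bar>(LINT z|P. payoff k (x + z)) - (LINT z|P. payoff k z)\<bar> \<le> a * \<bar>exp x - 1\<bar>"
proof -
  interpret real_distribution P by (rule P)
  have ie: "integrable P exp" "integral\<^sup>L P exp = a"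
    using integrable_nn_bound[of exp P a] a nn_integral_eq_integral[of P exp]
    by auto
  have i: "integrable P (\<lambda>z. payoff k (x + z))" for x
    by (rule Bochner_Integration.integrable_bound[OF integrable_mult_right[OF ie(1), of "exp x"]])
       (auto simp: payoff_nonneg exp_add[symmetric] payoff_le_exp intro!: AE_I2)
  from i show "integrable P (\<lambda>z. payoff k (x + z))" .
  show "0 \<le> (LINT z|P. payoff k (x + z))" by (intro integral_nonneg_AE) (auto simp: payoff_nonneg)
  have "(LINT z|P. payoff k (x + z)) \<le> (LINT z|P. exp x * exp z)"
    by (intro integral_mono i integrable_mult_right ie) (simp add: exp_add[symmetric] payoff_le_exp)
  then show "(LINT z|P. payoff k (x + z)) \<le> a * exp x" using ie by (simp add: mult.commute)
  show "(\<integral>\<^sup>+z. ennreal (payoff k (x + z)) \<partial>P) = ennreal (LINT z|P. payoff k (x + z))"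
    using i by (intro nn_integral_eq_integral) (auto simp: payoff_nonneg)
  have "(LINT z|P. payoff k (x + z)) - (LINT z|P. payoff k z) = (LINT z|P. payoff k (x + z) - payoff k z)"
    using i[of x] i[of 0] by simp
  also have "\<bar>\<dots>\<bar> \<le> (LINT z|P. \<bar>payoff k (x + z) - payoff k z\<bar>)" by (rule integral_abs_bound)
  also have "\<dots> \<le> (LINT z|P. \<bar>exp x - 1\<bar> * exp z)"
    using i[of x] i[of 0] ie(1) by (intro integral_mono payoff_diff_le) auto
  also have "\<dots> = a * \<bar>exp x - 1\<bar>" using ie by simp
  finally show "\<bar>(LINT z|P. payoff k (x + z)) - (LINT z|P. payoff k z)\<bar> \<le> a * \<bar>exp x - 1\<bar>" .
qed

lemma payoff_shift_measurable:
  assumes P: "real_distribution P"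
  shows "(\<lambda>x. LINT z|P. payoff k (x + z)) \<in> borel_measurable borel"
proof -
  interpret real_distribution P by (rule P)
  show ?thesis by measurable
qed

context small_jump_law
begin

text \<open>The one-jump term has to be exact here, because it is of order \<open>t\<close> and
  needs the Taylor expansion. The two-jump term already carries \<open>t ^ 2\<close>, so replacing
  the shift by \<open>0\<close> is affordable as soon as \<kappa> tends to \<open>0\<close>; the
  exponential moments bound all later terms.\<close>

lemma payoff_series:
  assumes \<xi>: "real_distribution \<xi>" and lam: "0 < lam"
    and a: "0 \<le> a" "(\<integral>\<^sup>+z. ennreal (exp z) \<partial>\<xi>) = ennreal a"
    and \<delta>: "0 < \<delta>" "e \<le> \<delta> / 6" "\<delta> \<le> k" and r: "0 < r"
  defines "\<kappa> \<equiv> (r + (mgf_bound 2 - 1 - 2 * t * \<beta> + 2 * w) / r) / 2"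
    and "X \<equiv> t * lam * a"
  shows "\<bar>(LINT x|(Q \<star> compound_poisson (t * lam) \<xi>). payoff k x) -
       exp (- t * lam) * (t * lam * (LINT x|Q. LINT z|\<xi>. payoff k (x + z)) +
         (t * lam)\<^sup>2 / 2 * (LINT z|\<xi>. LINT y|\<xi>. payoff k (z + y)))\<bar>
    \<le> tail_bound \<beta> s v \<delta> t + (t * lam)\<^sup>2 / 2 * (a\<^sup>2 * \<kappa>) + mgf_bound 1 * (X ^ 3 * exp X)"
proof -
  define p where "p n = (t * lam) ^ n / fact n * exp (- (t * lam))" for n :: nat
  define G where "G n x = (LINT z|conv_power \<xi> n. payoff k (x + z))" for n x
  define R where "R n = (LINT x|Q. G n x)" for n
  define \<mu> where "\<mu> = (Q \<star> compound_poisson (t * lam) \<xi>)"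
  have tl: "0 < t * lam" using t lam by simp
  have p0: "0 \<le> p n" for n using tl by (simp add: p_def)
  have K: "real_distribution (conv_power \<xi> n)" for n by (rule real_distribution_conv_power[OF \<xi>])
  have Cx: "real_distribution (compound_poisson (t * lam) \<xi>)" by (rule real_distribution_compound_poisson[OF \<xi>])
  have Qd: "real_distribution Q" by unfold_locales
  have an: "0 \<le> a ^ n" "(\<integral>\<^sup>+z. ennreal (exp z) \<partial>conv_power \<xi> n) = ennreal (a ^ n)" for n
    using nn_integral_exp_conv_power[OF \<xi>, where u=1 and n=n] a by (auto simp: ennreal_power)
  have sh: "integrable (conv_power \<xi> n) (\<lambda>z. payoff k (x + z))" "0 \<le> G n x" "G n x \<le> a ^ n * exp x"
    "(\<integral>\<^sup>+z. ennreal (payoff k (x + z)) \<partial>conv_power \<xi> n) = ennreal (G n x)"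
    "\<bar>G n x - G n 0\<bar> \<le> a ^ n * \<bar>exp x - 1\<bar>" for n x
    using payoff_shift_integral[OF K[of n] an[of n], of k x] by (simp_all add: G_def)
  have G[measurable]: "G n \<in> borel_measurable borel" for n
    unfolding G_def[abs_def] by (rule payoff_shift_measurable[OF K])
  have iexp: "integrable Q exp" "integral\<^sup>L Q exp \<le> mgf_bound 1"
    using integrable_exp[of 1] integral_exp_le[of 1] by simp_all
  have iG: "integrable Q (G n)" for n
    by (rule Bochner_Integration.integrable_bound[OF integrable_mult_right[OF iexp(1), of "a ^ n"]])
       (use sh(2,3) an(1) in \<open>auto simp: abs_mult intro!: AE_I2\<close>)
  have R0: "0 \<le> R n" for n unfolding R_def using sh(2) by (intro integral_nonneg_AE) auto
  have Rle: "R n \<le> mgf_bound 1 * a ^ n" for n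
  proof -
    have "R n \<le> (LINT x|Q. a ^ n * exp x)"
      unfolding R_def by (intro integral_mono iG integrable_mult_right iexp sh(3))
    also have "\<dots> = a ^ n * integral\<^sup>L Q exp" by simp
    also have "\<dots> \<le> a ^ n * mgf_bound 1" by (intro mult_left_mono iexp an)
    finally show ?thesis by (simp add: mult.commute)
  qed
  have M0: "0 \<le> mgf_bound 1" by (simp add: mgf_bound_def)
  have nnR: "(\<integral>\<^sup>+x. ennreal (G n x) \<partial>Q) = ennreal (R n)" for n
    unfolding R_def using iG sh(2) by (intro nn_integral_eq_integral) auto
  have X: "0 \<le> X" unfolding X_def using tl a by simp
  have pa: "p n * a ^ n = X ^ n / fact n * exp (- (t * lam))" for n
    unfolding p_def X_def by (simp add: power_mult_distrib)
  have sX: "summable (\<lambda>n. mgf_bound 1 * (X ^ n / fact n * exp (- (t * lam))))"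
    using summable_exp[of X] by (intro summable_mult summable_mult2) (simp add: divide_inverse_commute)
  have sR: "summable (\<lambda>n. p n * R n)"
  proof (rule summable_comparison_test'[OF sX, of 0])
    fix n
    have "p n * R n \<le> p n * (mgf_bound 1 * a ^ n)" by (intro mult_left_mono Rle p0)
    also have "\<dots> = mgf_bound 1 * (X ^ n / fact n * exp (- (t * lam)))"
      unfolding pa[symmetric] by (simp only: mult_ac)
    finally show "norm (p n * R n) \<le> mgf_bound 1 * (X ^ n / fact n * exp (- (t * lam)))"
      using p0[of n] R0[of n] by (simp only: real_norm_def abs_of_nonneg mult_nonneg_nonneg)
  qed
  have nc: "(\<integral>\<^sup>+y. ennreal (payoff k (x + y)) \<partial>compound_poisson (t * lam) \<xi>) =
      (\<Sum>n. ennreal (p n) * ennreal (G n x))" for x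
    unfolding p_def sh(4)[symmetric] by (rule nn_integral_compound_poisson[OF \<xi> tl]) measurable
  \<comment> \<open>Nonnegativity permits exchanging sum and integral before any integrability is
    known; summability of the real series is supplied by the exponential series in
    \<open>X\<close>.\<close>
  have "(\<integral>\<^sup>+x. ennreal (payoff k x) \<partial>\<mu>) = (\<integral>\<^sup>+x. (\<Sum>n. ennreal (p n) * ennreal (G n x)) \<partial>Q)"
    unfolding \<mu>_def
    by (subst nn_integral_convolution'[OF Qd Cx]) (simp_all only: nc, measurable)
  also have "\<dots> = (\<Sum>n. ennreal (p n) * ennreal (R n))"
    by (subst nn_integral_suminf) (simp_all add: nn_integral_cmult nnR)
  also have "\<dots> = ennreal (\<Sum>n. p n * R n)"
    using p0 R0 sR by (simp add: ennreal_mult[symmetric] suminf_ennreal2)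
  finally have nn: "(\<integral>\<^sup>+x. ennreal (payoff k x) \<partial>\<mu>) = ennreal (\<Sum>n. p n * R n)" .
  have E: "(LINT x|\<mu>. payoff k x) = (\<Sum>n. p n * R n)"
    using nn p0 R0 sR unfolding \<mu>_def
    by (subst integral_eq_nn_integral)
       (auto simp: payoff_nonneg intro!: enn2real_ennreal suminf_nonneg)
  have split: "(\<Sum>n. p n * R n) = (\<Sum>n. p (n + 3) * R (n + 3)) + (p 0 * R 0 + p 1 * R 1 + p 2 * R 2)"
    using suminf_split_initial_segment[OF sR, of 3] by (simp add: eval_nat_numeral)
  have sR3: "summable (\<lambda>n. p (n + 3) * R (n + 3))" using sR by (rule summable_ignore_initial_segment)
  have rest0: "0 \<le> (\<Sum>n. p (n + 3) * R (n + 3))" using p0 R0 by (intro suminf_nonneg sR3) auto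
  have el1: "exp (- (t * lam)) \<le> 1" using tl by simp
  have "(\<Sum>n. p (n + 3) * R (n + 3)) \<le> (\<Sum>n. mgf_bound 1 * (X ^ (n + 3) / fact (n + 3)))"
  proof (intro suminf_le sR3 summable_mult exp_tail_le X)
    fix n
    have "p (n + 3) * R (n + 3) \<le> p (n + 3) * (mgf_bound 1 * a ^ (n + 3))" by (intro mult_left_mono Rle p0)
    also have "\<dots> = mgf_bound 1 * (X ^ (n + 3) / fact (n + 3) * exp (- (t * lam)))"
      unfolding pa[symmetric] by (simp only: mult_ac)
    also have "\<dots> \<le> mgf_bound 1 * (X ^ (n + 3) / fact (n + 3) * 1)"
      using X M0 by (intro mult_left_mono el1) auto
    finally show "p (n + 3) * R (n + 3) \<le> mgf_bound 1 * (X ^ (n + 3) / fact (n + 3))" by simp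
  qed
  also have "\<dots> = mgf_bound 1 * (\<Sum>n. X ^ (n + 3) / fact (n + 3))"
    by (rule suminf_mult[OF exp_tail_le(1)[OF X]])
  also have "\<dots> \<le> mgf_bound 1 * (X ^ 3 * exp X)" by (intro mult_left_mono exp_tail_le X M0)
  finally have rest: "(\<Sum>n. p (n + 3) * R (n + 3)) \<le> mgf_bound 1 * (X ^ 3 * exp X)" .
  have "G 0 = payoff k" unfolding G_def by (simp add: integral_return fun_eq_iff)
  then have "R 0 \<le> tail_bound \<beta> s v \<delta> t" unfolding R_def using payoff_expectation[OF \<delta>] by simp
  then have R0': "p 0 * R 0 \<le> tail_bound \<beta> s v \<delta> t"
    using mult_mono[OF el1, of "R 0" "tail_bound \<beta> s v \<delta> t"] R0[of 0] by (simp add: p_def)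
  interpret \<xi>: real_distribution \<xi> by (rule \<xi>)
  have G1: "G 1 x = (LINT z|\<xi>. payoff k (x + z))" for x
  proof -
    have "G 1 x = (LINT z|\<xi>. LINT y|return borel 0. payoff k (x + (z + y)))"
      unfolding G_def using sh(1)[of 1 x] by (simp add: integral_convolution[OF \<xi> real_distribution_return])
    then show ?thesis by (simp add: integral_return)
  qed
  have G2: "G 2 x = (LINT z|\<xi>. G 1 (x + z))" for x
  proof -
    have "G 2 x = (LINT z|\<xi>. LINT y|conv_power \<xi> 1. payoff k (x + (z + y)))"
      unfolding G_def using sh(1)[of 2 x] integral_convolution[OF \<xi> K[of 1], of "\<lambda>z. payoff k (x + z)"]
      by (simp add: eval_nat_numeral)
    then show ?thesis by (simp add: G_def add.assoc)
  qed
  have iae: "integrable Q (\<lambda>x. \<bar>exp x - 1\<bar>)" "(LINT x|Q. \<bar>exp x - 1\<bar>) \<le> \<kappa>"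
    unfolding \<kappa>_def using abs_exp_minus_one[OF r] by auto
  have "R 2 - G 2 0 = (LINT x|Q. G 2 x - G 2 0)"
    unfolding R_def using iG one by simp
  also have "\<bar>\<dots>\<bar> \<le> (LINT x|Q. \<bar>G 2 x - G 2 0\<bar>)" by (rule integral_abs_bound)
  also have "\<dots> \<le> (LINT x|Q. a\<^sup>2 * \<bar>exp x - 1\<bar>)"
  proof (intro integral_mono integrable_mult_right iae)
    show "integrable Q (\<lambda>x. \<bar>G 2 x - G 2 0\<bar>)" using iG by auto
    show "\<bar>G 2 x - G 2 0\<bar> \<le> a\<^sup>2 * \<bar>exp x - 1\<bar>" for x
      using sh(5)[of 2 x] by (simp add: G_def)
  qed
  also have "\<dots> \<le> a\<^sup>2 * \<kappa>" using iae by (simp add: mult_left_mono)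
  finally have R2: "\<bar>R 2 - G 2 0\<bar> \<le> a\<^sup>2 * \<kappa>" .
  have p1: "p 1 = exp (- t * lam) * (t * lam)" and p2: "p 2 = exp (- t * lam) * ((t * lam)\<^sup>2 / 2)"
    by (simp_all add: p_def fact_2)
  have "\<bar>p 2 * R 2 - p 2 * G 2 0\<bar> = p 2 * \<bar>R 2 - G 2 0\<bar>"
    using p0[of 2] by (simp add: right_diff_distrib[symmetric] abs_mult)
  also have "\<dots> \<le> ((t * lam)\<^sup>2 / 2) * (a\<^sup>2 * \<kappa>)"
  proof (intro mult_mono R2)
    show "p 2 \<le> (t * lam)\<^sup>2 / 2"
      unfolding p2 using mult_right_mono[OF el1, of "(t * lam)\<^sup>2 / 2"] by simp
  qed auto
  finally have P2: "\<bar>p 2 * R 2 - p 2 * G 2 0\<bar> \<le> (t * lam)\<^sup>2 / 2 * (a\<^sup>2 * \<kappa>)" .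
  have target: "exp (- t * lam) * (t * lam * (LINT x|Q. LINT z|\<xi>. payoff k (x + z)) +
         (t * lam)\<^sup>2 / 2 * (LINT z|\<xi>. LINT y|\<xi>. payoff k (z + y))) = p 1 * R 1 + p 2 * G 2 0"
    unfolding p1 p2 by (simp add: G2 G1 R_def distrib_left mult.assoc del: One_nat_def)
  have "0 \<le> p 0 * R 0" using p0 R0 by simp
  then show ?thesis
    unfolding target E[unfolded \<mu>_def] split
    using rest rest0 R0' P2 by linarith
qed

end

subsection \<open>Size of the remainder\<close>

lemma exp_linear_quotient_limit: "((\<lambda>t. (exp (t * c) - 1) / t) \<longlongrightarrow> (c::real)) (at_right 0)"
  by real_asymp

text \<open>The worst term of the exponent is of order \<open>sqrt t\<close> times a squared
  logarithm, so the exponential tends to \<open>1\<close>, and dividing \<open>t ^ 3\<close> by the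
  square of \<open>t\<close> leaves a factor \<open>t\<close>.\<close>

lemma tail_bound_limit:
  assumes \<delta>: "0 < \<delta>"
  shows "((\<lambda>t. tail_bound \<beta> s v \<delta> t / t\<^sup>2) \<longlongrightarrow> 0) (at_right 0)"
proof -
  let ?q = "\<lambda>t. 2 + 3 / \<delta> * ln (1 / t)"
  have 1: "((\<lambda>t. t * ?q t) \<longlongrightarrow> 0) (at_right 0)"
    and 2: "((\<lambda>t. t * (?q t)\<^sup>2) \<longlongrightarrow> 0) (at_right 0)"
    and 3: "((\<lambda>t. t * (?q t)\<^sup>2 * t powr (- 1 / 2)) \<longlongrightarrow> 0) (at_right 0)"
    using \<delta> by real_asymp+
  have "((\<lambda>t. 2 * t * exp (t * ?q t * \<bar>\<beta>\<bar> + t * (?q t)\<^sup>2 * (s / 2) + t * (?q t)\<^sup>2 * t powr (- 1 / 2) * (exp 2 * v / 2)))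
      \<longlongrightarrow> 2 * 0 * exp (0 * \<bar>\<beta>\<bar> + 0 * (s / 2) + 0 * (exp 2 * v / 2))) (at_right 0)"
    by (intro tendsto_intros 1 2 3)
  moreover have "\<forall>\<^sub>F t in at_right 0. 2 * t * exp (t * ?q t * \<bar>\<beta>\<bar> + t * (?q t)\<^sup>2 * (s / 2) + t * (?q t)\<^sup>2 * t powr (- 1 / 2) * (exp 2 * v / 2)) =
      tail_bound \<beta> s v \<delta> t / t\<^sup>2"
    using eventually_at_right_less[of 0]
  proof eventually_elim
    case (elim t)
    have "tail_bound \<beta> s v \<delta> t / t\<^sup>2 = 2 * t * exp (t * (?q t * \<bar>\<beta>\<bar> + (?q t)\<^sup>2 / 2 * (s + exp 2 * t powr (- 1 / 2) * v)))"
      using elim by (simp add: tail_bound_def power2_eq_square power3_eq_cube)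
    also have "t * (?q t * \<bar>\<beta>\<bar> + (?q t)\<^sup>2 / 2 * (s + exp 2 * t powr (- 1 / 2) * v)) =
       t * ?q t * \<bar>\<beta>\<bar> + t * (?q t)\<^sup>2 * (s / 2) + t * (?q t)\<^sup>2 * t powr (- 1 / 2) * (exp 2 * v / 2)"
      by (simp add: field_simps)
    finally show ?case by simp
  qed
  ultimately show ?thesis by (simp add: tendsto_cong)
qed

text \<open>The probability \<open>exp (- t * l)\<close> of no big jump accompanies every term; its
  first-order part acts on \<open>F0\<close> and yields the contribution
  \<open>- l * F0\<close>.\<close>

lemma first_order_limit:
  "((\<lambda>t. (exp (- t * l) * (t * (F0 + t * P) + t\<^sup>2 / 2 * H) - t * F0 - t\<^sup>2 * (- l * F0 + P + H / 2)) / t\<^sup>2)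
     \<longlongrightarrow> (0::real)) (at_right 0)"
proof -
  have "((\<lambda>t. (exp (t * - l) - 1) / t * F0 + l * F0 + (exp (- t * l) - 1) * (P + H / 2)) \<longlongrightarrow>
     (- l) * F0 + l * F0 + (exp (- 0 * l) - 1) * (P + H / 2)) (at_right 0)"
    by (intro tendsto_intros exp_linear_quotient_limit)
  moreover have "\<forall>\<^sub>F t in at_right 0. (exp (t * - l) - 1) / t * F0 + l * F0 + (exp (- t * l) - 1) * (P + H / 2) =
     (exp (- t * l) * (t * (F0 + t * P) + t\<^sup>2 / 2 * H) - t * F0 - t\<^sup>2 * (- l * F0 + P + H / 2)) / t\<^sup>2"
    using eventually_at_right_less[of 0]
    by eventually_elim (simp add: field_simps power2_eq_square)
  ultimately show ?thesis by (simp add: tendsto_cong)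
qed

text \<open>The remainder is kept in the shape in which the estimates for fixed \<open>t\<close> produce it;
  only its size as \<open>t\<close> tends to \<open>0\<close> matters.\<close>

lemma remainder_limit:
  fixes \<beta> s e v \<delta> l a F0 F1 F2 H \<eta> K :: real
  assumes \<delta>: "0 < \<delta>"
  defines "w \<equiv> \<lambda>t. exp (t * (exp 1 / 2 * v)) - 1"
  defines "V \<equiv> \<lambda>t. t\<^sup>2 * \<beta>\<^sup>2 + 2 * t * \<bar>\<beta>\<bar> * w t + 4 * w t"
  defines "\<theta> \<equiv> \<lambda>t. exp (t * (2 * \<beta> + 2\<^sup>2 / 2 * (s + exp (\<bar>2\<bar> * e) * v))) - 1 - 2 * t * \<beta> + 2 * w t"
  defines "B \<equiv> \<lambda>t. \<bar>exp (- t * l) * (t * (F0 + t * (F1 * \<beta> + F2 / 2 * s)) + t\<^sup>2 / 2 * H) - t * F0 -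
        t\<^sup>2 * (- l * F0 + (F1 * \<beta> + F2 / 2 * s) + H / 2)\<bar> +
      t * (\<bar>F1\<bar> * w t + \<bar>F2\<bar> / 2 * V t + \<eta> * (t * s + V t) + K * tail_bound \<beta> s v \<delta> t) +
      (tail_bound \<beta> s v \<delta> t + (t * l)\<^sup>2 / 2 * (a\<^sup>2 * ((sqrt t + \<theta> t / sqrt t) / 2)) +
        exp (t * (1 * \<beta> + 1\<^sup>2 / 2 * (s + exp (\<bar>1\<bar> * e) * v))) * ((t * l * a) ^ 3 * exp (t * l * a)))"
  shows "((\<lambda>t. B t / t\<^sup>2) \<longlongrightarrow> (\<bar>F1\<bar> / 2 + \<bar>F2\<bar>) * exp 1 * v + \<eta> * (s + 2 * exp 1 * v)) (at_right 0)"
proof -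
  \<comment> \<open>The derivative of \<open>w\<close> at \<open>0\<close>. It survives in the limit
    as the price of knowing the moments of \<open>Q\<close> only approximately.\<close>
  let ?c = "exp 1 / 2 * v"
  have w1: "((\<lambda>t. w t / t) \<longlongrightarrow> ?c) (at_right 0)" unfolding w_def by (rule exp_linear_quotient_limit)
  have w0: "(w \<longlongrightarrow> exp (0 * ?c) - 1) (at_right 0)" unfolding w_def by (intro tendsto_intros)
  then have w0: "(w \<longlongrightarrow> 0) (at_right 0)" by simp
  have V1: "((\<lambda>t. t * \<beta>\<^sup>2 + 2 * \<bar>\<beta>\<bar> * w t + 4 * (w t / t)) \<longlongrightarrow> 0 * \<beta>\<^sup>2 + 2 * \<bar>\<beta>\<bar> * 0 + 4 * ?c) (at_right 0)"
    by (intro tendsto_intros w0 w1)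
  then have V1: "((\<lambda>t. t * \<beta>\<^sup>2 + 2 * \<bar>\<beta>\<bar> * w t + 4 * (w t / t)) \<longlongrightarrow> 4 * ?c) (at_right 0)" by simp
  note \<tau> = tail_bound_limit[OF \<delta>, of \<beta> s v]
  let ?m = "2 * \<beta> + 2\<^sup>2 / 2 * (s + exp (\<bar>2\<bar> * e) * v)"
  have sq: "(sqrt \<longlongrightarrow> sqrt 0) (at_right 0)" by (intro tendsto_intros)
  \<comment> \<open>Since \<theta> is \<open>O(t)\<close>, writing its quotient by
    \<open>sqrt t\<close> as \<open>sqrt t\<close> times its quotient by \<open>t\<close> shows that
    the two-jump error vanishes after division by the square of \<open>t\<close>.\<close>
  have \<kappa>: "((\<lambda>t. (sqrt t + sqrt t * ((exp (t * ?m) - 1) / t - 2 * \<beta> + 2 * (w t / t))) / 2) \<longlongrightarrow>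
      (sqrt 0 + sqrt 0 * (?m - 2 * \<beta> + 2 * ?c)) / 2) (at_right 0)"
    by (intro tendsto_intros exp_linear_quotient_limit w1 sq) simp
  let ?T1 = "\<lambda>t. \<bar>(exp (- t * l) * (t * (F0 + t * (F1 * \<beta> + F2 / 2 * s)) + t\<^sup>2 / 2 * H) - t * F0 -
        t\<^sup>2 * (- l * F0 + (F1 * \<beta> + F2 / 2 * s) + H / 2)) / t\<^sup>2\<bar>"
  let ?T2 = "\<lambda>t. \<bar>F1\<bar> * (w t / t) + \<bar>F2\<bar> / 2 * (t * \<beta>\<^sup>2 + 2 * \<bar>\<beta>\<bar> * w t + 4 * (w t / t)) +
       \<eta> * (s + (t * \<beta>\<^sup>2 + 2 * \<bar>\<beta>\<bar> * w t + 4 * (w t / t))) + K * (t * (tail_bound \<beta> s v \<delta> t / t\<^sup>2))"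
  let ?T3 = "\<lambda>t. tail_bound \<beta> s v \<delta> t / t\<^sup>2 + l\<^sup>2 / 2 * (a\<^sup>2 * ((sqrt t + sqrt t * ((exp (t * ?m) - 1) / t - 2 * \<beta> + 2 * (w t / t))) / 2)) +
        exp (t * (1 * \<beta> + 1\<^sup>2 / 2 * (s + exp (\<bar>1\<bar> * e) * v))) * (t * (l * a) ^ 3 * exp (t * l * a))"
  have "((\<lambda>t. ?T1 t + ?T2 t + ?T3 t) \<longlongrightarrow> \<bar>0\<bar> + (\<bar>F1\<bar> * ?c + \<bar>F2\<bar> / 2 * (4 * ?c) + \<eta> * (s + 4 * ?c) + K * (0 * 0)) +
      (0 + l\<^sup>2 / 2 * (a\<^sup>2 * ((sqrt 0 + sqrt 0 * (?m - 2 * \<beta> + 2 * ?c)) / 2)) +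
       exp (0 * (1 * \<beta> + 1\<^sup>2 / 2 * (s + exp (\<bar>1\<bar> * e) * v))) * (0 * (l * a) ^ 3 * exp (0 * l * a)))) (at_right 0)"
    by (intro tendsto_add[OF tendsto_add] first_order_limit[THEN tendsto_rabs] tendsto_add tendsto_mult
          tendsto_const w1 V1 \<tau> \<kappa> tendsto_ident_at tendsto_exp)
  moreover have "\<forall>\<^sub>F t in at_right 0. ?T1 t + ?T2 t + ?T3 t = B t / t\<^sup>2"
    using eventually_at_right_less[of 0]
  proof eventually_elim
    case (elim t)
    have r: "sqrt t * sqrt t = t" "0 < sqrt t" using elim by simp_all
    have V: "V t = t * (t * \<beta>\<^sup>2 + 2 * \<bar>\<beta>\<bar> * w t + 4 * (w t / t))"
      unfolding V_def using elim by (simp add: power2_eq_square distrib_left)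
    have \<theta>: "\<theta> t / sqrt t = sqrt t * ((exp (t * ?m) - 1) / t - 2 * \<beta> + 2 * (w t / t))"
    proof -
      have "sqrt t * ((exp (t * ?m) - 1) / t - 2 * \<beta> + 2 * (w t / t)) = sqrt t / t * \<theta> t"
        unfolding \<theta>_def using elim by (simp add: field_simps)
      also have "sqrt t / t = 1 / sqrt t" using r elim by (simp add: field_simps)
      finally show ?thesis by simp
    qed
    have d: "(A + t * C + D) / t\<^sup>2 = A / t\<^sup>2 + C / t + D / t\<^sup>2" for A C D
      using elim by (simp add: add_divide_distrib power2_eq_square)
    have T1: "?T1 t = \<bar>exp (- t * l) * (t * (F0 + t * (F1 * \<beta> + F2 / 2 * s)) + t\<^sup>2 / 2 * H) - t * F0 -
        t\<^sup>2 * (- l * F0 + (F1 * \<beta> + F2 / 2 * s) + H / 2)\<bar> / t\<^sup>2"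
      by (simp add: abs_divide)
    have T2: "?T2 t = (\<bar>F1\<bar> * w t + \<bar>F2\<bar> / 2 * V t + \<eta> * (t * s + V t) + K * tail_bound \<beta> s v \<delta> t) / t"
      unfolding V using elim by (simp add: add_divide_distrib distrib_left power2_eq_square)
    have T3: "?T3 t = (tail_bound \<beta> s v \<delta> t + (t * l)\<^sup>2 / 2 * (a\<^sup>2 * ((sqrt t + \<theta> t / sqrt t) / 2)) +
        exp (t * (1 * \<beta> + 1\<^sup>2 / 2 * (s + exp (\<bar>1\<bar> * e) * v))) * ((t * l * a) ^ 3 * exp (t * l * a))) / t\<^sup>2"
      unfolding \<theta> using elim by (simp add: add_divide_distrib power_mult_distrib power2_eq_square power3_eq_cube)
    show ?case unfolding B_def d T1 T2 T3 ..
  qed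
  ultimately have "((\<lambda>t. B t / t\<^sup>2) \<longlongrightarrow> \<bar>0\<bar> + (\<bar>F1\<bar> * ?c + \<bar>F2\<bar> / 2 * (4 * ?c) + \<eta> * (s + 4 * ?c) + K * (0 * 0)) +
      (0 + l\<^sup>2 / 2 * (a\<^sup>2 * ((sqrt 0 + sqrt 0 * (?m - 2 * \<beta> + 2 * ?c)) / 2)) +
       exp (0 * (1 * \<beta> + 1\<^sup>2 / 2 * (s + exp (\<bar>1\<bar> * e) * v))) * (0 * (l * a) ^ 3 * exp (0 * l * a)))) (at_right 0)"
    by (rule Lim_transform_eventually)
  then show ?thesis by (simp add: algebra_simps)
qed

subsection \<open>Levy measures with a density\<close>

locale levy_density =
  fixes N :: "real measure" and \<nu> :: "real \<Rightarrow> real"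
  assumes levy: "levy_measure N"
    and N_eq: "N = density lborel (\<lambda>x. ennreal (\<nu> x))"
    and pos: "\<And>x. x \<noteq> 0 \<Longrightarrow> 0 < \<nu> x"
    and cont: "continuous_on (- {0}) \<nu>"
begin

text \<open>The value of \<nu> at \<open>0\<close> is arbitrary, hence it is split off from the
  continuous part.\<close>

lemma density_measurable [measurable]: "\<nu> \<in> borel_measurable borel"
proof -
  have "(\<lambda>x. indicator (- {0}) x *\<^sub>R \<nu> x + indicator {0} x *\<^sub>R \<nu> 0) \<in> borel_measurable borel"
    by (intro borel_measurable_add borel_measurable_continuous_on_indicator cont) auto
  moreover have "(\<lambda>x. indicator (- {0}) x *\<^sub>R \<nu> x + indicator {0} x *\<^sub>R \<nu> 0) = \<nu>"
    by (auto simp: indicator_def fun_eq_iff)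
  ultimately show ?thesis by simp
qed

lemma sets_N [measurable_cong]: "sets N = sets borel"
  by (rule levy_measure_sets[OF levy])

lemma AE_density_nonneg: "AE x in lborel. 0 \<le> \<nu> x"
proof -
  have "AE x in lborel. x \<noteq> (0::real)" by (rule AE_lborel_singleton)
  then show ?thesis by eventually_elim (auto simp: less_imp_le pos)
qed

lemma set_integrable_N:
  fixes f :: "real \<Rightarrow> real"
  assumes "f \<in> borel_measurable borel" "A \<in> sets borel"
  shows "set_integrable N A f \<longleftrightarrow> set_integrable lborel A (\<lambda>x. f x * \<nu> x)"
  unfolding set_integrable_def N_eq using assms AE_density_nonneg
  by (subst integrable_density) (auto simp: mult_ac)

lemma set_integral_N:
  fixes f :: "real \<Rightarrow> real"
  assumes "f \<in> borel_measurable borel" "A \<in> sets borel"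
  shows "(LINT x:A|N. f x) = (LBINT x:A. f x * \<nu> x)"
  unfolding set_lebesgue_integral_def N_eq using assms AE_density_nonneg
  by (subst integral_density) (auto simp: mult_ac)

text \<open>Needed to normalise restrictions of \<open>N\<close> to probability measures.\<close>

lemma emeasure_N_nonzero:
  assumes ab: "a < b" "{a<..<b} \<subseteq> A" and A: "A \<in> sets borel" "0 \<notin> A"
  shows "emeasure N A \<noteq> 0"
proof
  assume "emeasure N A = 0"
  then have "(\<integral>\<^sup>+x. ennreal (\<nu> x) * indicator A x \<partial>lborel) = 0"
    unfolding N_eq using A by (simp add: emeasure_density)
  then have "AE x in lborel. ennreal (\<nu> x) * indicator A x = 0"
    using A by (subst (asm) nn_integral_0_iff_AE) auto
  then have "AE x in lborel. x \<notin> A"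
  proof eventually_elim
    case (elim x)
    then show ?case using pos[of x] A by (auto simp: ennreal_eq_0_iff not_le[symmetric] split: split_indicator_asm)
  qed
  then have "emeasure lborel A = 0" using A by (subst AE_iff_measurable[symmetric, of A lborel "\<lambda>x. x \<notin> A"]) auto
  then have "emeasure lborel {a<..<b} \<le> 0" using emeasure_mono[OF ab(2), of lborel] A by simp
  then show False using ab by simp
qed

lemma small_jump_integral:
  fixes f :: "real \<Rightarrow> real"
  assumes e: "e \<le> 1" and m: "set_borel_measurable N {x. \<bar>x\<bar> \<le> e} f"
    and f: "\<And>x. \<bar>x\<bar> \<le> e \<Longrightarrow> \<bar>f x\<bar> \<le> c * x\<^sup>2"
  shows "set_integrable N {x. \<bar>x\<bar> \<le> e} f"
    "\<bar>LINT x:{x. \<bar>x\<bar> \<le> e}|N. f x\<bar> \<le> c * (LINT x:{x. \<bar>x\<bar> \<le> e}|N. x\<^sup>2)"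
proof -
  let ?E = "{x. \<bar>x\<bar> \<le> e}"
  have sq: "integrable N (\<lambda>x. c * (indicator ?E x *\<^sub>R x\<^sup>2))"
    using levy_measure_integrable_square[OF levy e] unfolding set_integrable_def by (intro integrable_mult_right)
  have bound: "\<bar>indicator ?E x *\<^sub>R f x\<bar> \<le> c * (indicator ?E x *\<^sub>R x\<^sup>2)" for x
    using f[of x] by (auto simp: indicator_def)
  show i: "set_integrable N ?E f"
    unfolding set_integrable_def
    by (rule Bochner_Integration.integrable_bound[OF sq m[unfolded set_borel_measurable_def]])
       (use bound in \<open>auto intro!: AE_I2 order_trans[OF _ abs_ge_self]\<close>)
  have "\<bar>LINT x:?E|N. f x\<bar> \<le> (LINT x|N. \<bar>indicator ?E x *\<^sub>R f x\<bar>)"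
    unfolding set_lebesgue_integral_def by (rule integral_abs_bound)
  also have "\<dots> \<le> (LINT x|N. c * (indicator ?E x *\<^sub>R x\<^sup>2))"
    by (intro integral_mono bound sq integrable_abs i[unfolded set_integrable_def])
  also have "\<dots> = c * (LINT x:?E|N. x\<^sup>2)" unfolding set_lebesgue_integral_def by (rule integral_mult_right_zero)
  finally show "\<bar>LINT x:?E|N. f x\<bar> \<le> c * (LINT x:?E|N. x\<^sup>2)" .
qed

text \<open>Dominated convergence along \<open>e = 1 / real (Suc n)\<close>, where the point
  \<open>0\<close> contributes nothing to the integral of the square; monotonicity in
  \<open>e\<close> covers all smaller levels.\<close>

lemma small_variance_tendsto:
  assumes r: "0 < r"
  shows "\<exists>e0>0. e0 \<le> 1 \<and> (\<forall>e. 0 < e \<and> e \<le> e0 \<longrightarrow> (LINT x:{x. \<bar>x\<bar> \<le> e}|N. x\<^sup>2) \<le> r)"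
proof -
  define E where "E e = {x::real. \<bar>x\<bar> \<le> e}" for e
  have [measurable]: "E e \<in> sets borel" for e unfolding E_def by measurable
  have i: "set_integrable N (E e) (\<lambda>x. x\<^sup>2)" if "e \<le> 1" for e
    using levy_measure_integrable_square[OF levy that] unfolding E_def .
  have "(\<lambda>n. LINT x:E (1 / real (Suc n))|N. x\<^sup>2) \<longlonglongrightarrow> (LINT x|N. 0)"
    unfolding set_lebesgue_integral_def
  proof (rule integral_dominated_convergence[where w="\<lambda>x. indicator (E 1) x *\<^sub>R x\<^sup>2"])
    show "integrable N (\<lambda>x. indicator (E 1) x *\<^sub>R x\<^sup>2)" using i[of 1] unfolding set_integrable_def by simp
    show "AE x in N. (\<lambda>n. indicator (E (1 / real (Suc n))) x *\<^sub>R x\<^sup>2) \<longlonglongrightarrow> 0"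
    proof (intro AE_I2)
      fix x :: real
      have "\<forall>\<^sub>F n in sequentially. indicator (E (1 / real (Suc n))) x *\<^sub>R x\<^sup>2 = 0"
      proof (cases "x = 0")
        case False
        then obtain m where m: "inverse (real (Suc m)) < \<bar>x\<bar>" using reals_Archimedean[of "\<bar>x\<bar>"] by auto
        have "1 / real (Suc n) < \<bar>x\<bar>" if "m \<le> n" for n
        proof -
          have "1 / real (Suc n) \<le> 1 / real (Suc m)" using that by (intro divide_left_mono) auto
          then show ?thesis using m by (simp add: inverse_eq_divide)
        qed
        then have "indicator (E (1 / real (Suc n))) x *\<^sub>R x\<^sup>2 = 0" if "m \<le> n" for n
          using that by (fastforce simp: E_def indicator_def)
        then show ?thesis unfolding eventually_sequentially by blast
      qed simp
      then show "(\<lambda>n. indicator (E (1 / real (Suc n))) x *\<^sub>R x\<^sup>2) \<longlonglongrightarrow> 0" by (rule tendsto_eventually)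
    qed
    show "AE x in N. norm (indicator (E (1 / real (Suc n))) x *\<^sub>R x\<^sup>2) \<le> indicator (E 1) x *\<^sub>R x\<^sup>2" for n
    proof (intro AE_I2)
      fix x :: real
      have "1 / real (Suc n) \<le> 1" by simp
      then have "E (1 / real (Suc n)) \<subseteq> E 1" unfolding E_def using order_trans by blast
      then show "norm (indicator (E (1 / real (Suc n))) x *\<^sub>R x\<^sup>2) \<le> indicator (E 1) x *\<^sub>R x\<^sup>2"
        by (auto simp: indicator_def)
    qed
  qed measurable
  then have "\<forall>\<^sub>F n in sequentially. (LINT x:E (1 / real (Suc n))|N. x\<^sup>2) < r"
    using r by (intro order_tendstoD) auto
  then obtain n where n: "(LINT x:E (1 / real (Suc n))|N. x\<^sup>2) < r" by (auto simp: eventually_sequentially)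
  have "(LINT x:E e|N. x\<^sup>2) \<le> r" if "0 < e" "e \<le> 1 / real (Suc n)" for e
  proof -
    have n1: "1 / real (Suc n) \<le> 1" by simp
    have "set_integrable N (E e) (\<lambda>x. x\<^sup>2)" "set_integrable N (E (1 / real (Suc n))) (\<lambda>x. x\<^sup>2)"
      by (rule i[OF order_trans[OF that(2) n1]], rule i[OF n1])
    then have "(LINT x:E e|N. x\<^sup>2) \<le> (LINT x:E (1 / real (Suc n))|N. x\<^sup>2)"
      unfolding set_lebesgue_integral_def set_integrable_def
      by (intro integral_mono) (use that in \<open>auto simp: E_def indicator_def\<close>)
    with n show ?thesis by simp
  qed
  then show ?thesis unfolding E_def by (intro exI[of _ "1 / real (Suc n)"]) auto
qed

end

section \<open>Derivatives of upper tails and Taylor expansion\<close>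

lemma tail_integral_has_derivative:
  fixes f :: "real \<Rightarrow> real"
  assumes i: "\<And>a. 0 < a \<Longrightarrow> set_integrable lborel {a..} f" and c: "continuous_on {0<..} f" and y: "0 < y"
  shows "((\<lambda>y. LBINT z:{y..}. f z) has_real_derivative - f y) (at y)"
proof -
  \<comment> \<open>The fundamental theorem is applied on a compact interval around \<open>y\<close>
    that stays away from \<open>0\<close>, where \<open>f\<close> may be singular.\<close>
  let ?a = "y / 2" and ?b = "2 * y"
  have sub: "set_integrable lborel A f" if "A \<subseteq> {?a..}" "A \<in> sets borel" for A
    using set_integrable_subset[OF i[of ?a]] that y by auto
  have "continuous_on {?a..?b} f" using y by (intro continuous_on_subset[OF c]) auto
  then have "((\<lambda>x. integral {?a..x} f) has_real_derivative f y) (at y within {?a..?b})"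
    using y by (intro integral_has_real_derivative) auto
  then have d: "((\<lambda>x. integral {?a..x} f) has_real_derivative f y) (at y)"
    using y at_within_interior[of y "{?a..?b}"] by simp
  have "((\<lambda>x. (LBINT z:{?a..}. f z) - integral {?a..x} f) has_real_derivative 0 - f y) (at y)"
    by (intro DERIV_diff DERIV_const d)
  moreover have "\<forall>\<^sub>F x in nhds y. (LBINT z:{?a..}. f z) - integral {?a..x} f = (LBINT z:{x..}. f z)"
  proof (rule eventually_mono[OF eventually_nhds_in_open[of "{?a<..}" y]])
    fix x assume x: "x \<in> {?a<..}"
    have 1: "set_integrable lborel {?a..x} f" "set_integrable lborel {x..} f" using x by (auto intro!: sub)
    have "(LBINT z:{?a..}. f z) = (LBINT z:{?a..x} \<union> {x..}. f z)"
      using x by (intro arg_cong[where f="\<lambda>A. LBINT z:A. f z"]) auto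
    also have "\<dots> = (LBINT z:{?a..x}. f z) + (LBINT z:{x..}. f z)"
    proof (rule set_integral_Un_AE[OF _ _ _ 1])
      show "AE z in lborel. \<not> (z \<in> {?a..x} \<and> z \<in> {x..})"
        using AE_lborel_singleton[of x] by eventually_elim auto
    qed auto
    also have "(LBINT z:{?a..x}. f z) = integral {?a..x} f"
      by (rule set_borel_integral_eq_integral(2)[OF 1(1)])
    finally show "(LBINT z:{?a..}. f z) - integral {?a..x} f = (LBINT z:{x..}. f z)" by simp
  qed (use y in auto)
  ultimately show ?thesis
    by (subst (asm) DERIV_cong_ev[OF refl _ refl]) auto
qed

context levy_density
begin

lemma finite_away: "A \<in> sets borel \<Longrightarrow> 0 < a \<Longrightarrow> A \<subseteq> {x. a < \<bar>x\<bar>} \<Longrightarrow> emeasure N A < \<infinity>"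
  using emeasure_mono[of A "{x. a < \<bar>x\<bar>}" N] levy_measure_finite[OF levy, of a] by (simp add: sets_N le_less_trans)

lemma integrable_away:
  fixes f :: "real \<Rightarrow> real"
  assumes "A \<in> sets borel" "0 < a" "A \<subseteq> {x. a < \<bar>x\<bar>}" "f \<in> borel_measurable borel" "\<And>x. x \<in> A \<Longrightarrow> \<bar>f x\<bar> \<le> c"
  shows "set_integrable N A f"
  by (rule set_integrable_bounded[OF sets_N assms(1) finite_away[OF assms(1-3)] assms(4)]) (use assms(5) in auto)

lemma measure_away: "A \<in> sets borel \<Longrightarrow> 0 < a \<Longrightarrow> A \<subseteq> {x. a < \<bar>x\<bar>} \<Longrightarrow> (LINT x:A|N. 1) = measure N A"
  using finite_away[of A a] by (simp add: set_integral_const sets_N)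

text \<open>For \<open>y \<le> 0\<close> the measure may be infinite and \<open>utail y\<close> is then the junk value \<open>0\<close>; hence the
  indicators below.\<close>

definition "utail y = measure N {y..}"

lemma utail_integral: "0 < y \<Longrightarrow> utail y = (LINT z:{y..}|N. 1)"
  unfolding utail_def by (rule measure_away[symmetric, of _ "y / 2"]) auto

lemma utail_eq: "0 < y \<Longrightarrow> utail y = (LBINT z:{y..}. \<nu> z)"
  by (simp add: utail_integral set_integral_N)

lemma utail_derivative:
  assumes y: "0 < y"
  shows "(utail has_real_derivative - \<nu> y) (at y)"
proof -
  have c: "continuous_on {0<..} \<nu>" by (rule continuous_on_subset[OF cont]) auto
  have "((\<lambda>y. LBINT z:{y..}. \<nu> z) has_real_derivative - \<nu> y) (at y)"
  proof (rule tail_integral_has_derivative[OF _ c y])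
    fix a :: real assume a: "0 < a"
    have "set_integrable N {a..} (\<lambda>x. 1::real)"
      by (rule integrable_away[where a="a / 2" and c=1]) (use a in auto)
    then show "set_integrable lborel {a..} \<nu>" by (simp add: set_integrable_N)
  qed
  then show ?thesis
  proof (rule has_field_derivative_transform_within_open)
    show "open {0::real<..}" "y \<in> {0<..}" using y by auto
  qed (simp add: utail_eq)
qed

end

text \<open>Peano form: differentiability of \<open>f1\<close> at the single point \<open>0\<close>
  gives the bound for its linearisation, which the mean value theorem integrates once.\<close>

lemma second_order_taylor:
  fixes f f1 :: "real \<Rightarrow> real"
  assumes r: "0 < r" and f: "\<And>x. \<bar>x\<bar> < r \<Longrightarrow> (f has_real_derivative f1 x) (at x)"
    and f1: "(f1 has_real_derivative f2) (at 0)" and \<eta>: "0 < \<eta>"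
  shows "\<exists>\<delta>>0. \<delta> < r \<and> (\<forall>x. \<bar>x\<bar> \<le> \<delta> \<longrightarrow> \<bar>f x - f 0 - f1 0 * x - f2 / 2 * x\<^sup>2\<bar> \<le> \<eta> * x\<^sup>2)"
proof -
  have "(f1 has_derivative (*) f2) (at 0)" using f1 by (simp add: has_field_derivative_def)
  then obtain d where d: "d > 0" "\<And>y. \<bar>y\<bar> < d \<Longrightarrow> \<bar>f1 y - f1 0 - f2 * y\<bar> \<le> \<eta> * \<bar>y\<bar>"
    unfolding has_derivative_at_alt using \<eta> by auto
  define \<delta> where "\<delta> = min d r / 2"
  have \<delta>: "0 < \<delta>" "\<delta> < d" "\<delta> < r" using d r by (auto simp: \<delta>_def min_def)
  have "\<bar>f x - f 0 - f1 0 * x - f2 / 2 * x\<^sup>2\<bar> \<le> \<eta> * x\<^sup>2" if x: "\<bar>x\<bar> \<le> \<delta>" for x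
  proof -
    let ?g = "\<lambda>x. f x - f1 0 * x - f2 / 2 * x\<^sup>2"
    have "norm (?g x - ?g 0) \<le> (\<eta> * \<bar>x\<bar>) * norm (x - 0)"
    proof (rule field_differentiable_bound[of "{- \<bar>x\<bar>..\<bar>x\<bar>}" ?g "\<lambda>y. f1 y - f1 0 - f2 * y"])
      fix y assume y: "y \<in> {- \<bar>x\<bar>..\<bar>x\<bar>}"
      then have yd: "\<bar>y\<bar> < d" "\<bar>y\<bar> < r" "\<bar>y\<bar> \<le> \<bar>x\<bar>" using x \<delta> by auto
      show "(?g has_real_derivative f1 y - f1 0 - f2 * y) (at y within {- \<bar>x\<bar>..\<bar>x\<bar>})"
        by (rule has_field_derivative_at_within) (auto intro!: derivative_eq_intros f yd)
      have "\<bar>f1 y - f1 0 - f2 * y\<bar> \<le> \<eta> * \<bar>y\<bar>" by (rule d(2)[OF yd(1)])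
      also have "\<dots> \<le> \<eta> * \<bar>x\<bar>" using \<eta> yd by (intro mult_left_mono) auto
      finally show "norm (f1 y - f1 0 - f2 * y) \<le> \<eta> * \<bar>x\<bar>" by simp
    qed auto
    then show ?thesis by (simp add: power2_eq_square algebra_simps abs_mult_self_eq)
  qed
  then show ?thesis using \<delta> by blast
qed

subsection \<open>Second-order expansion of the payoff\<close>

lemma small_jump_law_gauss:
  assumes J: "real_distribution J" and t: "0 < t" "t < 1" and e: "0 < e" "e \<le> 1" and v: "0 \<le> v"
    and mgf: "\<And>u. (\<integral>\<^sup>+x. ennreal (exp (u * x)) \<partial>J) \<le> ennreal (exp (t * (u\<^sup>2 / 2 * exp (\<bar>u\<bar> * e) * v)))"
  shows "small_jump_law (gauss (t * \<beta>) (\<sigma> * sqrt t) \<star> J) t \<beta> (\<sigma>\<^sup>2) e v (exp (t * (exp 1 / 2 * v)) - 1)"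
proof -
  let ?G = "gauss (t * \<beta>) (\<sigma> * sqrt t)" and ?w = "exp (t * (exp 1 / 2 * v)) - 1"
  note G = real_distribution_gauss[of "t * \<beta>" "\<sigma> * sqrt t"]
  have w: "0 \<le> ?w" using t v by simp
  \<comment> \<open>Only the exponents \<open>1\<close> and \<open>-1\<close> are used for the
    moments, and \<open>e\<close> is at most \<open>1\<close>; this is the origin of
    \<open>exp 1 / 2\<close> in \<open>w\<close>.\<close>
  have "t * (1 / 2 * exp e * v) \<le> t * (exp 1 / 2 * v)"
    using t v e by (intro mult_left_mono) (auto intro: mult_right_mono)
  then have "ennreal (exp (t * (1 / 2 * exp e * v))) \<le> ennreal (1 + ?w)" by (intro ennreal_leI) simp
  then have m: "(\<integral>\<^sup>+x. ennreal (exp x) \<partial>J) \<le> ennreal (1 + ?w)" "(\<integral>\<^sup>+x. ennreal (exp (- x)) \<partial>J) \<le> ennreal (1 + ?w)"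
    using mgf[of 1] mgf[of "-1"] by (auto intro: order_trans)
  note mJ = moments_of_exp_bound[OF J w m]
  note mG = gauss_moments[of "t * \<beta>" "\<sigma> * sqrt t"]
  note mQ = convolution_moments[OF G J mG(1) mG(3) mJ(1) mJ(3)]
  have sq: "(\<sigma> * sqrt t)\<^sup>2 = t * \<sigma>\<^sup>2" using t by (simp add: power_mult_distrib)
  interpret Q: real_distribution "?G \<star> J" by (rule real_distribution_convolution[OF G J])
  show ?thesis
  proof
    show "0 < t" "t < 1" "0 \<le> \<sigma>\<^sup>2" "0 < e" "e \<le> 1" "0 \<le> v" "0 \<le> ?w" using assms w by auto
    show "integrable (?G \<star> J) (\<lambda>x. x)" "integrable (?G \<star> J) (\<lambda>x. x\<^sup>2)" by fact+
    show "\<bar>(LINT x|(?G \<star> J). x) - t * \<beta>\<bar> \<le> ?w" using mJ(2) by (simp add: mQ(2) mG(2))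
    have "\<bar>2 * (t * \<beta>) * (LINT x|J. x)\<bar> \<le> 2 * t * \<bar>\<beta>\<bar> * ?w"
      using mult_left_mono[OF mJ(2), of "2 * t * \<bar>\<beta>\<bar>"] t by (simp add: abs_mult mult_ac)
    then show "\<bar>(LINT x|(?G \<star> J). x\<^sup>2) - t * \<sigma>\<^sup>2\<bar> \<le> t\<^sup>2 * \<beta>\<^sup>2 + 2 * t * \<bar>\<beta>\<bar> * ?w + 4 * ?w"
      using mJ(4,5) zero_le_power2[of "t * \<beta>"] unfolding mQ(4) mG(2,4) sq power_mult_distrib[of t \<beta>] by linarith
    fix u
    have "(\<integral>\<^sup>+x. ennreal (exp (u * x)) \<partial>(?G \<star> J)) \<le>
        ennreal (exp (u * (t * \<beta>) + (\<sigma> * sqrt t)\<^sup>2 * u\<^sup>2 / 2)) * ennreal (exp (t * (u\<^sup>2 / 2 * exp (\<bar>u\<bar> * e) * v)))"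
      unfolding nn_integral_exp_convolution[OF G J] nn_integral_exp_gauss by (intro mult_left_mono mgf) simp
    also have "\<dots> = ennreal (exp (t * (u * \<beta> + u\<^sup>2 / 2 * (\<sigma>\<^sup>2 + exp (\<bar>u\<bar> * e) * v))))"
      unfolding sq by (simp add: ennreal_mult[symmetric] exp_add[symmetric] algebra_simps)
    finally show "(\<integral>\<^sup>+x. ennreal (exp (u * x)) \<partial>(?G \<star> J)) \<le>
        ennreal (exp (t * (u * \<beta> + u\<^sup>2 / 2 * (\<sigma>\<^sup>2 + exp (\<bar>u\<bar> * e) * v))))" .
  qed
qed

section \<open>Integrals of the payoff over big jumps\<close>

locale exp_levy_density = levy_density +
  assumes exp_tail: "set_integrable N {x. 1 < \<bar>x\<bar>} exp"
begin

text \<open>The upper tail of the tilted measure, that is of \<nu> multiplied by \<open>exp\<close>;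
  it is identified with the tail of \<open>N_star\<close> only at the end.\<close>

definition "tail1 y = (LINT z:{y..}|N. exp z)"
definition "drift b e = b - (LINT x:{x. e < \<bar>x\<bar> \<and> \<bar>x\<bar> \<le> 1}|N. x)"
definition "rate e = measure N {x. e < \<bar>x\<bar>}"
definition "pairs k e = (LINT z:{x. e < \<bar>x\<bar>}|N. LINT y:{x. e < \<bar>x\<bar>}|N. payoff k (z + y))"
text \<open>The coefficient of \<open>t\<^sup>2\<close> produced by truncation at \<open>e\<close>. It depends on \<open>e\<close>; as \<open>e\<close> tends to
  \<open>0\<close> it tends to half of the coefficient built from the two functionals \<open>d2\<close>.\<close>

definition "coef k b \<sigma> e = - rate e * (tail1 k - exp k * utail k) +
  (tail1 k * drift b e + (tail1 k + exp k * \<nu> k) / 2 * \<sigma>\<^sup>2) + pairs k e / 2"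

lemma big_finite: "0 < a \<Longrightarrow> emeasure N {x. a < \<bar>x\<bar>} < \<infinity>"
  by (rule levy_measure_finite[OF levy])

lemma big_integrable_const: "0 < a \<Longrightarrow> set_integrable N {x. a < \<bar>x\<bar>} (\<lambda>x. c::real)"
  by (rule set_integrable_bounded[OF sets_N _ big_finite, where B="\<bar>c\<bar>"]) auto

lemma big_integrable_exp:
  assumes a: "0 < a"
  shows "set_integrable N {x. a < \<bar>x\<bar>} exp"
proof -
  have "emeasure N {x. a < \<bar>x\<bar> \<and> \<bar>x\<bar> \<le> 1} \<le> emeasure N {x. a < \<bar>x\<bar>}"
    by (intro emeasure_mono) auto
  then have fin: "emeasure N {x. a < \<bar>x\<bar> \<and> \<bar>x\<bar> \<le> 1} < \<infinity>" using big_finite[OF a] by (rule le_less_trans)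
  have "set_integrable N {x. a < \<bar>x\<bar> \<and> \<bar>x\<bar> \<le> 1} exp"
    by (rule set_integrable_bounded[OF sets_N _ fin, where B="exp 1"]) auto
  from set_integrable_Un[OF this exp_tail] show ?thesis
    by (rule set_integrable_subset) auto
qed

lemma upper_integrable:
  assumes "0 < a"
  shows "set_integrable N {a..} (\<lambda>x. c::real)" "set_integrable N {a..} exp"
  using assms
  by (auto intro!: set_integrable_subset[OF big_integrable_const[of "a / 2"]]
      set_integrable_subset[OF big_integrable_exp[of "a / 2"]])

lemma tail1_derivative:
  assumes y: "0 < y"
  shows "(tail1 has_real_derivative - (exp y * \<nu> y)) (at y)"
proof -
  have c: "continuous_on {0<..} \<nu>" by (rule continuous_on_subset[OF cont]) auto
  have "((\<lambda>y. LBINT z:{y..}. exp z * \<nu> z) has_real_derivative - (exp y * \<nu> y)) (at y)"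
    using upper_integrable(2) y
    by (intro tail_integral_has_derivative) (auto simp: set_integrable_N intro!: continuous_intros c)
  moreover have "tail1 = (\<lambda>y. LBINT z:{y..}. exp z * \<nu> z)"
    unfolding tail1_def by (intro ext set_integral_N) auto
  ultimately show ?thesis by simp
qed

text \<open>For such \<open>x\<close> the payoff is nonzero only if \<open>z\<close> exceeds
  \<open>k - x\<close>, hence exceeds \<open>e\<close>: the truncation is invisible and the value
  does not depend on \<open>e\<close>.\<close>

lemma big_jump_payoff:
  assumes k: "0 < k" and e: "0 < e" "e \<le> k / 2" and x: "\<bar>x\<bar> < k / 2"
  shows "(LINT z:{z. e < \<bar>z\<bar>}|N. payoff k (x + z)) = exp x * tail1 (k - x) - exp k * utail (k - x)"
proof -
  have kx: "0 < k - x" "e < k - x" using assms by auto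
  have "indicator {z. e < \<bar>z\<bar>} z *\<^sub>R payoff k (x + z) =
      exp x * (indicator {k - x..} z *\<^sub>R exp z) - exp k * (indicator {k - x..} z *\<^sub>R 1)" for z
    using kx by (auto simp: indicator_def payoff_def exp_add[symmetric])
  then show ?thesis
    using upper_integrable(1)[OF kx(1), of 1] upper_integrable(2)[OF kx(1)]
    unfolding utail_integral[OF kx(1)] tail1_def set_lebesgue_integral_def set_integrable_def by simp
qed

text \<open>In the first derivative the boundary terms at \<open>k - x\<close> cancel, because the
  payoff vanishes at its kink; the second derivative keeps one such term,
  \<open>exp k * \<nu> k\<close>. That \<delta> is chosen before \<open>e\<close> matters, since
  \<open>e\<close> will have to be at most \<delta>\<open>/ 6\<close>.\<close>

lemma big_jump_payoff_taylor:
  assumes k: "0 < k" and \<eta>: "0 < \<eta>"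
  shows "\<exists>\<delta>>0. \<delta> < k / 2 \<and> (\<forall>e x. 0 < e \<and> e \<le> k / 2 \<and> \<bar>x\<bar> \<le> \<delta> \<longrightarrow>
     \<bar>(LINT z:{z. e < \<bar>z\<bar>}|N. payoff k (x + z)) - (tail1 k - exp k * utail k) - tail1 k * x -
       (tail1 k + exp k * \<nu> k) / 2 * x\<^sup>2\<bar> \<le> \<eta> * x\<^sup>2)"
proof -
  let ?f = "\<lambda>x. exp x * tail1 (k - x) - exp k * utail (k - x)" and ?f1 = "\<lambda>x. exp x * tail1 (k - x)"
  have d0: "((\<lambda>x. utail (k - x)) has_real_derivative \<nu> (k - x)) (at x)"
    and d1: "((\<lambda>x. tail1 (k - x)) has_real_derivative exp (k - x) * \<nu> (k - x)) (at x)" if "\<bar>x\<bar> < k / 2" for x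
  proof -
    have p: "0 < k - x" using that by auto
    have g: "((\<lambda>x. k - x) has_real_derivative - 1) (at x)" by (auto intro!: derivative_eq_intros)
    show "((\<lambda>x. utail (k - x)) has_real_derivative \<nu> (k - x)) (at x)"
      using DERIV_chain2[OF utail_derivative[OF p] g] by simp
    show "((\<lambda>x. tail1 (k - x)) has_real_derivative exp (k - x) * \<nu> (k - x)) (at x)"
      using DERIV_chain2[OF tail1_derivative[OF p] g] by simp
  qed
  have f: "(?f has_real_derivative ?f1 x) (at x)" if x: "\<bar>x\<bar> < k / 2" for x
    using exp_diff[of k x] by (auto intro!: derivative_eq_intros d0[OF x] d1[OF x] simp: field_simps)
  have k0: "\<bar>0\<bar> < k / 2" using k by simp
  have f1: "(?f1 has_real_derivative tail1 k + exp k * \<nu> k) (at 0)"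
    using d1[OF k0] by (auto intro!: derivative_eq_intros)
  obtain \<delta> where \<delta>: "0 < \<delta>" "\<delta> < k / 2"
    and t: "\<And>x. \<bar>x\<bar> \<le> \<delta> \<Longrightarrow> \<bar>?f x - ?f 0 - ?f1 0 * x - (tail1 k + exp k * \<nu> k) / 2 * x\<^sup>2\<bar> \<le> \<eta> * x\<^sup>2"
    using second_order_taylor[OF _ f f1 \<eta>] k by (metis half_gt_zero)
  show ?thesis
  proof (intro exI[of _ \<delta>] conjI allI impI \<delta>)
    fix e x assume a: "0 < e \<and> e \<le> k / 2 \<and> \<bar>x\<bar> \<le> \<delta>"
    then have "\<bar>x\<bar> < k / 2" using \<delta> by simp
    then have "(LINT z:{z. e < \<bar>z\<bar>}|N. payoff k (x + z)) = ?f x"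
      using a by (intro big_jump_payoff[OF k]) auto
    then show "\<bar>(LINT z:{z. e < \<bar>z\<bar>}|N. payoff k (x + z)) - (tail1 k - exp k * utail k) - tail1 k * x -
       (tail1 k + exp k * \<nu> k) / 2 * x\<^sup>2\<bar> \<le> \<eta> * x\<^sup>2" using t[of x] a by simp
  qed
qed

text \<open>All estimates for one fixed \<open>t\<close>. Replacing \<open>uniform_measure\<close>
  by \<open>N\<close> multiplies each big jump by the rate \<open>l\<close>, so \<open>t * l\<close>
  times the law of one jump becomes \<open>t\<close> times an integral over \<open>N\<close>, and
  two jumps give \<open>H\<close>.\<close>

lemma payoff_expansion_step:
  assumes \<mu>: "real_distribution \<mu>" "\<And>u. char \<mu> u = exp (of_real t * levy_exponent b \<sigma> N u)"
    and t: "0 < t" "t < 1" and k: "0 < k" and \<delta>: "0 < \<delta>" "\<delta> \<le> k" and \<eta>: "0 \<le> \<eta>"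
    and e: "0 < e" "e \<le> 1" "e \<le> \<delta> / 6"
    and near: "\<And>x. \<bar>x\<bar> \<le> \<delta> \<Longrightarrow> \<bar>(LINT z:{z. e < \<bar>z\<bar>}|N. payoff k (x + z)) - F0 - F1 * x - F2 / 2 * x\<^sup>2\<bar> \<le> \<eta> * x\<^sup>2"
  defines "v \<equiv> (LINT x:{x. \<bar>x\<bar> \<le> e}|N. x\<^sup>2)" and "\<beta> \<equiv> drift b e" and "l \<equiv> rate e" and "s \<equiv> \<sigma>\<^sup>2"
    and "a \<equiv> (LINT z:{z. e < \<bar>z\<bar>}|N. exp z) / rate e" and "H \<equiv> pairs k e"
  defines "w \<equiv> exp (t * (exp 1 / 2 * v)) - 1"
  defines "V \<equiv> t\<^sup>2 * \<beta>\<^sup>2 + 2 * t * \<bar>\<beta>\<bar> * w + 4 * w"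
  defines "\<theta> \<equiv> exp (t * (2 * \<beta> + 2\<^sup>2 / 2 * (s + exp (\<bar>2\<bar> * e) * v))) - 1 - 2 * t * \<beta> + 2 * w"
  shows "\<bar>(LINT x|\<mu>. payoff k x) - t * F0 - t\<^sup>2 * (- l * F0 + (F1 * \<beta> + F2 / 2 * s) + H / 2)\<bar> \<le>
      \<bar>exp (- t * l) * (t * (F0 + t * (F1 * \<beta> + F2 / 2 * s)) + t\<^sup>2 / 2 * H) - t * F0 -
        t\<^sup>2 * (- l * F0 + (F1 * \<beta> + F2 / 2 * s) + H / 2)\<bar> +
      t * (\<bar>F1\<bar> * w + \<bar>F2\<bar> / 2 * V + \<eta> * (t * s + V) + (l * a + \<bar>F0\<bar> + \<bar>F1\<bar> + \<bar>F2\<bar>) * tail_bound \<beta> s v \<delta> t) +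
      (tail_bound \<beta> s v \<delta> t + (t * l)\<^sup>2 / 2 * (a\<^sup>2 * ((sqrt t + \<theta> / sqrt t) / 2)) +
        exp (t * (1 * \<beta> + 1\<^sup>2 / 2 * (s + exp (\<bar>1\<bar> * e) * v))) * ((t * l * a) ^ 3 * exp (t * l * a)))"
proof -
  define B where "B = {z::real. e < \<bar>z\<bar>}"
  have B[measurable]: "B \<in> sets borel" unfolding B_def by measurable
  define \<xi> where "\<xi> = uniform_measure N B"
  have B0: "emeasure N B \<noteq> 0"
    by (rule emeasure_N_nonzero[of e "e + 1"]) (use e in \<open>auto simp: B_def\<close>)
  have Bfin: "emeasure N B < \<infinity>" unfolding B_def by (rule big_finite[OF e(1)])
  have B1: "emeasure N B \<noteq> \<infinity>" using Bfin by simp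
  have l: "l = measure N B" unfolding l_def rate_def B_def ..
  have l0: "0 < l" unfolding l
    using B0 Bfin by (simp add: measure_def enn2real_positive_iff zero_less_iff_neq_zero)
  have el: "emeasure N B = ennreal l" unfolding l using B1 by (intro emeasure_eq_ennreal_measure) auto
  have \<xi>: "real_distribution \<xi>" unfolding \<xi>_def by (rule real_distribution_uniform_measure[OF sets_N B0 B1])
  have v0: "0 \<le> v" unfolding v_def set_lebesgue_integral_def by (intro integral_nonneg_AE) auto
  have pos': "emeasure N {x. a < \<bar>x\<bar> \<and> \<bar>x\<bar> \<le> e} \<noteq> 0" if "0 < a" "a < e" for a
    by (rule emeasure_N_nonzero[of a e]) (use that in auto)
  obtain J where J: "real_distribution J"
    "\<And>u. (\<integral>\<^sup>+x. ennreal (exp (u * x)) \<partial>J) \<le> ennreal (exp (t * (u\<^sup>2 / 2 * exp (\<bar>u\<bar> * e) * v)))"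
    and \<mu>J: "\<mu> = ((gauss (t * \<beta>) (\<sigma> * sqrt t) \<star> J) \<star> compound_poisson (t * l) \<xi>)"
    using levy_decomposition[OF levy e(1,2) t(1) pos' B0[unfolded B_def] \<mu>]
    unfolding v_def \<beta>_def drift_def l_def rate_def \<xi>_def B_def by blast
  interpret L: small_jump_law "gauss (t * \<beta>) (\<sigma> * sqrt t) \<star> J" t \<beta> s e v w
    unfolding w_def s_def by (rule small_jump_law_gauss[OF J(1) t e(1,2) v0 J(2)])
  let ?Q = "gauss (t * \<beta>) (\<sigma> * sqrt t) \<star> J"
  let ?I = "LINT z:B|N. exp z"
  have I0: "0 \<le> ?I" unfolding set_lebesgue_integral_def by (intro integral_nonneg_AE) auto
  have aI: "a = ?I / l" unfolding a_def l_def B_def ..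
  have a0: "0 \<le> a" unfolding aI using I0 l0 by simp
  have "(\<integral>\<^sup>+z. ennreal (exp z) \<partial>\<xi>) = (\<integral>\<^sup>+x. ennreal (exp x) * indicator B x \<partial>N) / emeasure N B"
    unfolding \<xi>_def by (intro nn_integral_uniform_measure) (auto simp: sets_N)
  also have "(\<integral>\<^sup>+x. ennreal (exp x) * indicator B x \<partial>N) = (\<integral>\<^sup>+x. ennreal (indicator B x *\<^sub>R exp x) \<partial>N)"
    by (intro nn_integral_cong) (auto simp: indicator_def)
  also have "\<dots> = ennreal ?I"
    using big_integrable_exp[OF e(1)] unfolding set_lebesgue_integral_def set_integrable_def B_def
    by (intro nn_integral_eq_integral) auto
  also have "ennreal ?I / emeasure N B = ennreal a"
    unfolding el aI using l0 I0 by (simp add: divide_ennreal)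
  finally have a1: "(\<integral>\<^sup>+z. ennreal (exp z) \<partial>\<xi>) = ennreal a" .
  define F where "F x = (LINT z:B|N. payoff k (x + z))" for x
  have \<xi>int: "(LINT z|\<xi>. f z) = (LINT z:B|N. f z) / l" if "f \<in> borel_measurable borel" for f :: "real \<Rightarrow> real"
    unfolding \<xi>_def l using that by (subst integral_uniform_measure[OF _ _ B0 B1]) (auto simp: sets_N divide_inverse_commute)
  have F: "F x = l * (LINT z|\<xi>. payoff k (x + z))" for x
    unfolding F_def using l0 by (subst \<xi>int) auto
  note sh = payoff_shift_integral[OF \<xi> a0 a1, of k]
  have Fm: "F \<in> borel_measurable borel"
    unfolding F[abs_def] using payoff_shift_measurable[OF \<xi>] by (intro borel_measurable_times) auto
  have FA: "\<bar>F x\<bar> \<le> (l * a) * exp x" for x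
    unfolding F using sh(2,3)[of x] l0 by (simp add: abs_mult mult_left_mono mult.assoc)
  have H: "H = l\<^sup>2 * (LINT z|\<xi>. LINT y|\<xi>. payoff k (z + y))"
  proof -
    have "H = (LINT z:B|N. F z)" unfolding H_def pairs_def F_def B_def ..
    also have "\<dots> = l * (LINT z|\<xi>. F z)" using \<xi>int[OF Fm] l0 by simp
    also have "(LINT z|\<xi>. F z) = l * (LINT z|\<xi>. LINT y|\<xi>. payoff k (z + y))" unfolding F by simp
    finally show ?thesis by (simp add: power2_eq_square)
  qed
  \<comment> \<open>The free parameter of \<open>abs_exp_minus_one\<close> is set to
    \<open>sqrt t\<close>, which balances its two summands.\<close>
  have X1: "\<bar>(LINT x|\<mu>. payoff k x) - exp (- t * l) * (t * (LINT x|?Q. F x) + t\<^sup>2 / 2 * H)\<bar> \<le>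
      tail_bound \<beta> s v \<delta> t + (t * l)\<^sup>2 / 2 * (a\<^sup>2 * ((sqrt t + \<theta> / sqrt t) / 2)) +
      L.mgf_bound 1 * ((t * l * a) ^ 3 * exp (t * l * a))"
    using L.payoff_series[OF \<xi> l0 a0 a1 \<delta>(1) e(3) \<delta>(2), of "sqrt t"] t
    unfolding \<mu>J H F \<theta>_def L.mgf_bound_def[of 2] by (simp add: power_mult_distrib mult_ac)
  have X2: "\<bar>(LINT x|?Q. F x) - (F0 + F1 * (t * \<beta>) + F2 / 2 * (t * s))\<bar> \<le>
     \<bar>F1\<bar> * w + \<bar>F2\<bar> / 2 * V + \<eta> * (t * s + V) + (l * a + \<bar>F0\<bar> + \<bar>F1\<bar> + \<bar>F2\<bar>) * tail_bound \<beta> s v \<delta> t"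
    unfolding V_def
    by (rule L.quadratic_expansion[OF Fm FA _ \<delta>(1) e(3) \<eta>]) (use l0 a0 near in \<open>auto simp: F_def B_def\<close>)
  define Y where "Y = F0 + t * (F1 * \<beta> + F2 / 2 * s)"
  have Y: "F0 + F1 * (t * \<beta>) + F2 / 2 * (t * s) = Y" unfolding Y_def by (simp add: algebra_simps)
  define R where "R = \<bar>F1\<bar> * w + \<bar>F2\<bar> / 2 * V + \<eta> * (t * s + V) + (l * a + \<bar>F0\<bar> + \<bar>F1\<bar> + \<bar>F2\<bar>) * tail_bound \<beta> s v \<delta> t"
  have X2: "\<bar>(LINT x|?Q. F x) - Y\<bar> \<le> R" using X2 unfolding Y R_def .
  have "\<bar>exp (- t * l) * (t * (LINT x|?Q. F x) + t\<^sup>2 / 2 * H) - exp (- t * l) * (t * Y + t\<^sup>2 / 2 * H)\<bar> =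
      exp (- t * l) * (t * \<bar>(LINT x|?Q. F x) - Y\<bar>)"
    using t by (simp add: right_diff_distrib[symmetric] abs_mult)
  also have "\<dots> \<le> 1 * (t * R)"
    using t l0 X2 by (intro mult_mono) auto
  finally have X3: "\<bar>exp (- t * l) * (t * (LINT x|?Q. F x) + t\<^sup>2 / 2 * H) - exp (- t * l) * (t * Y + t\<^sup>2 / 2 * H)\<bar> \<le> t * R"
    by simp
  show ?thesis
    unfolding Y_def[symmetric] R_def[symmetric]
    using X1[unfolded L.mgf_bound_def] X3 by linarith
qed

text \<open>The choices are made in the order \<eta>, \<delta>, \<open>e\<close>, \<open>t\<close>:
  the Taylor accuracy fixes \<delta>, then \<open>e\<close> must be small relative to \<delta> and
  have small variance, and only then does \<open>t\<close> tend to \<open>0\<close>.\<close>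

lemma payoff_expansion:
  assumes \<mu>: "\<And>t. 0 < t \<Longrightarrow> real_distribution (\<mu> t)"
      "\<And>t u. 0 < t \<Longrightarrow> char (\<mu> t) u = exp (of_real t * levy_exponent b \<sigma> N u)"
    and k: "0 < k" and \<rho>: "0 < \<rho>"
  shows "\<exists>e0>0. \<forall>e. 0 < e \<and> e \<le> e0 \<longrightarrow> (\<forall>\<^sub>F t in at_right 0.
     \<bar>(LINT x|\<mu> t. payoff k x) - t * (tail1 k - exp k * utail k) - t\<^sup>2 * coef k b \<sigma> e\<bar> \<le> \<rho> * t\<^sup>2)"
proof -
  define F0 where "F0 = tail1 k - exp k * utail k"
  define F1 where "F1 = tail1 k"
  define F2 where "F2 = tail1 k + exp k * \<nu> k"
  define v where "v e = (LINT x:{x. \<bar>x\<bar> \<le> e}|N. x\<^sup>2)" for e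
  \<comment> \<open>For \<open>v e \<le> 1\<close>, \<open>C\<close> dominates both the coefficient
    of \<open>v e\<close> and the factor of \<eta> in the limit of the remainder. With
    \<open>v e\<close> at most \<rho>\<open>/ (4 * C)\<close> and \<eta> equal to it, each part is
    at most \<rho>\<open>/ 4\<close>.\<close>
  define C where "C = (\<bar>F1\<bar> / 2 + \<bar>F2\<bar>) * exp 1 + \<sigma>\<^sup>2 + 2 * exp 1 + 1"
  have C: "0 < C" unfolding C_def by (intro add_nonneg_pos add_nonneg_nonneg mult_nonneg_nonneg) auto
  define \<eta> where "\<eta> = \<rho> / (4 * C)"
  have \<eta>: "0 < \<eta>" unfolding \<eta>_def using C \<rho> by simp
  obtain \<delta> where \<delta>: "0 < \<delta>" "\<delta> < k / 2"
    and near: "\<And>e x. 0 < e \<Longrightarrow> e \<le> k / 2 \<Longrightarrow> \<bar>x\<bar> \<le> \<delta> \<Longrightarrow>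
     \<bar>(LINT z:{z. e < \<bar>z\<bar>}|N. payoff k (x + z)) - F0 - F1 * x - F2 / 2 * x\<^sup>2\<bar> \<le> \<eta> * x\<^sup>2"
    using big_jump_payoff_taylor[OF k \<eta>] unfolding F0_def F1_def F2_def by blast
  have m: "0 < min 1 (\<rho> / (4 * C))" using C \<rho> by simp
  obtain e1 where e1: "0 < e1" "e1 \<le> 1" and v: "\<And>e. 0 < e \<Longrightarrow> e \<le> e1 \<Longrightarrow> v e \<le> min 1 (\<rho> / (4 * C))"
    using small_variance_tendsto[OF m] unfolding v_def by blast
  show ?thesis
  proof (intro exI[of _ "min e1 (\<delta> / 6)"] conjI allI impI)
    show "0 < min e1 (\<delta> / 6)" using e1 \<delta> by simp
    fix e assume a: "0 < e \<and> e \<le> min e1 (\<delta> / 6)"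
    then have e: "0 < e" "e \<le> 1" "e \<le> \<delta> / 6" "e \<le> k / 2" and ve: "v e \<le> 1" "v e \<le> \<rho> / (4 * C)"
      using e1 \<delta> v[of e] by auto
    have v0: "0 \<le> v e" unfolding v_def set_lebesgue_integral_def by (intro integral_nonneg_AE) auto
    let ?L = "(\<bar>F1\<bar> / 2 + \<bar>F2\<bar>) * exp 1 * v e + \<eta> * (\<sigma>\<^sup>2 + 2 * exp 1 * v e)"
    have "(\<bar>F1\<bar> / 2 + \<bar>F2\<bar>) * exp 1 * v e \<le> C * (\<rho> / (4 * C))"
      using ve v0 C by (intro mult_mono) (auto simp: C_def)
    moreover have "\<eta> * (\<sigma>\<^sup>2 + 2 * exp 1 * v e) \<le> \<eta> * C"
    proof (intro mult_left_mono)
      have "2 * exp 1 * v e \<le> 2 * exp 1 * 1" using ve by (intro mult_left_mono) auto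
      moreover have "0 \<le> (\<bar>F1\<bar> / 2 + \<bar>F2\<bar>) * exp 1" by (intro mult_nonneg_nonneg) auto
      ultimately show "\<sigma>\<^sup>2 + 2 * exp 1 * v e \<le> C" unfolding C_def by linarith
    qed (use \<eta> in simp)
    moreover have "C * (\<rho> / (4 * C)) = \<rho> / 4" "\<eta> * C = \<rho> / 4" using C unfolding \<eta>_def by auto
    ultimately have L: "?L < \<rho>" using \<rho> by linarith
    note lim = remainder_limit[OF \<delta>(1), where ?F0.0=F0 and ?F1.0=F1 and ?F2.0=F2 and v="v e" and \<eta>=\<eta> and s="\<sigma>\<^sup>2"
        and l="rate e" and \<beta>="drift b e" and H="pairs k e" and e=e
        and K="rate e * ((LINT z:{z. e < \<bar>z\<bar>}|N. exp z) / rate e) + \<bar>F0\<bar> + \<bar>F1\<bar> + \<bar>F2\<bar>"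
        and a="(LINT z:{z. e < \<bar>z\<bar>}|N. exp z) / rate e"]
    from order_tendstoD(2)[OF lim L]
    show "\<forall>\<^sub>F t in at_right 0. \<bar>(LINT x|\<mu> t. payoff k x) - t * (tail1 k - exp k * utail k) - t\<^sup>2 * coef k b \<sigma> e\<bar> \<le> \<rho> * t\<^sup>2"
      using eventually_at_right_real[OF zero_less_one]
    proof eventually_elim
      case (elim t)
      then have t: "0 < t" "t < 1" by auto
      have t2: "0 < t\<^sup>2" using t by simp
      have le: "\<delta> \<le> k" "0 \<le> \<eta>" using \<delta> k \<eta> by auto
      note step = payoff_expansion_step[OF \<mu>(1)[OF t(1)] \<mu>(2)[OF t(1)] t k \<delta>(1) le e(1,2,3) near[OF e(1) e(4)], folded v_def]
      have "\<bar>(LINT x|\<mu> t. payoff k x) - t * F0 -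
          t\<^sup>2 * (- rate e * F0 + (F1 * drift b e + F2 / 2 * \<sigma>\<^sup>2) + pairs k e / 2)\<bar> \<le> \<rho> * t\<^sup>2"
        by (rule order_trans[OF step less_imp_le[OF iffD1[OF pos_divide_less_eq[OF t2] elim(1)]]])
      then show ?case unfolding coef_def F0_def F1_def F2_def .
    qed
  qed
qed

end

subsection \<open>The functional d2 in terms of the truncated Levy measure\<close>

lemma C1_onE:
  fixes f :: "real \<Rightarrow> real"
  assumes "f C1_differentiable_on S"
  obtains "\<And>x. x \<in> S \<Longrightarrow> (f has_real_derivative deriv f x) (at x)" "continuous_on S (deriv f)"
proof -
  obtain D where D: "\<And>x. x \<in> S \<Longrightarrow> (f has_vector_derivative D x) (at x)" "continuous_on S D"
    using assms unfolding C1_differentiable_on_def by auto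
  have d: "(f has_real_derivative D x) (at x)" if "x \<in> S" for x
    using D(1)[OF that] by (simp add: has_real_derivative_iff_has_vector_derivative)
  then have e: "deriv f x = D x" if "x \<in> S" for x using that by (intro DERIV_imp_deriv) auto
  show ?thesis
    by (rule that) (use d D(2) e in \<open>simp_all cong: continuous_on_cong\<close>)
qed

text \<open>Two applications of the mean value theorem, with \<open>g'\<close> bounded on the
  compact interval from \<open>y / 2\<close> to \<open>3 * y / 2\<close>. The quadratic bound makes
  the singular integral in \<open>d2\<close> converge at \<open>0\<close>.\<close>

lemma second_difference_bound:
  fixes F g g' :: "real \<Rightarrow> real"
  assumes y: "0 < y"
    and F: "\<And>x. 0 < x \<Longrightarrow> (F has_real_derivative - g x) (at x)"
    and g: "\<And>x. 0 < x \<Longrightarrow> (g has_real_derivative g' x) (at x)" and c: "continuous_on {0<..} g'"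
  shows "\<exists>M\<ge>0. \<forall>x. \<bar>x\<bar> \<le> y / 2 \<longrightarrow> \<bar>F (y - x) - F y - x * g y\<bar> \<le> M * x\<^sup>2"
proof -
  let ?I = "{y / 2..3 * y / 2}"
  have "compact (g' ` ?I)" using y by (intro compact_continuous_image continuous_on_subset[OF c]) auto
  from compact_imp_bounded[OF this] obtain M where "\<forall>z\<in>g' ` ?I. \<bar>z\<bar> \<le> M"
    unfolding bounded_real by blast
  then have M: "\<bar>g' x\<bar> \<le> M" if "x \<in> ?I" for x using that by blast
  have "\<bar>g' y\<bar> \<le> M" by (rule M) (use y in simp)
  then have M0: "0 \<le> M" by linarith
  have g1: "\<bar>g (y - x) - g y\<bar> \<le> M * \<bar>x\<bar>" if x: "\<bar>x\<bar> \<le> y / 2" for x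
  proof -
    have "norm (g (y - x) - g y) \<le> M * norm ((y - x) - y)"
    proof (rule field_differentiable_bound[of ?I g g'])
      show "(g has_real_derivative g' z) (at z within ?I)" if "z \<in> ?I" for z
        by (rule has_field_derivative_at_within[OF g]) (use that y in auto)
      show "norm (g' z) \<le> M" if "z \<in> ?I" for z using M[OF that] by simp
      show "y - x \<in> ?I" "y \<in> ?I" using x y by auto
    qed simp
    then show ?thesis by simp
  qed
  have "\<bar>F (y - x) - F y - x * g y\<bar> \<le> M * x\<^sup>2" if x: "\<bar>x\<bar> \<le> y / 2" for x
  proof -
    let ?h = "\<lambda>z. F (y - z) - z * g y"
    have "norm (?h x - ?h 0) \<le> (M * \<bar>x\<bar>) * norm (x - 0)"
    proof (rule field_differentiable_bound[of "{- \<bar>x\<bar>..\<bar>x\<bar>}" ?h "\<lambda>z. g (y - z) - g y"])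
      fix z assume z: "z \<in> {- \<bar>x\<bar>..\<bar>x\<bar>}"
      then have zy: "0 < y - z" "\<bar>z\<bar> \<le> y / 2" "\<bar>z\<bar> \<le> \<bar>x\<bar>" using x y by auto
      have "((\<lambda>z. y - z) has_real_derivative - 1) (at z)" by (auto intro!: derivative_eq_intros)
      from DERIV_chain2[OF F[OF zy(1)] this]
      have "((\<lambda>z. F (y - z)) has_real_derivative g (y - z)) (at z)" by simp
      then have "(?h has_real_derivative g (y - z) - g y) (at z)" by (auto intro!: derivative_eq_intros)
      then show "(?h has_real_derivative g (y - z) - g y) (at z within {- \<bar>x\<bar>..\<bar>x\<bar>})"
        by (rule has_field_derivative_at_within)
      have "M * \<bar>z\<bar> \<le> M * \<bar>x\<bar>" by (intro mult_left_mono zy M0)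
      with g1[OF zy(2)] show "norm (g (y - z) - g y) \<le> M * \<bar>x\<bar>" by simp
    qed auto
    then show ?thesis by (simp add: power2_eq_square mult.assoc abs_mult_self_eq)
  qed
  with M0 show ?thesis by blast
qed

section \<open>Upper tails, sums of two big jumps, and the singular integral\<close>

locale smooth_levy_density = levy_density +
  assumes C1: "\<nu> C1_differentiable_on (- {0})"
begin

lemma density_deriv: "x \<noteq> 0 \<Longrightarrow> (\<nu> has_real_derivative deriv \<nu> x) (at x)"
  and deriv_cont: "continuous_on (- {0}) (deriv \<nu>)"
  by (rule C1_onE[OF C1]; auto)+

lemma utail_mono:
  assumes "0 < a" "a \<le> b"
  shows "utail b \<le> utail a"
proof -
  have "emeasure N {a..} < \<infinity>" by (rule finite_away[of _ "a / 2"]) (use assms in auto)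
  then show ?thesis
    unfolding utail_def using assms by (intro measure_mono_fmeasurable) (auto simp: fmeasurable_def sets_N)
qed

lemma utail_nonneg: "0 \<le> utail y" by (simp add: utail_def)

lemma utail_measurable: "(\<lambda>x. indicator {0<..} x * utail x) \<in> borel_measurable borel"
proof -
  have "continuous_on {0<..} utail"
    by (rule DERIV_continuous_on[OF has_field_derivative_at_within[OF utail_derivative]]) simp
  then have "(\<lambda>x. indicator {0<..} x *\<^sub>R utail x) \<in> borel_measurable borel"
    by (intro borel_measurable_continuous_on_indicator) auto
  then show ?thesis by simp
qed

lemma AE_neq: "AE x in N. x \<noteq> c"
proof -
  have "AE x in lborel. x \<noteq> c" by (rule AE_lborel_singleton)
  then have "AE x in lborel. 0 < ennreal (\<nu> x) \<longrightarrow> x \<noteq> c" by eventually_elim simp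
  then show ?thesis unfolding N_eq by (subst AE_density) auto
qed

text \<open>The contribution of \<open>\<bar>x\<bar> \<le> e\<close> to the last integral of
  \<open>d2\<close>, after evaluating its inner oriented integral.\<close>

definition "remainder y e = (LINT x:{x. \<bar>x\<bar> \<le> e}|N. utail (y - x) - utail y - x * \<nu> y)"

text \<open>The mass that the product of the truncated measure with itself gives to \<open>{(z, w). y \<le> z + w}\<close>.\<close>

definition "sum_tail y e = (LINT z:{x. e < \<bar>x\<bar>}|N. measure N ({y - z..} \<inter> {x. e < \<bar>x\<bar>}))"

text \<open>Monotonicity serves as the source of measurability of the integrand in
  \<open>sum_tail\<close>.\<close>

lemma sum_tail_mono:
  assumes "0 < e"
  shows "mono (\<lambda>z. measure N ({y - z..} \<inter> {x. e < \<bar>x\<bar>}))"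
proof (rule monoI)
  fix z z' :: real assume z: "z \<le> z'"
  have "emeasure N ({y - z'..} \<inter> {x. e < \<bar>x\<bar>}) < \<infinity>" by (rule finite_away[OF _ assms]) auto
  then show "measure N ({y - z..} \<inter> {x. e < \<bar>x\<bar>}) \<le> measure N ({y - z'..} \<inter> {x. e < \<bar>x\<bar>})"
    using z by (intro measure_mono_fmeasurable) (auto simp: fmeasurable_def sets_N)
qed

lemma sum_tail_integrable:
  assumes e: "0 < e"
  shows "set_integrable N {x. e < \<bar>x\<bar>} (\<lambda>z. measure N ({y - z..} \<inter> {x. e < \<bar>x\<bar>}))"
proof (rule integrable_away[OF _ e, where c="measure N {x. e < \<bar>x\<bar>}"])
  show "(\<lambda>z. measure N ({y - z..} \<inter> {x. e < \<bar>x\<bar>})) \<in> borel_measurable borel"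
    by (intro borel_measurable_mono sum_tail_mono e)
  have "emeasure N {x. e < \<bar>x\<bar>} < \<infinity>" by (rule finite_away[OF _ e]) auto
  then show "\<bar>measure N ({y - z..} \<inter> {x. e < \<bar>x\<bar>})\<bar> \<le> measure N {x. e < \<bar>x\<bar>}" for z
    by (simp, intro measure_mono_fmeasurable) (auto simp: fmeasurable_def sets_N)
qed auto

text \<open>If two numbers add up to at least \<open>y\<close>, either both are at least
  \<open>y / 2\<close> or exactly one is smaller, and these two last cases are symmetric. Since
  \<open>e\<close> is below \<open>y / 2\<close>, the truncation does not affect the upper tails
  involved.\<close>

lemma sum_tail_eq:
  assumes e: "0 < e" "e < y / 2"
  shows "set_integrable N {x. e < \<bar>x\<bar> \<and> x < y / 2} (\<lambda>x. utail (y - x))"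
    "sum_tail y e = (utail (y / 2))\<^sup>2 + 2 * (LINT x:{x. e < \<bar>x\<bar> \<and> x < y / 2}|N. utail (y - x))"
proof -
  let ?B = "{x::real. e < \<bar>x\<bar>}" and ?L = "{x. e < \<bar>x\<bar> \<and> x < y / 2}"
  define K where "K = density N (indicator ?B)"
  have [measurable]: "?B \<in> sets borel" "?L \<in> sets borel" by measurable
  have sK [measurable_cong]: "sets K = sets borel" unfolding K_def by (simp add: sets_N)
  have K: "emeasure K A = emeasure N (?B \<inter> A)" if "A \<in> sets borel" for A
  proof -
    have "emeasure K A = (\<integral>\<^sup>+x. indicator ?B x * indicator A x \<partial>N)"
      unfolding K_def using that by (intro emeasure_density) (auto simp: sets_N)
    also have "\<dots> = (\<integral>\<^sup>+x. indicator (?B \<inter> A) x \<partial>N)"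
      by (intro nn_integral_cong) (auto simp: indicator_def)
    also have "\<dots> = emeasure N (?B \<inter> A)"
      using that by (intro nn_integral_indicator) (simp add: sets_N)
    finally show ?thesis .
  qed
  have fB: "emeasure N ?B < \<infinity>" by (rule finite_away[of _ e]) (use e in auto)
  have "emeasure K UNIV = emeasure N ?B" using K[of UNIV] by simp
  then interpret K: finite_measure K
    using fB sets_eq_imp_space_eq[OF sK] by (intro finite_measureI) auto
  interpret KK: pair_sigma_finite K K ..
  have Nm: "emeasure N A = ennreal (measure N A)" if "A \<in> sets borel" "A \<subseteq> ?B" for A
    using finite_away[OF that(1) e(1)] that(2) by (intro emeasure_eq_ennreal_measure) auto
  have up: "emeasure K {s..} = ennreal (utail s)" if "y / 2 \<le> s" for s
  proof -
    have "?B \<inter> {s..} = {s..}" using that e by auto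
    then show ?thesis using Nm[of "{s..}"] that e by (auto simp: K utail_def)
  qed
  \<comment> \<open>Measurability on the whole line is available for the cut-off tail only; on
    \<open>?L\<close>, where \<open>y - z\<close> exceeds \<open>y / 2\<close>, the cut-off changes
    nothing.\<close>
  let ?m = "\<lambda>z. indicator {0<..} (y - z) * utail (y - z)"
  have um: "?m \<in> borel_measurable borel"
    using measurable_compose[OF _ utail_measurable, of "\<lambda>z. y - z" borel] by simp
  have si: "set_integrable N ?L ?m"
  proof (rule integrable_away[where a=e and c="utail (y / 2)"])
    fix x assume "x \<in> ?L"
    then show "\<bar>?m x\<bar> \<le> utail (y / 2)"
      using e utail_mono[of "y / 2" "y - x"] utail_nonneg by (auto simp: indicator_def)
  qed (use e um in auto)
  have me: "indicator ?L x *\<^sub>R ?m x = indicator ?L x *\<^sub>R utail (y - x)" for x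
    using e by (auto simp: indicator_def)
  show i: "set_integrable N ?L (\<lambda>x. utail (y - x))"
    using si unfolding set_integrable_def me .
  let ?I = "LINT x:?L|N. utail (y - x)"
  have I0: "0 \<le> ?I" unfolding set_lebesgue_integral_def by (intro integral_nonneg_AE) (auto simp: utail_nonneg)
  have nI: "(\<integral>\<^sup>+z. ennreal (indicator {..<y / 2} z * ?m z) \<partial>K) = ennreal ?I"
  proof -
    have "(\<integral>\<^sup>+z. ennreal (indicator {..<y / 2} z * ?m z) \<partial>K) =
        (\<integral>\<^sup>+z. indicator ?B z * ennreal (indicator {..<y / 2} z * ?m z) \<partial>N)"
      unfolding K_def using um by (intro nn_integral_density) auto
    also have "\<dots> = (\<integral>\<^sup>+z. ennreal (indicator ?L z *\<^sub>R utail (y - z)) \<partial>N)"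
      using e by (intro nn_integral_cong) (auto simp: indicator_def)
    also have "\<dots> = ennreal ?I"
      using i unfolding set_lebesgue_integral_def set_integrable_def
      by (intro nn_integral_eq_integral) (auto simp: utail_nonneg)
    finally show ?thesis .
  qed
  have "mono (\<lambda>z. measure N ({y - z..} \<inter> ?B))" by (rule sum_tail_mono[OF e(1)])
  then have mm: "(\<lambda>z. measure N ({y - z..} \<inter> ?B)) \<in> borel_measurable N"
    using borel_measurable_mono measurable_cong_sets[OF sets_N refl] by blast
  define S where "S = {p :: real \<times> real. y \<le> fst p + snd p}"
  define A1 where "A1 = {y / 2..} \<times> {y / 2..}"
  define A2 where "A2 = {p :: real \<times> real. fst p < y / 2 \<and> y \<le> fst p + snd p}"
  define A3 where "A3 = {p :: real \<times> real. snd p < y / 2 \<and> y \<le> fst p + snd p}"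
  have meas: "A1 \<in> sets (K \<Otimes>\<^sub>M K)" "A2 \<in> sets (K \<Otimes>\<^sub>M K)" "A3 \<in> sets (K \<Otimes>\<^sub>M K)" "S \<in> sets (K \<Otimes>\<^sub>M K)"
  proof -
    have b: "sets (K \<Otimes>\<^sub>M K) = sets (borel :: (real \<times> real) measure)"
      unfolding borel_prod[symmetric] by (rule sets_pair_measure_cong) (simp_all add: sK)
    show "A1 \<in> sets (K \<Otimes>\<^sub>M K)" unfolding A1_def by (intro pair_measureI) (simp_all add: sK)
    have S: "S \<in> sets borel"
      unfolding S_def by (intro borel_closed closed_Collect_le continuous_intros)
    have "{p :: real \<times> real. fst p < y / 2} \<in> sets borel" "{p :: real \<times> real. snd p < y / 2} \<in> sets borel"
      by (intro borel_open open_Collect_less continuous_intros)+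
    moreover have "A2 = {p. fst p < y / 2} \<inter> S" "A3 = {p. snd p < y / 2} \<inter> S"
      by (auto simp: A2_def A3_def S_def)
    ultimately show "A2 \<in> sets (K \<Otimes>\<^sub>M K)" "A3 \<in> sets (K \<Otimes>\<^sub>M K)" "S \<in> sets (K \<Otimes>\<^sub>M K)"
      unfolding b using S by auto
  qed
  have "emeasure (K \<Otimes>\<^sub>M K) S = (\<integral>\<^sup>+z. emeasure K (Pair z -` S) \<partial>K)"
    by (rule K.emeasure_pair_measure_alt[OF meas(4)])
  also have "\<dots> = (\<integral>\<^sup>+z. ennreal (measure N ({y - z..} \<inter> ?B)) \<partial>K)"
  proof (intro nn_integral_cong)
    fix z
    have "Pair z -` S = {y - z..}" by (auto simp: S_def)
    then show "emeasure K (Pair z -` S) = ennreal (measure N ({y - z..} \<inter> ?B))"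
      using Nm[of "{y - z..} \<inter> ?B"] by (simp add: K Int_commute)
  qed
  also have "\<dots> = (\<integral>\<^sup>+z. indicator ?B z * ennreal (measure N ({y - z..} \<inter> ?B)) \<partial>N)"
    unfolding K_def by (rule nn_integral_density) (use mm in \<open>simp_all add: measurable_cong_sets[OF sets_N refl]\<close>)
  also have "\<dots> = (\<integral>\<^sup>+z. ennreal (indicator ?B z *\<^sub>R measure N ({y - z..} \<inter> ?B)) \<partial>N)"
    by (intro nn_integral_cong) (auto simp: indicator_def)
  finally have ES: "emeasure (K \<Otimes>\<^sub>M K) S = (\<integral>\<^sup>+z. ennreal (indicator ?B z *\<^sub>R measure N ({y - z..} \<inter> ?B)) \<partial>N)" .
  have "S = A1 \<union> (A2 \<union> A3)" unfolding S_def A1_def A2_def A3_def using e by (auto simp: field_simps)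
  moreover have "A1 \<inter> (A2 \<union> A3) = {}" "A2 \<inter> A3 = {}" unfolding A1_def A2_def A3_def by auto
  ultimately have "emeasure (K \<Otimes>\<^sub>M K) S = emeasure (K \<Otimes>\<^sub>M K) A1 + (emeasure (K \<Otimes>\<^sub>M K) A2 + emeasure (K \<Otimes>\<^sub>M K) A3)"
    using meas by (simp add: plus_emeasure[symmetric])
  also have "emeasure (K \<Otimes>\<^sub>M K) A1 = ennreal ((utail (y / 2))\<^sup>2)"
    unfolding A1_def by (subst K.emeasure_pair_measure_Times) (simp_all add: sK up ennreal_mult[symmetric] utail_nonneg power2_eq_square)
  also have "emeasure (K \<Otimes>\<^sub>M K) A2 = ennreal ?I"
  proof -
    have "emeasure (K \<Otimes>\<^sub>M K) A2 = (\<integral>\<^sup>+z. emeasure K (Pair z -` A2) \<partial>K)"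
      by (rule K.emeasure_pair_measure_alt[OF meas(2)])
    also have "\<dots> = (\<integral>\<^sup>+z. ennreal (indicator {..<y / 2} z * ?m z) \<partial>K)"
    proof (intro nn_integral_cong)
      fix z
      have "Pair z -` A2 = (if z < y / 2 then {y - z..} else {})" by (auto simp: A2_def)
      then show "emeasure K (Pair z -` A2) = ennreal (indicator {..<y / 2} z * ?m z)"
        using up[of "y - z"] e by (auto simp: indicator_def)
    qed
    finally show ?thesis unfolding nI .
  qed
  also have "emeasure (K \<Otimes>\<^sub>M K) A3 = ennreal ?I"
  proof -
    have "emeasure (K \<Otimes>\<^sub>M K) A3 = (\<integral>\<^sup>+z. emeasure K ((\<lambda>x. (x, z)) -` A3) \<partial>K)"
      by (rule KK.emeasure_pair_measure_alt2[OF meas(3)])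
    also have "\<dots> = (\<integral>\<^sup>+z. ennreal (indicator {..<y / 2} z * ?m z) \<partial>K)"
    proof (intro nn_integral_cong)
      fix z
      have "(\<lambda>x. (x, z)) -` A3 = (if z < y / 2 then {y - z..} else {})" by (auto simp: A3_def)
      then show "emeasure K ((\<lambda>x. (x, z)) -` A3) = ennreal (indicator {..<y / 2} z * ?m z)"
        using up[of "y - z"] e by (auto simp: indicator_def)
    qed
    finally show ?thesis unfolding nI .
  qed
  also have "ennreal ((utail (y / 2))\<^sup>2) + (ennreal ?I + ennreal ?I) = ennreal ((utail (y / 2))\<^sup>2 + 2 * ?I)"
    using I0 by (simp add: ennreal_plus[symmetric] del: ennreal_plus)
  finally have fin: "(\<integral>\<^sup>+z. ennreal (indicator ?B z *\<^sub>R measure N ({y - z..} \<inter> ?B)) \<partial>N) = ennreal ((utail (y / 2))\<^sup>2 + 2 * ?I)"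
    unfolding ES .
  show "sum_tail y e = (utail (y / 2))\<^sup>2 + 2 * ?I"
  proof -
    have "sum_tail y e = enn2real (\<integral>\<^sup>+z. ennreal (indicator ?B z *\<^sub>R measure N ({y - z..} \<inter> ?B)) \<partial>N)"
      unfolding sum_tail_def set_lebesgue_integral_def using mm by (intro integral_eq_nn_integral) auto
    then show ?thesis unfolding fin using I0 by (simp only: enn2real_ennreal add_nonneg_nonneg mult_nonneg_nonneg zero_le_power2 zero_le_numeral)
  qed
qed

end

context smooth_levy_density
begin

text \<open>One antiderivative handles both inner integrals of \<open>d2\<close>:
  \<open>d = 0\<close> for the far negative range and \<open>d = \<nu> y\<close> for the compensated
  one. The oriented integral takes care of the sign of \<open>x\<close>.\<close>

lemma oriented_density_integral:
  assumes "0 < y" "0 < y - x"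
  shows "(LBINT u=y - x..y. (\<nu> u - d) * c) = (utail (y - x) - utail y - x * d) * c"
proof -
  have m: "0 < min (y - x) y" using assms by simp
  have "(LBINT u=y - x..y. (\<nu> u - d) * c) = (- utail y - y * d) * c - (- utail (y - x) - (y - x) * d) * c"
  proof (rule interval_integral_FTC_finite[where F="\<lambda>u. (- utail u - u * d) * c"])
    show "continuous_on {min (y - x) y..max (y - x) y} (\<lambda>u. (\<nu> u - d) * c)"
      using m by (intro continuous_intros continuous_on_subset[OF cont]) auto
    fix u assume "min (y - x) y \<le> u"
    then have "0 < u" using m by linarith
    then have "((\<lambda>u. (- utail u - u * d) * c) has_real_derivative (\<nu> u - d) * c) (at u)"
      by (auto intro!: derivative_eq_intros utail_derivative)
    then show "((\<lambda>u. (- utail u - u * d) * c) has_vector_derivative (\<nu> u - d) * c)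
        (at u within {min (y - x) y..max (y - x) y})"
      unfolding has_real_derivative_iff_has_vector_derivative by (rule has_vector_derivative_at_within)
  qed
  then show ?thesis by (simp add: algebra_simps)
qed

text \<open>\<open>M\<close> depends on \<open>y\<close> alone, so the remainder vanishes with the
  small-jump variance.\<close>

lemma remainder_integrable_bound:
  assumes y: "0 < y"
  shows "\<exists>M\<ge>0. \<forall>e. 0 < e \<and> e \<le> 1 \<and> e \<le> y / 2 \<longrightarrow>
     set_integrable N {x. \<bar>x\<bar> \<le> e} (\<lambda>x. utail (y - x) - utail y - x * \<nu> y) \<and>
     \<bar>remainder y e\<bar> \<le> M * (LINT x:{x. \<bar>x\<bar> \<le> e}|N. x\<^sup>2)"
proof -
  have d: "(\<nu> has_real_derivative deriv \<nu> x) (at x)" if "0 < x" for x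
    using that by (intro density_deriv) auto
  have c: "continuous_on {0<..} (deriv \<nu>)" by (rule continuous_on_subset[OF deriv_cont]) auto
  obtain M where M: "0 \<le> M" "\<And>x. \<bar>x\<bar> \<le> y / 2 \<Longrightarrow> \<bar>utail (y - x) - utail y - x * \<nu> y\<bar> \<le> M * x\<^sup>2"
    using second_difference_bound[OF y utail_derivative d c] by blast
  show ?thesis
  proof (intro exI[of _ M] conjI allI impI M(1))
    fix e assume a: "0 < e \<and> e \<le> 1 \<and> e \<le> y / 2"
    let ?E = "{x. \<bar>x\<bar> \<le> e}" and ?f = "\<lambda>x. utail (y - x) - utail y - x * \<nu> y"
    have cont_f: "continuous_on ?E ?f"
    proof (intro continuous_intros)
      have "continuous_on {0<..} utail"
        by (rule DERIV_continuous_on[OF has_field_derivative_at_within[OF utail_derivative]]) simp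
      then show "continuous_on ?E (\<lambda>x. utail (y - x))"
        by (rule continuous_on_compose2) (use a y in \<open>auto intro!: continuous_intros\<close>)
    qed
    have "?E \<in> sets borel" by measurable
    then have "(\<lambda>x. indicator ?E x *\<^sub>R ?f x) \<in> borel_measurable borel"
      by (rule borel_measurable_continuous_on_indicator[OF _ cont_f])
    then have m: "set_borel_measurable N ?E ?f"
      using measurable_cong_sets[OF sets_N refl] by (simp add: set_borel_measurable_def)
    have b: "\<bar>?f x\<bar> \<le> M * x\<^sup>2" if "\<bar>x\<bar> \<le> e" for x using M(2)[of x] a that by simp
    have e1: "e \<le> 1" using a by simp
    show "set_integrable N ?E ?f" by (rule small_jump_integral(1)[OF e1 m b])
    show "\<bar>remainder y e\<bar> \<le> M * (LINT x:?E|N. x\<^sup>2)"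
      unfolding remainder_def by (rule small_jump_integral(2)[OF e1 m b])
  qed
qed

lemma set_integral_null_boundary:
  fixes f :: "real \<Rightarrow> real"
  assumes "f \<in> borel_measurable borel" "A \<in> sets borel" "B \<in> sets borel" "\<And>x. x \<noteq> c \<Longrightarrow> x \<noteq> d \<Longrightarrow> x \<in> A \<longleftrightarrow> x \<in> B"
  shows "(LINT x:A|N. f x) = (LINT x:B|N. f x)"
proof (rule set_integral_cong_set)
  show "AE x in N. x \<in> B \<longleftrightarrow> x \<in> A"
    using AE_neq[of c] AE_neq[of d] by eventually_elim (use assms(4) in auto)
qed (use assms(1-3) in \<open>auto simp: set_borel_measurable_def measurable_cong_sets[OF sets_N refl]\<close>)

text \<open>With all integrals expressed by \<open>utail\<close>, the difference of the two squared
  masses in \<open>d2\<close> is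
  \<open>(utail (y / 2))\<^sup>2 - 2 * utail (y / 2) * utail y\<close>. The square completes the
  integrals over \<open>L\<close> to \<open>sum_tail\<close>; the mixed term joins
  \<open>utail y * measure N L\<close> to form the full jump rate.\<close>

lemma d2_eq:
  assumes y: "0 < y" and e: "0 < e" "e \<le> 1" "e < y / 2"
  shows "d2 y b \<sigma> \<nu> = - \<sigma>\<^sup>2 * deriv \<nu> y + 2 * (b - (LINT x:{x. e < \<bar>x\<bar> \<and> \<bar>x\<bar> \<le> 1}|N. x)) * \<nu> y
     + sum_tail y e - 2 * measure N {x. e < \<bar>x\<bar>} * utail y + 2 * remainder y e"
proof -
  \<comment> \<open>The indicator excludes arguments at which \<open>utail\<close> is a default
    value and makes \<open>g\<close> measurable; for \<open>x < y\<close> it has no effect.\<close>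
  define g where "g x = indicator {0<..} (y - x) * utail (y - x) - utail y" for x
  define E1 where "E1 = {..- y / 2}"
  define E2 where "E2 = {x. e < \<bar>x\<bar> \<and> \<bar>x\<bar> < y / 2}"
  define S where "S = {x::real. \<bar>x\<bar> \<le> e}"
  define L where "L = {x. e < \<bar>x\<bar> \<and> x < y / 2}"
  define X where "X = (LINT x:{x. e < \<bar>x\<bar> \<and> \<bar>x\<bar> \<le> 1}|N. x)"
  have sets [measurable]: "E1 \<in> sets borel" "E2 \<in> sets borel" "S \<in> sets borel" "L \<in> sets borel"
    unfolding E1_def E2_def S_def L_def by measurable
  have gm [measurable]: "g \<in> borel_measurable borel"
    unfolding g_def using measurable_compose[OF _ utail_measurable, of "\<lambda>z. y - z" borel]
    by (intro borel_measurable_diff) auto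
  have g: "g x = utail (y - x) - utail y" if "x < y" for x using that by (simp add: g_def)
  have gb: "\<bar>g x\<bar> \<le> utail (y / 2)" if "x \<le> y / 2" for x
    using that y g[of x] utail_mono[of "y / 2" "y - x"] utail_mono[of "y / 2" y] utail_nonneg[of "y - x"] utail_nonneg[of y]
    by auto
  have sub: "E1 \<subseteq> {x. e < \<bar>x\<bar>}" "E2 \<subseteq> {x. e < \<bar>x\<bar>}" "L \<subseteq> {x. e < \<bar>x\<bar>}"
    unfolding E1_def E2_def L_def using e by auto
  have gi: "set_integrable N E1 g" "set_integrable N E2 g" "set_integrable N L g"
    by (rule integrable_away[OF _ e(1) _ gm, where c="utail (y / 2)"]; use sub e y gb in \<open>auto simp: E1_def E2_def L_def\<close>)+
  have Xi: "set_integrable N E2 (\<lambda>x. x)"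
    by (rule integrable_away[OF _ e(1) sub(2), where c="y / 2"]) (auto simp: E2_def)
  have M: "set_integrable N S (\<lambda>x. utail (y - x) - utail y - x * \<nu> y)"
    using remainder_integrable_bound[OF y] e unfolding S_def by auto
  have T0: "measure (density lborel \<nu>) {y..} = utail y" by (simp add: utail_def N_eq[symmetric])
  have T1: "measure (density lborel \<nu>) {y / 2<..<y} = utail (y / 2) - utail y"
  proof -
    have m: "(LINT x:{y / 2..}|N. 1) = measure N {y / 2..}" "(LINT x:{y..}|N. 1) = measure N {y..}"
      "(LINT x:{y / 2<..<y}|N. 1) = measure N {y / 2<..<y}"
      by (rule measure_away[of _ "y / 4"]; use y in auto)+
    have "(LINT x:{y / 2..}|N. 1) = (LINT x:{y / 2..<y} \<union> {y..}|N. 1 :: real)"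
      using y by (intro arg_cong[where f="\<lambda>A. LINT x:A|N. 1"]) auto
    also have "\<dots> = (LINT x:{y / 2..<y}|N. 1) + (LINT x:{y..}|N. 1)"
      by (rule set_integral_Un) (use y in \<open>auto intro!: integrable_away[where a="y / 4" and c=1]\<close>)
    also have "(LINT x:{y / 2..<y}|N. 1 :: real) = (LINT x:{y / 2<..<y}|N. 1)"
      by (rule set_integral_null_boundary[where c="y / 2" and d="y / 2"]) auto
    finally have "measure N {y / 2..} = measure N {y / 2<..<y} + measure N {y..}"
      unfolding m by simp
    then show ?thesis by (simp add: utail_def N_eq[symmetric])
  qed
  have I1: "(LBINT x=-\<infinity>..- y / 2. (LBINT u=y - x..y. \<nu> u * \<nu> x)) = (LINT x:E1|N. g x)"
  proof -
    have "(LBINT x=-\<infinity>..- y / 2. (LBINT u=y - x..y. \<nu> u * \<nu> x)) = (LBINT x:{..<- y / 2}. (LBINT u=y - x..y. \<nu> u * \<nu> x))"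
      by (subst interval_lebesgue_integral_le_eq) auto
    also have "\<dots> = (LBINT x:{..<- y / 2}. g x * \<nu> x)"
    proof (intro set_lebesgue_integral_cong allI impI)
      fix x assume "x \<in> {..<- y / 2}"
      then have "x < y" "0 < y - x" using y by auto
      then show "(LBINT u=y - x..y. \<nu> u * \<nu> x) = g x * \<nu> x"
        using oriented_density_integral[OF y, of x 0 "\<nu> x"] g[of x] by simp
    qed simp
    also have "\<dots> = (LINT x:{..<- y / 2}|N. g x)" by (rule set_integral_N[symmetric]) auto
    also have "\<dots> = (LINT x:E1|N. g x)"
      by (rule set_integral_null_boundary[where c="- y / 2" and d="- y / 2"]) (auto simp: E1_def)
    finally show ?thesis .
  qed
  have I2: "(LBINT x=- y / 2..y / 2. (LBINT u=y - x..y. (\<nu> u - \<nu> y) * \<nu> x)) =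
     remainder y e + ((LINT x:E2|N. g x) - (LINT x:E2|N. x) * \<nu> y)"
  proof -
    let ?h = "\<lambda>x. g x - x * \<nu> y"
    have "(LBINT x=- y / 2..y / 2. (LBINT u=y - x..y. (\<nu> u - \<nu> y) * \<nu> x)) =
        (LBINT x:{- y / 2<..<y / 2}. (LBINT u=y - x..y. (\<nu> u - \<nu> y) * \<nu> x))"
      using y by (subst interval_lebesgue_integral_le_eq) auto
    also have "\<dots> = (LBINT x:{- y / 2<..<y / 2}. ?h x * \<nu> x)"
    proof (intro set_lebesgue_integral_cong allI impI)
      fix x assume "x \<in> {- y / 2<..<y / 2}"
      then have "x < y" "0 < y - x" using y by auto
      then show "(LBINT u=y - x..y. (\<nu> u - \<nu> y) * \<nu> x) = ?h x * \<nu> x"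
        using oriented_density_integral[OF y, of x "\<nu> y" "\<nu> x"] g[of x] by simp
    qed simp
    also have "\<dots> = (LINT x:{- y / 2<..<y / 2}|N. ?h x)" by (rule set_integral_N[symmetric]) auto
    also have "{- y / 2<..<y / 2} = S \<union> E2" unfolding S_def E2_def using e by auto
    also have "(LINT x:S \<union> E2|N. ?h x) = (LINT x:S|N. ?h x) + (LINT x:E2|N. ?h x)"
    proof (rule set_integral_Un)
      show "S \<inter> E2 = {}" by (auto simp: S_def E2_def)
      have h: "indicator S x *\<^sub>R ?h x = indicator S x *\<^sub>R (utail (y - x) - utail y - x * \<nu> y)" for x
        using g[of x] e by (auto simp: indicator_def S_def)
      show "set_integrable N S ?h" using M unfolding set_integrable_def h .
      show "set_integrable N E2 ?h" using gi(2) Xi by (intro set_integral_diff) auto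
    qed
    also have "(LINT x:S|N. ?h x) = remainder y e"
      unfolding remainder_def S_def[symmetric]
      by (intro set_lebesgue_integral_cong allI impI) (use e g in \<open>auto simp: S_def sets_N\<close>)
    also have "(LINT x:E2|N. ?h x) = (LINT x:E2|N. g x) - (LINT x:E2|N. x) * \<nu> y"
      using gi(2) Xi by (subst set_integral_diff(2)) auto
    finally show ?thesis .
  qed
  \<comment> \<open>The last integral of \<open>d2\<close> compensates jumps up to
    \<open>y / 2\<close>, the triplet those up to \<open>1\<close>. \<open>d2_drift\<close> is the
    signed difference, with the sign depending on which cut-off is larger.\<close>
  have drift: "(LINT x:E2|N. x) + d2_drift \<nu> y = X"
  proof (cases "y \<le> 2")
    case True
    let ?D = "{x. y / 2 < \<bar>x\<bar> \<and> \<bar>x\<bar> \<le> 1}"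
    have "X = (LINT x:E2 \<union> ?D|N. x)"
      unfolding X_def by (rule set_integral_null_boundary[where c="y / 2" and d="- y / 2"])
        (use e True in \<open>auto simp: E2_def abs_if split: if_splits\<close>)
    also have "\<dots> = (LINT x:E2|N. x) + (LINT x:?D|N. x)"
    proof (rule set_integral_Un[OF _ Xi])
      show "set_integrable N ?D (\<lambda>x. x)"
        by (rule integrable_away[of _ "y / 2" _ 1]) (use y in auto)
    qed (auto simp: E2_def)
    also have "(LINT x:?D|N. x) = d2_drift \<nu> y" using True by (simp add: d2_drift_def set_integral_N)
    finally show ?thesis by simp
  next
    case False
    let ?D = "{x. 1 < \<bar>x\<bar> \<and> \<bar>x\<bar> \<le> y / 2}" and ?X = "{x. e < \<bar>x\<bar> \<and> \<bar>x\<bar> \<le> 1}"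
    have "(LINT x:E2|N. x) = (LINT x:?X \<union> ?D|N. x)"
      by (rule set_integral_null_boundary[where c="y / 2" and d="- y / 2"])
        (use e False in \<open>auto simp: E2_def abs_if split: if_splits\<close>)
    also have "\<dots> = X + (LINT x:?D|N. x)"
      unfolding X_def
    proof (rule set_integral_Un)
      show "set_integrable N ?D (\<lambda>x. x)"
        by (rule integrable_away[of _ 1 _ "y / 2"]) auto
      show "set_integrable N ?X (\<lambda>x. x)"
        by (rule integrable_away[of _ e _ 1]) (use e in auto)
    qed auto
    also have "(LINT x:?D|N. x) = - d2_drift \<nu> y" using False by (simp add: d2_drift_def set_integral_N)
    finally show ?thesis by simp
  qed
  have rate: "measure N {x. e < \<bar>x\<bar>} = measure N L + utail (y / 2)"
  proof -
    have "{x. e < \<bar>x\<bar>} = L \<union> {y / 2..}" unfolding L_def using e by auto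
    then have "(LINT x:{x. e < \<bar>x\<bar>}|N. 1) = (LINT x:L \<union> {y / 2..}|N. 1 :: real)" by simp
    also have "\<dots> = (LINT x:L|N. 1) + (LINT x:{y / 2..}|N. 1)"
    proof (rule set_integral_Un)
      show "set_integrable N L (\<lambda>x. 1 :: real)" by (rule integrable_away[OF _ e(1) sub(3), of _ 1]) auto
      show "set_integrable N {y / 2..} (\<lambda>x. 1 :: real)" by (rule integrable_away[of _ e _ 1]) (use e in auto)
    qed (auto simp: L_def)
    moreover have "(LINT x:{x. e < \<bar>x\<bar>}|N. 1) = measure N {x. e < \<bar>x\<bar>}" "(LINT x:L|N. 1) = measure N L"
      "(LINT x:{y / 2..}|N. 1) = measure N {y / 2..}"
      by (rule measure_away[of _ e]; use e sub(3) in auto)+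
    ultimately show ?thesis by (simp add: utail_def)
  qed
  have IL: "(LINT x:L|N. utail (y - x)) = (LINT x:E1|N. g x) + (LINT x:E2|N. g x) + utail y * measure N L"
  proof -
    have "(LINT x:L|N. g x) = (LINT x:L|N. utail (y - x) - utail y)"
      by (intro set_lebesgue_integral_cong allI impI) (use y g in \<open>auto simp: L_def sets_N\<close>)
    also have "\<dots> = (LINT x:L|N. utail (y - x)) - (LINT x:L|N. utail y * 1)"
      using sum_tail_eq(1)[OF e(1,3)] unfolding L_def[symmetric]
      by (subst set_integral_diff(2)) (auto intro!: integrable_away[OF _ e(1) sub(3), of _ "\<bar>utail y\<bar>"])
    also have "(LINT x:L|N. utail y * 1) = utail y * measure N L"
      using measure_away[OF _ e(1) sub(3)] by (subst set_integral_mult_right) auto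
    finally have 1: "(LINT x:L|N. g x) = (LINT x:L|N. utail (y - x)) - utail y * measure N L" .
    have "L = E1 \<union> E2" unfolding L_def E1_def E2_def using e by auto
    then have "(LINT x:L|N. g x) = (LINT x:E1 \<union> E2|N. g x)" by simp
    also have "\<dots> = (LINT x:E1|N. g x) + (LINT x:E2|N. g x)"
      by (rule set_integral_Un[OF _ gi(1,2)]) (use e in \<open>auto simp: E1_def E2_def\<close>)
    finally show ?thesis using 1 by simp
  qed
  have W: "sum_tail y e = (utail (y / 2))\<^sup>2 + 2 * ((LINT x:E1|N. g x) + (LINT x:E2|N. g x) + utail y * measure N L)"
    using sum_tail_eq(2)[OF e(1,3)] IL unfolding L_def[symmetric] by simp
  have X2: "(LINT x:E2|N. x) = X - d2_drift \<nu> y" using drift by simp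
  show ?thesis
    unfolding d2_def T0 T1 I1 I2 W rate X_def[symmetric] X2
    by (simp add: algebra_simps power2_eq_square)
qed

end

subsection \<open>The share measure and the proof of the proposition\<close>

locale exp_smooth_levy_density = exp_levy_density + smooth_levy_density
begin

definition "N_star = density lborel (\<lambda>x. ennreal (nu_star \<nu> x))"

lemma nu_star_deriv:
  assumes "x \<noteq> 0"
  shows "(nu_star \<nu> has_real_derivative exp x * \<nu> x + exp x * deriv \<nu> x) (at x)"
  unfolding nu_star_def[abs_def] using density_deriv[OF assms] by (auto intro!: derivative_eq_intros)

lemma N_star_density: "N_star = density N (\<lambda>x. ennreal (exp x))"
proof -
  have "density N (\<lambda>x. ennreal (exp x)) = density lborel (\<lambda>x. ennreal (\<nu> x) * ennreal (exp x))"
    unfolding N_eq by (subst density_density_eq) auto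
  also have "\<dots> = N_star"
    unfolding N_star_def nu_star_def
  proof (rule density_cong)
    show "AE x in lborel. ennreal (\<nu> x) * ennreal (exp x) = ennreal (exp x * \<nu> x)"
      using AE_density_nonneg by eventually_elim (simp add: ennreal_mult mult.commute)
  qed auto
  finally show ?thesis ..
qed

text \<open>On the unit interval around \<open>0\<close> tilting costs at most a factor
  \<open>exp 1\<close>; outside, integrability is the assumption \<open>exp_tail\<close>.\<close>

lemma levy_N_star: "levy_measure N_star"
  unfolding levy_measure_def
proof (intro conjI)
  show "sets N_star = sets borel" by (simp add: N_star_density sets_N)
  have "emeasure N {0} = 0" using levy by (simp add: levy_measure_def)
  then have "AE x in N. x \<noteq> 0" by (subst AE_iff_measurable[of "{0}"]) (auto simp: sets_N levy_measure_space[OF levy])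
  then show "emeasure N_star {0} = 0"
    unfolding N_star_density by (subst emeasure_density) (auto simp: nn_integral_0_iff_AE sets_N indicator_def)
  have i: "integrable N (\<lambda>x. exp 1 * min 1 (x\<^sup>2) + indicator {x. 1 < \<bar>x\<bar>} x *\<^sub>R exp x)"
    using exp_tail levy_measure_integrable_min[OF levy] unfolding set_integrable_def
    by (intro Bochner_Integration.integrable_add integrable_mult_right)
  have "(\<integral>\<^sup>+x. ennreal (min 1 (x\<^sup>2)) \<partial>N_star) = (\<integral>\<^sup>+x. ennreal (exp x) * ennreal (min 1 (x\<^sup>2)) \<partial>N)"
    unfolding N_star_density by (rule nn_integral_density) auto
  also have "\<dots> \<le> (\<integral>\<^sup>+x. ennreal (exp 1 * min 1 (x\<^sup>2) + indicator {x. 1 < \<bar>x\<bar>} x *\<^sub>R exp x) \<partial>N)"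
  proof (intro nn_integral_mono)
    fix x :: real
    have "exp x * min 1 (x\<^sup>2) \<le> exp 1 * min 1 (x\<^sup>2) + indicator {x. 1 < \<bar>x\<bar>} x *\<^sub>R exp x"
    proof (cases "1 < \<bar>x\<bar>")
      case True
      have "exp x * min 1 (x\<^sup>2) \<le> exp x * 1" by (intro mult_left_mono) auto
      with True show ?thesis by (simp add: add_increasing)
    next
      case False
      then have "exp x \<le> exp 1" by simp
      with False show ?thesis by (simp add: mult_right_mono)
    qed
    then show "ennreal (exp x) * ennreal (min 1 (x\<^sup>2)) \<le> ennreal (exp 1 * min 1 (x\<^sup>2) + indicator {x. 1 < \<bar>x\<bar>} x *\<^sub>R exp x)"
      by (simp add: ennreal_mult[symmetric] ennreal_leI del: ennreal_plus)
  qed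
  also have "\<dots> < \<infinity>" using i by (subst nn_integral_eq_integral) auto
  finally show "(\<integral>\<^sup>+x. ennreal (min 1 (x\<^sup>2)) \<partial>N_star) < \<infinity>" .
qed

text \<open>Makes \<open>d2_eq\<close> and the remainder bound available for the starred data
  without a second proof.\<close>

sublocale star: smooth_levy_density N_star "nu_star \<nu>"
proof
  show "levy_measure N_star" by (rule levy_N_star)
  show "N_star = density lborel (\<lambda>x. ennreal (nu_star \<nu> x))" by (rule N_star_def)
  show "0 < nu_star \<nu> x" if "x \<noteq> 0" for x using pos[OF that] by (simp add: nu_star_def)
  show "continuous_on (- {0}) (nu_star \<nu>)" unfolding nu_star_def by (intro continuous_intros cont)
  have "(nu_star \<nu> has_vector_derivative exp x * \<nu> x + exp x * deriv \<nu> x) (at x)" if "x \<in> - {0}" for x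
    using nu_star_deriv[of x] that by (simp add: has_real_derivative_iff_has_vector_derivative)
  moreover have "continuous_on (- {0}) (\<lambda>x. exp x * \<nu> x + exp x * deriv \<nu> x)"
    by (intro continuous_intros cont deriv_cont)
  ultimately show "nu_star \<nu> C1_differentiable_on - {0}"
    unfolding C1_differentiable_on_def
    by (intro exI[of _ "\<lambda>x. exp x * \<nu> x + exp x * deriv \<nu> x"]) auto
qed

lemma star_integral:
  fixes f :: "real \<Rightarrow> real"
  assumes "f \<in> borel_measurable borel" "A \<in> sets borel"
  shows "(LINT x:A|N_star. f x) = (LINT x:A|N. exp x * f x)"
    "set_integrable N_star A f \<longleftrightarrow> set_integrable N A (\<lambda>x. exp x * f x)"
  using assms by (simp_all add: set_integral_N star.set_integral_N set_integrable_N star.set_integrable_N nu_star_def mult_ac)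

lemma star_measure:
  assumes "A \<in> sets borel" "0 < a" "A \<subseteq> {x. a < \<bar>x\<bar>}"
  shows "measure N_star A = (LINT x:A|N. exp x)"
  using star.measure_away[OF assms] star_integral(1)[of "\<lambda>x. 1" A] assms by simp

lemma tail1_eq:
  assumes "0 < k"
  shows "tail1 k = star.utail k"
  unfolding tail1_def star.utail_def
  by (rule star_measure[symmetric, of _ "k / 2"]; use assms in auto)

text \<open>On the region where the sum of two jumps exceeds \<open>k\<close>, the payoff is a
  product of exponentials minus \<open>exp k\<close>; the product tilts both factors of the product
  measure at once.\<close>

lemma pairs_eq:
  assumes e: "0 < e"
  shows "pairs k e = star.sum_tail k e - exp k * sum_tail k e"
proof -
  let ?B = "{x::real. e < \<bar>x\<bar>}"
  have B: "?B \<in> sets borel" by measurable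
  have inner: "(LINT y:?B|N. payoff k (z + y)) =
      exp z * measure N_star ({k - z..} \<inter> ?B) - exp k * measure N ({k - z..} \<inter> ?B)" for z
  proof -
    let ?A = "{k - z..} \<inter> ?B"
    have A: "?A \<in> sets borel" using B by auto
    have i1: "set_integrable N ?A (\<lambda>y. 1::real)" by (rule integrable_away[OF A e, of _ 1]) auto
    have i2: "set_integrable N ?A exp"
      by (rule set_integrable_subset[OF big_integrable_exp[OF e]]) (use A in \<open>auto simp: sets_N\<close>)
    have "indicator ?B y *\<^sub>R payoff k (z + y) =
        exp z * (indicator ?A y *\<^sub>R exp y) - exp k * (indicator ?A y *\<^sub>R 1)" for y
      by (auto simp: indicator_def payoff_def exp_add[symmetric])
    then have "(LINT y:?B|N. payoff k (z + y)) = exp z * (LINT y:?A|N. exp y) - exp k * (LINT y:?A|N. 1)"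
      using i1 i2 unfolding set_lebesgue_integral_def set_integrable_def by simp
    then show ?thesis using star_measure[OF A e] measure_away[OF A e] by simp
  qed
  have m: "(\<lambda>z. measure N_star ({k - z..} \<inter> ?B)) \<in> borel_measurable borel"
    by (intro borel_measurable_mono star.sum_tail_mono e)
  note s = star_integral[OF m B]
  have "pairs k e = (LINT z:?B|N. exp z * measure N_star ({k - z..} \<inter> ?B) - exp k * measure N ({k - z..} \<inter> ?B))"
    unfolding pairs_def inner ..
  also have "\<dots> = (LINT z:?B|N. exp z * measure N_star ({k - z..} \<inter> ?B)) - exp k * (LINT z:?B|N. measure N ({k - z..} \<inter> ?B))"
    using sum_tail_integrable[OF e, of k] star.sum_tail_integrable[OF e, of k, unfolded s(2)]
    by (subst set_integral_diff(2)) auto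
  finally show ?thesis unfolding s(1)[symmetric] star.sum_tail_def[symmetric] sum_tail_def[symmetric] .
qed

text \<open>After \<open>d2_eq\<close> for both measures all pair terms and derivatives of \<nu>
  cancel. What remains is the tilted tail times the martingale expression split at \<open>e\<close>,
  which equals \<open>- p\<close>, the small-jump part \<open>q\<close> of the starred drift, and
  the two remainders. Each is bounded by a multiple of the small-jump variance.\<close>

lemma coef_approximates_d2:
  assumes k: "0 < k" and mart: "b + \<sigma>\<^sup>2 / 2 + (LINT x|N. exp x - 1 - x * indicator {-1..1} x) = 0"
  shows "\<exists>C e0. 0 < e0 \<and> (\<forall>e. 0 < e \<and> e \<le> e0 \<longrightarrow>
    \<bar>2 * coef k b \<sigma> e - (d2 k (b_star b \<sigma> \<nu>) \<sigma> (nu_star \<nu>) - exp k * d2 k b \<sigma> \<nu>)\<bar> \<le>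
      C * (LINT x:{x. \<bar>x\<bar> \<le> e}|N. x\<^sup>2))"
proof -
  obtain M where M: "0 \<le> M" "\<And>e. 0 < e \<Longrightarrow> e \<le> 1 \<Longrightarrow> e \<le> k / 2 \<Longrightarrow> \<bar>remainder k e\<bar> \<le> M * (LINT x:{x. \<bar>x\<bar> \<le> e}|N. x\<^sup>2)"
    using remainder_integrable_bound[OF k] by blast
  obtain M' where M': "0 \<le> M'" "\<And>e. 0 < e \<Longrightarrow> e \<le> 1 \<Longrightarrow> e \<le> k / 2 \<Longrightarrow>
      \<bar>star.remainder k e\<bar> \<le> M' * (LINT x:{x. \<bar>x\<bar> \<le> e}|N_star. x\<^sup>2)"
    using star.remainder_integrable_bound[OF k] by blast
  \<comment> \<open>For arguments of absolute value at most \<open>1\<close>,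
    \<open>exp x - 1\<close> is bounded by \<open>c * \<bar>x\<bar>\<close>; the same constant also
    bounds the second-order error in \<open>p\<close>.\<close>
  define c where "c = 1 + exp 1 / (2::real)"
  define U where "U = star.utail k"
  \<comment> \<open>One summand for each of \<open>p\<close>, \<open>q\<close>,
    \<open>star.remainder\<close> and \<open>remainder\<close>; the factor \<open>exp 1\<close>
    compares the tilted small-jump variance with the original one.\<close>
  define C where "C = 2 * U * c + 2 * exp k * \<nu> k * c + 2 * (M' * exp 1) + 2 * exp k * M"
  have U: "0 \<le> U" unfolding U_def by (rule star.utail_nonneg)
  have nk: "0 < \<nu> k" using pos k by simp
  show ?thesis
  \<comment> \<open>\<open>k / 3\<close> rather than \<open>k / 2\<close>, because
    \<open>d2_eq\<close> requires \<open>e\<close> strictly below \<open>k / 2\<close>.\<close>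
  proof (rule exI[of _ C], rule exI[of _ "min 1 (k / 3)"], intro conjI allI impI)
    show "0 < min 1 (k / 3)" using k by simp
    fix e assume a: "0 < e \<and> e \<le> min 1 (k / 3)"
    then have e: "0 < e" "e \<le> 1" "e < k / 2" "e \<le> k / 2" using k by auto
    define S where "S = {x::real. \<bar>x\<bar> \<le> e}"
    define A where "A = {x::real. e < \<bar>x\<bar> \<and> \<bar>x\<bar> \<le> 1}"
    define B where "B = {x::real. e < \<bar>x\<bar>}"
    have sets [measurable]: "S \<in> sets borel" "A \<in> sets borel" "B \<in> sets borel"
      unfolding S_def A_def B_def by measurable
    define v where "v = (LINT x:S|N. x\<^sup>2)"
    define p where "p = (LINT x:S|N. exp x - 1 - x)"
    define q where "q = (LINT x:S|N. x * (exp x - 1))"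
    define Xe where "Xe = (LINT x:A|N. x)"
    have small: "set_integrable N S f \<and> \<bar>LINT x:S|N. f x\<bar> \<le> c' * v"
      if f: "f \<in> borel_measurable borel" "\<And>x. \<bar>x\<bar> \<le> 1 \<Longrightarrow> \<bar>f x\<bar> \<le> c' * x\<^sup>2" for f :: "real \<Rightarrow> real" and c'
    proof -
      have m: "set_borel_measurable N {x. \<bar>x\<bar> \<le> e} f"
        using f(1) measurable_cong_sets[OF sets_N refl] by (simp add: set_borel_measurable_def)
      have b: "\<bar>f x\<bar> \<le> c' * x\<^sup>2" if "\<bar>x\<bar> \<le> e" for x using f(2)[of x] that e by simp
      show ?thesis unfolding S_def v_def using small_jump_integral[OF e(2) m b] by blast
    qed
    have ex: "0 \<le> exp x - 1 - x" "exp x - 1 - x \<le> exp 1 / 2 * x\<^sup>2" if "\<bar>x\<bar> \<le> 1" for x :: real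
    proof -
      show "0 \<le> exp x - 1 - x" using exp_ge_add_one_self[of x] by linarith
      show "exp x - 1 - x \<le> exp 1 / 2 * x\<^sup>2" using exp_minus_linear_le[OF that] by (simp add: mult.commute)
    qed
    have P: "set_integrable N S (\<lambda>x. exp x - 1 - x) \<and> \<bar>p\<bar> \<le> c * v"
      unfolding p_def
    proof (rule small)
      fix x :: real assume x: "\<bar>x\<bar> \<le> 1"
      have "exp 1 / 2 * x\<^sup>2 \<le> c * x\<^sup>2" by (intro mult_right_mono) (auto simp: c_def)
      then show "\<bar>exp x - 1 - x\<bar> \<le> c * x\<^sup>2" using ex[OF x] by linarith
    qed simp
    have Q: "set_integrable N S (\<lambda>x. x * (exp x - 1)) \<and> \<bar>q\<bar> \<le> c * v"
      unfolding q_def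
    proof (rule small)
      fix x :: real assume x: "\<bar>x\<bar> \<le> 1"
      have "x\<^sup>2 \<le> \<bar>x\<bar>" using mult_left_mono[OF x abs_ge_zero[of x]] by (simp add: power2_eq_square abs_mult_self_eq)
      then have "exp 1 / 2 * x\<^sup>2 \<le> exp 1 / 2 * \<bar>x\<bar>" by (intro mult_left_mono) auto
      then have "\<bar>exp x - 1\<bar> \<le> \<bar>x\<bar> + exp 1 / 2 * \<bar>x\<bar>" using ex[OF x] by linarith
      also have "\<dots> = c * \<bar>x\<bar>" by (simp add: c_def distrib_right)
      finally have "\<bar>exp x - 1\<bar> \<le> c * \<bar>x\<bar>" .
      then have "\<bar>x\<bar> * \<bar>exp x - 1\<bar> \<le> \<bar>x\<bar> * (c * \<bar>x\<bar>)" by (intro mult_left_mono) auto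
      then show "\<bar>x * (exp x - 1)\<bar> \<le> c * x\<^sup>2"
        by (simp add: abs_mult power2_eq_square abs_mult_self_eq mult_ac)
    qed simp
    have iA: "set_integrable N A (\<lambda>x. x)" "set_integrable N A (\<lambda>x. exp x * x)" "set_integrable N A (\<lambda>x. x * (exp x - 1))"
    proof -
      show i: "set_integrable N A (\<lambda>x. x)" by (rule integrable_away[OF _ e(1), of _ _ 1]) (auto simp: A_def)
      show j: "set_integrable N A (\<lambda>x. exp x * x)"
      proof (rule integrable_away[OF _ e(1), of _ _ "exp 1 * 1"])
        fix x assume "x \<in> A"
        then show "\<bar>exp x * x\<bar> \<le> exp 1 * 1" unfolding abs_mult by (intro mult_mono) (auto simp: A_def)
      qed (auto simp: A_def)
      show "set_integrable N A (\<lambda>x. x * (exp x - 1))"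
        using set_integral_diff(1)[OF j i] by (simp add: algebra_simps)
    qed
    have rate_star: "measure N_star B = (LINT x:B|N. exp x)"
      by (rule star_measure[OF _ e(1)]) (auto simp: B_def)
    have mart': "b - Xe + \<sigma>\<^sup>2 / 2 + measure N_star B - rate e = - p"
    proof -
      have i1: "set_integrable N B (\<lambda>x. 1::real)" unfolding B_def by (rule big_integrable_const[OF e(1)])
      have i2: "set_integrable N B exp" unfolding B_def by (rule big_integrable_exp[OF e(1)])
      have "exp x - 1 - x * indicator {-1..1} x = indicator S x *\<^sub>R (exp x - 1 - x) + indicator B x *\<^sub>R exp x
          - indicator B x *\<^sub>R 1 - indicator A x *\<^sub>R x" for x :: real
        using e by (auto simp: indicator_def S_def A_def B_def)
      then have "(LINT x|N. exp x - 1 - x * indicator {-1..1} x) = p + (LINT x:B|N. exp x) - (LINT x:B|N. 1) - Xe"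
        using P i1 i2 iA(1) unfolding p_def Xe_def set_lebesgue_integral_def set_integrable_def by simp
      also have "(LINT x:B|N. 1) = rate e"
        unfolding rate_def B_def by (rule measure_away[OF _ e(1)]) auto
      finally show ?thesis using mart unfolding rate_star by linarith
    qed
    \<comment> \<open>Between \<open>e\<close> and \<open>1\<close> the correction in
      \<open>b_star\<close> is precisely the change of compensator from \<open>N\<close> to
      \<open>N_star\<close>, so only its part \<open>q\<close> below \<open>e\<close>
      remains.\<close>
    have drift_star: "b_star b \<sigma> \<nu> - (LINT x:A|N_star. x) = b - Xe + \<sigma>\<^sup>2 + q"
    proof -
      have "(LBINT x:{-1..1}. x * (exp x - 1) * \<nu> x) = (LINT x:{-1..1}|N. x * (exp x - 1))"
        by (rule set_integral_N[symmetric]) auto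
      also have "\<dots> = (LINT x:S \<union> A|N. x * (exp x - 1))"
        using e by (intro arg_cong[where f="\<lambda>B. LINT x:B|N. x * (exp x - 1)"]) (auto simp: S_def A_def)
      also have "(LINT x:S \<union> A|N. x * (exp x - 1)) = q + (LINT x:A|N. x * (exp x - 1))"
        unfolding q_def using Q iA by (intro set_integral_Un) (auto simp: S_def A_def)
      also have "(LINT x:A|N. x * (exp x - 1)) = (LINT x:A|N. exp x * x - x)"
        by (intro set_lebesgue_integral_cong) (auto simp: sets_N algebra_simps)
      also have "\<dots> = (LINT x:A|N. exp x * x) - Xe"
        unfolding Xe_def by (rule set_integral_diff(2)[OF iA(2,1)])
      also have "(LINT x:A|N. exp x * x) = (LINT x:A|N_star. x)"
        by (rule star_integral(1)[symmetric]) auto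
      finally show ?thesis unfolding b_star_def by linarith
    qed
    have R: "\<bar>remainder k e\<bar> \<le> M * v" unfolding v_def S_def by (rule M(2)[OF e(1,2,4)])
    have "(LINT x:S|N_star. x\<^sup>2) \<le> exp 1 * v"
    proof -
      have i: "set_integrable N S (\<lambda>x. exp x * x\<^sup>2) \<and> \<bar>LINT x:S|N. exp x * x\<^sup>2\<bar> \<le> exp 1 * v"
        by (rule small) (auto simp: abs_mult intro!: mult_right_mono)
      then show ?thesis by (subst star_integral(1)) auto
    qed
    then have "M' * (LINT x:S|N_star. x\<^sup>2) \<le> M' * (exp 1 * v)" by (intro mult_left_mono M'(1))
    then have R': "\<bar>star.remainder k e\<bar> \<le> M' * exp 1 * v"
      using M'(2)[OF e(1,2,4)] unfolding S_def by simp
    have dstar: "deriv (nu_star \<nu>) k = exp k * \<nu> k + exp k * deriv \<nu> k"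
      using nu_star_deriv[of k] k by (intro DERIV_imp_deriv) auto
    have D: "d2 k b \<sigma> \<nu> = - \<sigma>\<^sup>2 * deriv \<nu> k + 2 * (b - Xe) * \<nu> k + sum_tail k e - 2 * rate e * utail k + 2 * remainder k e"
      unfolding d2_eq[OF k e(1,2,3)] Xe_def A_def rate_def ..
    have D': "d2 k (b_star b \<sigma> \<nu>) \<sigma> (nu_star \<nu>) = - \<sigma>\<^sup>2 * (exp k * \<nu> k + exp k * deriv \<nu> k) +
        2 * (b - Xe + \<sigma>\<^sup>2 + q) * (exp k * \<nu> k) + star.sum_tail k e - 2 * measure N_star B * U + 2 * star.remainder k e"
      unfolding star.d2_eq[OF k e(1,2,3)] drift_star[symmetric] A_def B_def dstar U_def by (simp add: nu_star_def)
    have co: "2 * coef k b \<sigma> e = - 2 * rate e * (U - exp k * utail k) + 2 * U * (b - Xe) +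
        (U + exp k * \<nu> k) * \<sigma>\<^sup>2 + star.sum_tail k e - exp k * sum_tail k e"
      unfolding coef_def pairs_eq[OF e(1)] tail1_eq[OF k] U_def drift_def Xe_def A_def by (simp add: field_simps)
    have "2 * coef k b \<sigma> e - (d2 k (b_star b \<sigma> \<nu>) \<sigma> (nu_star \<nu>) - exp k * d2 k b \<sigma> \<nu>) =
        2 * U * (b - Xe + \<sigma>\<^sup>2 / 2 + measure N_star B - rate e) - 2 * exp k * \<nu> k * q
        - 2 * star.remainder k e + 2 * exp k * remainder k e"
      unfolding co D D' by (simp add: algebra_simps)
    also have "\<dots> = - (2 * U * p) - 2 * exp k * \<nu> k * q - 2 * star.remainder k e + 2 * exp k * remainder k e"
      unfolding mart' by simp
    finally have eq: "2 * coef k b \<sigma> e - (d2 k (b_star b \<sigma> \<nu>) \<sigma> (nu_star \<nu>) - exp k * d2 k b \<sigma> \<nu>) = \<dots>" .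
    have "\<bar>2 * U * p\<bar> \<le> 2 * U * c * v" "\<bar>2 * exp k * \<nu> k * q\<bar> \<le> 2 * exp k * \<nu> k * c * v"
      "\<bar>2 * exp k * remainder k e\<bar> \<le> 2 * exp k * M * v"
      using P Q R U nk by (auto simp: abs_mult mult.assoc intro!: mult_left_mono)
    then show "\<bar>2 * coef k b \<sigma> e - (d2 k (b_star b \<sigma> \<nu>) \<sigma> (nu_star \<nu>) - exp k * d2 k b \<sigma> \<nu>)\<bar> \<le>
        C * (LINT x:{x. \<bar>x\<bar> \<le> e}|N. x\<^sup>2)"
      unfolding eq C_def v_def[symmetric, unfolded S_def] distrib_right using R' by linarith
  qed
qed

end

theorem proposition2p2:
  fixes M :: "'a measure" and X S :: "real \<Rightarrow> 'a \<Rightarrow> real"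
    and N :: "real measure" and \<nu> :: "real \<Rightarrow> real" and b \<sigma> S0 K k :: real
  assumes "levy_process_with_triplet M X \<sigma> b N"
    and "set_integrable N {x. 1 < \<bar>x\<bar>} exp"
    and "b + \<sigma>\<^sup>2 / 2 + (LINT x|N. exp x - 1 - x * indicator {-1..1} x) = 0"
    and "N = density lborel (\<lambda>x. ennreal (\<nu> x))"
    and "\<And>x. x \<noteq> 0 \<Longrightarrow> 0 < \<nu> x"
    and "\<nu> C1_differentiable_on (- {0})"
    and "\<And>\<epsilon>. 0 < \<epsilon> \<Longrightarrow> bdd_above (\<nu> ` {x. \<epsilon> < \<bar>x\<bar>})"
    and "set_integrable lborel {x. 1 < \<bar>x\<bar>} (\<lambda>x. exp x * \<nu> x)"
    and "\<And>\<epsilon>. 0 < \<epsilon> \<Longrightarrow> bdd_above ((\<lambda>x. exp x * \<nu> x) ` {x. \<epsilon> < \<bar>x\<bar>})"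
    and "0 < S0"
    and "\<And>t \<omega>. 0 \<le> t \<Longrightarrow> \<omega> \<in> space M \<Longrightarrow> S t \<omega> = S0 * exp (X t \<omega>)"
    and "S0 < K"
    and "k = ln (K / S0)"
  shows "(\<lambda>t. 1 / t * (LINT \<omega>|M. max 0 (S t \<omega> - K))
            - (S0 * (LBINT x. max 0 (exp x - exp k) * \<nu> x)
               + 1 / 2 * S0 * (d2 k (b_star b \<sigma> \<nu>) \<sigma> (nu_star \<nu>) - exp k * d2 k b \<sigma> \<nu>) * t))
         \<in> o[at_right 0](\<lambda>t. t)"
proof -
  have lp: "levy_process M X" and lm: "levy_measure N"
    and ch: "\<And>t u. 0 \<le> t \<Longrightarrow> char (distr M borel (X t)) u = exp (of_real t * levy_exponent b \<sigma> N u)"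
    using assms(1) unfolding levy_process_with_triplet_def by auto
  interpret P: levy_process M X by (rule lp)
  interpret L: exp_smooth_levy_density N \<nu>
  proof
    show "continuous_on (- {0}) \<nu>"
      using C1_differentiable_imp_continuous_on[OF assms(6)] .
  qed (use assms lm in auto)
  have k: "0 < k" using assms(10,12,13) by simp
  have K: "K = S0 * exp k" using assms(10,12,13) by simp
  have rd: "real_distribution (distr M borel (X t))" if "0 < t" for t
    using that by (intro real_distributionI P.prob_space_distr P.random_variable_at) auto
  define F0 where "F0 = L.tail1 k - exp k * L.utail k"
  define D where "D = d2 k (b_star b \<sigma> \<nu>) \<sigma> (nu_star \<nu>) - exp k * d2 k b \<sigma> \<nu>"
  define E where "E t = (LINT x|distr M borel (X t). payoff k x)" for t
  have E: "(LINT \<omega>|M. max 0 (S t \<omega> - K)) = S0 * E t" if t: "0 < t" for t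
  proof -
    have "max 0 (S t \<omega> - K) = S0 * payoff k (X t \<omega>)" if "\<omega> \<in> space M" for \<omega>
      using assms(10) assms(11)[of t \<omega>] t that
      unfolding K payoff_def by (simp add: max_def right_diff_distrib[symmetric] zero_le_mult_iff)
    then have "(LINT \<omega>|M. max 0 (S t \<omega> - K)) = (LINT \<omega>|M. S0 * payoff k (X t \<omega>))"
      by (intro Bochner_Integration.integral_cong) auto
    also have "\<dots> = S0 * E t"
      unfolding E_def using P.random_variable_at[of t] t by (subst integral_distr) auto
    finally show ?thesis .
  qed
  have F0: "(LBINT x. max 0 (exp x - exp k) * \<nu> x) = F0"
  proof -
    \<comment> \<open>The cut at \<open>k / 2\<close> is arbitrary: the payoff vanishes up to
      \<open>k\<close>, so the integral may be extended to the whole line.\<close>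
    have "F0 = (LINT z:{z. k / 2 < \<bar>z\<bar>}|N. payoff k z)"
      using L.big_jump_payoff[OF k, of "k / 2" 0] k by (simp add: F0_def)
    also have "\<dots> = (LBINT z:{z. k / 2 < \<bar>z\<bar>}. payoff k z * \<nu> z)" by (rule L.set_integral_N) auto
    also have "\<dots> = (LBINT z. payoff k z * \<nu> z)"
      unfolding set_lebesgue_integral_def using k payoff_zero[of _ k]
      by (intro Bochner_Integration.integral_cong) (auto simp: indicator_def)
    finally show ?thesis by (simp add: payoff_def)
  qed
  \<comment> \<open>Half of \<open>r\<close> pays for the expansion at level \<open>e\<close>, the
    other half for replacing \<open>coef\<close> by \<open>D / 2\<close>; the level \<open>e\<close>
    depends on \<open>r\<close> but not on \<open>t\<close>.\<close>
  have main: "\<forall>\<^sub>F t in at_right 0. \<bar>E t - t * F0 - t\<^sup>2 * (D / 2)\<bar> \<le> r * t\<^sup>2" if r: "0 < r" for r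
  proof -
    obtain C e0 where e0: "0 < e0" and C: "\<And>e. 0 < e \<Longrightarrow> e \<le> e0 \<Longrightarrow>
        \<bar>2 * L.coef k b \<sigma> e - D\<bar> \<le> C * (LINT x:{x. \<bar>x\<bar> \<le> e}|N. x\<^sup>2)"
      using L.coef_approximates_d2[OF k assms(3)] unfolding D_def by blast
    have r2: "0 < r / 2" using r by simp
    obtain e1 where e1: "0 < e1" and x1: "\<And>e. 0 < e \<Longrightarrow> e \<le> e1 \<Longrightarrow>
        \<forall>\<^sub>F t in at_right 0. \<bar>E t - t * F0 - t\<^sup>2 * L.coef k b \<sigma> e\<bar> \<le> r / 2 * t\<^sup>2"
      using L.payoff_expansion[of "\<lambda>t. distr M borel (X t)" b \<sigma> k "r / 2", OF rd ch[OF less_imp_le] k r2]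
      unfolding E_def F0_def by blast
    \<comment> \<open>Nothing is known about the sign of \<open>C\<close>; \<open>C'\<close> is
      positive and dominates it, so it can be divided by.\<close>
    define C' where "C' = \<bar>C\<bar> + 1"
    have rC: "0 < r / C'" using r by (simp add: C'_def)
    obtain e2 where e2: "0 < e2" and v: "\<And>e. 0 < e \<Longrightarrow> e \<le> e2 \<Longrightarrow> (LINT x:{x. \<bar>x\<bar> \<le> e}|N. x\<^sup>2) \<le> r / C'"
      using L.small_variance_tendsto[OF rC] by blast
    define e where "e = min e0 (min e1 e2)"
    have e: "0 < e" "e \<le> e0" "e \<le> e1" "e \<le> e2" using e0 e1 e2 by (auto simp: e_def)
    let ?v = "LINT x:{x. \<bar>x\<bar> \<le> e}|N. x\<^sup>2"
    have v0: "0 \<le> ?v" unfolding set_lebesgue_integral_def by (intro integral_nonneg_AE) auto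
    have "\<bar>2 * L.coef k b \<sigma> e - D\<bar> \<le> C * ?v" by (rule C[OF e(1,2)])
    also have "\<dots> \<le> C' * ?v" using v0 by (intro mult_right_mono) (auto simp: C'_def)
    also have "\<dots> \<le> C' * (r / C')" using v[OF e(1,4)] by (intro mult_left_mono) (auto simp: C'_def)
    also have "\<dots> = r" by (simp add: C'_def)
    finally have cD: "\<bar>L.coef k b \<sigma> e - D / 2\<bar> \<le> r / 2" by linarith
    from x1[OF e(1,3)] show ?thesis
    proof eventually_elim
      case (elim t)
      have "t\<^sup>2 * \<bar>L.coef k b \<sigma> e - D / 2\<bar> \<le> t\<^sup>2 * (r / 2)" by (intro mult_left_mono cD) simp
      then have "\<bar>t\<^sup>2 * L.coef k b \<sigma> e - t\<^sup>2 * (D / 2)\<bar> \<le> r / 2 * t\<^sup>2"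
        by (simp only: right_diff_distrib[symmetric] abs_mult abs_power2 mult.commute)
      with elim show ?case by linarith
    qed
  qed
  show ?thesis
  proof (rule landau_o.smallI)
    fix c :: real assume c: "0 < c"
    then have "0 < c / S0" using assms(10) by simp
    from main[OF this] eventually_at_right_less[of "0::real"]
    show "\<forall>\<^sub>F t in at_right 0. norm (1 / t * (LINT \<omega>|M. max 0 (S t \<omega> - K))
            - (S0 * (LBINT x. max 0 (exp x - exp k) * \<nu> x)
               + 1 / 2 * S0 * (d2 k (b_star b \<sigma> \<nu>) \<sigma> (nu_star \<nu>) - exp k * d2 k b \<sigma> \<nu>) * t)) \<le> c * norm t"
    proof eventually_elim
      case (elim t)
      have "1 / t * (S0 * E t) - (S0 * F0 + 1 / 2 * S0 * D * t) = S0 / t * (E t - t * F0 - t\<^sup>2 * (D / 2))"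
        using elim by (simp add: field_simps power2_eq_square)
      also have "\<bar>\<dots>\<bar> = S0 / t * \<bar>E t - t * F0 - t\<^sup>2 * (D / 2)\<bar>"
        using elim assms(10) by (simp add: abs_mult)
      also have "\<dots> \<le> S0 / t * (c / S0 * t\<^sup>2)"
        using elim assms(10) by (intro mult_left_mono) auto
      also have "\<dots> = c * \<bar>t\<bar>" using elim assms(10) by (simp add: power2_eq_square)
      finally show ?case unfolding E[OF elim(2)] F0 D_def by simp
    qed
  qed
qed

end
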